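(* The maps $\Phi\colon L^\infty(\Omega)\to\mathcal A$, $\Phi(b)=\phi_b$, and $\Theta\colon\mathcal A\to\mathcal C(\rho)$, $\Theta(\psi)=S_\psi$, are well defined, bijective and linear, and $\Theta\circ\Phi=\Lambda$, where $\Lambda(b)=V_b$.
   Context: Let $G$ be a metrizable, $\sigma$-compact locally compact abelian group (written additively) with Haar measure $\nu$, and let $(Y,\lambda)$ be a $\sigma$-finite measure space, with $L^2(G,\nu)$ and $L^2(Y,\lambda)$ separable. Let $H$ be a reproducing kernel Hilbert space of complex functions on $G\times Y$ whose inner product is that of $L^2(G\times Y,\nu\otimes\lambda)$, with reproducing kernel $(K_{x,y})_{(x,y)\in G\times Y}$ (so $f(x,y)=\langle f,K_{x,y}\rangle$ for $f\in H$). Assume $K_{x,y}(u,v)=K_{0,y}(u-x,v)$ for all $u,x\in G$, $v,y\in Y$, and $\sup_{v\in Y}\int_G|K_{0,y}(u,v)|\,d\nu(u)<\infty$ for every $y\in Y$. For $a\in G$ let $(\rho(a)f)(x,y)=f(x-a,y)$ (a unitary operator on $H$), and $\mathcal C(\rho)=\{S\in\mathcal B(H): S\rho(a)=\rho(a)S\ \forall a\in G\}$. Let $\widehat G$ be the dual group with Haar measure $\widehat\nu$ normalized so that the Fourier–Plancherel transform $F\colon L^2(G)\to L^2(\widehat G)$, $(Fh)(\xi)=\int_G h(u)\overline{\xi(u)}\,d\nu(u)$, is unitary. Define $L_{\xi,y}(v)=\int_G K_{0,y}(u,v)\overline{\xi(u)}\,d\nu(u)$ and $\Omega=\{\xi\in\widehat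 G:\exists y\in Y,\ L_{\xi,y}(y)>0\}$ with the restriction of $\widehat\nu$. Assume there is a measurable family $(q_\xi)_{\xi\in\Omega}$ with $L_{\xi,y}(v)=\overline{q_\xi(y)}q_\xi(v)$ for $\xi\in\Omega$, $y,v\in Y$. Define $R\colon H\to L^2(\Omega)$ by $(Rf)(\xi)=\int_Y((F\otimes I)f)(\xi,v)\overline{q_\xi(v)}\,d\lambda(v)$ ($F\otimes I$ = Fourier–Plancherel transform in the first variable); it is known that $R$ is unitary onto $L^2(\Omega)$. For $b\in L^\infty(\Omega)$ let $V_b=R^*M_bR$ with $M_b$ multiplication by $b$; it is known that $\Lambda\colon b\mapsto V_b$ is a *-isomorphism of $L^\infty(\Omega)$ onto $\mathcal C(\rho)$. Define $\phi_b(x,y,v)=\int_\Omega\xi(x)L_{\xi,v}(y)b(\xi)\,d\widehat\nu(\xi)$. Let $\mathcal A_0$ be the set of functions $\psi\colon G\times Y\times Y\to\mathbb C$ such that $\psi(\cdot,\cdot,v)\in H$ for every $v\in Y$ and $(u,v)\mapsto\overline{\psi(-u,y,v)}$ belongs to $H$ for every $y\in Y$. For $\psi\in\mathcal A_0$, $f\in H$, define $(S_\psi f)(x,y)=\int_{G\times Y}f(u,v)\psi(x-u,y,v)\,d\nu(u)\,d\lambda(v)$ (an absolutely convergent integral). Let $\mathcal A$ be the set of $\psi\in\mathcal A_0$ such that $S_\psi f\in H$ for every $f\in H$ and $S_\psi$ is a bounded operator on $H$. *)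

theory Defs
  imports "HOL-Analysis.Analysis" "HOL-Library.FuncSet"
begin

definition L2 :: "'a measure \<Rightarrow> ('a \<Rightarrow> complex) set" where
  "L2 M = {f. f \<in> borel_measurable M \<and> integrable M (\<lambda>x. (cmod (f x))^2)}"

definition l2norm :: "'a measure \<Rightarrow> ('a \<Rightarrow> complex) \<Rightarrow> real" where
  "l2norm M f = sqrt (\<integral>x. (cmod (f x))^2 \<partial>M)"

definition separable_L2 :: "'a measure \<Rightarrow> bool" where
  "separable_L2 M \<longleftrightarrow> (\<exists>D. countable D \<and> D \<subseteq> L2 M \<and>
      (\<forall>f\<in>L2 M. \<forall>e>0. \<exists>d\<in>D. l2norm M (\<lambda>x. f x - d x) < e))"

definition lc_metr_sigma_compact_group :: "'g::{ab_group_add,metric_space} itself \<Rightarrow> bool" where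
  "lc_metr_sigma_compact_group _ \<longleftrightarrow>
     continuous_on UNIV (\<lambda>p::'g\<times>'g. fst p + snd p) \<and>
     continuous_on UNIV (uminus :: 'g \<Rightarrow> 'g) \<and>
     (\<forall>x::'g. \<exists>U C. open U \<and> compact C \<and> x \<in> U \<and> U \<subseteq> C) \<and>
     (\<exists>C::nat \<Rightarrow> 'g set. (\<forall>n. compact (C n)) \<and> (\<Union>n. C n) = UNIV)"

definition haar_measure :: "'g::{ab_group_add,metric_space} measure \<Rightarrow> bool" where
  "haar_measure \<nu> \<longleftrightarrow> sets \<nu> = sets borel \<and>
     (\<forall>a. \<forall>A\<in>sets borel. emeasure \<nu> ((\<lambda>u. a + u) ` A) = emeasure \<nu> A) \<and>
     (\<forall>C. compact C \<longrightarrow> emeasure \<nu> C < top) \<and>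
     (\<forall>U. open U \<and> U \<noteq> {} \<longrightarrow> emeasure \<nu> U > 0)"

definition characters :: "('g::{ab_group_add,topological_space} \<Rightarrow> complex) set" where
  "characters = {\<xi>. continuous_on UNIV \<xi> \<and> (\<forall>u. cmod (\<xi> u) = 1) \<and>
                     (\<forall>u v. \<xi> (u + v) = \<xi> u * \<xi> v)}"

definition fourier :: "'g measure \<Rightarrow> ('g \<Rightarrow> complex) \<Rightarrow> ('g \<Rightarrow> complex) \<Rightarrow> complex" where
  "fourier \<nu> h \<xi> = (\<integral>u. h u * cnj (\<xi> u) \<partial>\<nu>)"

text \<open>Haar measure on the dual group, normalized so that the Fourier--Plancherel
  transform is unitary (isometric on L1 \<inter> L2 with dense range).  The sigma-algebra
  is the one generated by the evaluation maps.\<close>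

definition dual_plancherel_measure ::
  "'g::{ab_group_add,metric_space} measure \<Rightarrow> ('g \<Rightarrow> complex) measure \<Rightarrow> bool" where
  "dual_plancherel_measure \<nu> \<nu>h \<longleftrightarrow>
     space \<nu>h = characters \<and>
     sets \<nu>h = sigma_sets characters
        {(\<lambda>\<xi>. \<xi> u) -` B \<inter> characters | u B. B \<in> sets (borel :: complex measure)} \<and>
     sigma_finite_measure \<nu>h \<and>
     (\<forall>\<eta>\<in>characters. \<forall>A\<in>sets \<nu>h.
        emeasure \<nu>h ((\<lambda>\<xi> u. \<eta> u * \<xi> u) ` A) = emeasure \<nu>h A) \<and>
     (\<forall>h\<in>L2 \<nu>. integrable \<nu> h \<longrightarrow>
        fourier \<nu> h \<in> L2 \<nu>h \<and> l2norm \<nu>h (fourier \<nu> h) = l2norm \<nu> h) \<and>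
     (\<forall>g\<in>L2 \<nu>h. \<forall>e>0. \<exists>h\<in>L2 \<nu>. integrable \<nu> h \<and>
        l2norm \<nu>h (\<lambda>\<xi>. g \<xi> - fourier \<nu> h \<xi>) < e)"

definition rkhs_L2 :: "'a measure \<Rightarrow> ('a \<Rightarrow> complex) set \<Rightarrow> ('a \<Rightarrow> 'a \<Rightarrow> complex) \<Rightarrow> bool" where
  "rkhs_L2 M H Kp \<longleftrightarrow> H \<subseteq> L2 M \<and> (\<lambda>_. 0) \<in> H \<and>
     (\<forall>f\<in>H. \<forall>g\<in>H. \<forall>c::complex. (\<lambda>p. c * f p + g p) \<in> H) \<and>
     (\<forall>s. (\<forall>n. s n \<in> H) \<and>
          (\<forall>e>0. \<exists>N. \<forall>m\<ge>N. \<forall>n\<ge>N. l2norm M (\<lambda>p. s m p - s n p) < e) \<longrightarrow>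
          (\<exists>f\<in>H. (\<lambda>n. l2norm M (\<lambda>p. s n p - f p)) \<longlonglongrightarrow> 0)) \<and>
     (\<forall>p. Kp p \<in> H) \<and>
     (\<forall>f\<in>H. \<forall>p. f p = (\<integral>q. f q * cnj (Kp p q) \<partial>M))"

definition LK :: "'g measure \<Rightarrow> ('g::ab_group_add \<Rightarrow> 'y \<Rightarrow> ('g \<times> 'y \<Rightarrow> complex))
    \<Rightarrow> ('g \<Rightarrow> complex) \<Rightarrow> 'y \<Rightarrow> 'y \<Rightarrow> complex" where
  "LK \<nu> K \<xi> y v = (\<integral>u. K 0 y (u, v) * cnj (\<xi> u) \<partial>\<nu>)"

definition Omega :: "'g measure \<Rightarrow> ('g::{ab_group_add,topological_space} \<Rightarrow> 'y \<Rightarrow> ('g \<times> 'y \<Rightarrow> complex))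
    \<Rightarrow> ('g \<Rightarrow> complex) set" where
  "Omega \<nu> K = {\<xi>\<in>characters. \<exists>y. LK \<nu> K \<xi> y y \<in> \<real> \<and> Re (LK \<nu> K \<xi> y y) > 0}"

text \<open>Fourier--Plancherel transform in the first variable, F \<otimes> I, characterised by
  its inner products against the total family of products (F k) \<otimes> m.\<close>

definition FI :: "'g measure \<Rightarrow> ('g \<Rightarrow> complex) measure \<Rightarrow> 'y measure
    \<Rightarrow> ('g \<times> 'y \<Rightarrow> complex) \<Rightarrow> (('g \<Rightarrow> complex) \<times> 'y \<Rightarrow> complex)" where
  "FI \<nu> \<nu>h \<mu> f = (SOME g. g \<in> L2 (\<nu>h \<Otimes>\<^sub>M \<mu>) \<and>
     (\<forall>k m. k \<in> L2 \<nu> \<and> integrable \<nu> k \<and> m \<in> L2 \<mu> \<longrightarrow>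
        (\<integral>p. g p * cnj (fourier \<nu> k (fst p) * m (snd p)) \<partial>(\<nu>h \<Otimes>\<^sub>M \<mu>)) =
        (\<integral>p. f p * cnj (k (fst p) * m (snd p)) \<partial>(\<nu> \<Otimes>\<^sub>M \<mu>))))"

definition Rop :: "'g measure \<Rightarrow> ('g \<Rightarrow> complex) measure \<Rightarrow> 'y measure
    \<Rightarrow> (('g \<Rightarrow> complex) \<Rightarrow> 'y \<Rightarrow> complex) \<Rightarrow> ('g \<times> 'y \<Rightarrow> complex) \<Rightarrow> ('g \<Rightarrow> complex) \<Rightarrow> complex" where
  "Rop \<nu> \<nu>h \<mu> q f \<xi> = (\<integral>v. FI \<nu> \<nu>h \<mu> f (\<xi>, v) * cnj (q \<xi> v) \<partial>\<mu>)"

text \<open>V_b = R^* M_b R, i.e. V_b f is the element h of H with R h = b \<cdot> R f a.e. on \<Omega>.\<close>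

definition Vop :: "'g measure \<Rightarrow> ('g \<Rightarrow> complex) measure \<Rightarrow> 'y measure
    \<Rightarrow> ('g \<times> 'y \<Rightarrow> complex) set \<Rightarrow> ('g \<Rightarrow> complex) set
    \<Rightarrow> (('g \<Rightarrow> complex) \<Rightarrow> 'y \<Rightarrow> complex) \<Rightarrow> (('g \<Rightarrow> complex) \<Rightarrow> complex)
    \<Rightarrow> ('g \<times> 'y \<Rightarrow> complex) \<Rightarrow> ('g \<times> 'y \<Rightarrow> complex)" where
  "Vop \<nu> \<nu>h \<mu> H \<Omega> q b f = (THE h. h \<in> H \<and>
     (AE \<xi> in restrict_space \<nu>h \<Omega>. Rop \<nu> \<nu>h \<mu> q h \<xi> = b \<xi> * Rop \<nu> \<nu>h \<mu> q f \<xi>))"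

definition Linf :: "'a measure \<Rightarrow> ('a \<Rightarrow> complex) set" where
  "Linf N = {b. b \<in> borel_measurable N \<and> (\<exists>C. AE x in N. cmod (b x) \<le> C)}"

definition phi :: "'g measure \<Rightarrow> ('g \<Rightarrow> complex) measure \<Rightarrow> ('g \<Rightarrow> complex) set
    \<Rightarrow> ('g::ab_group_add \<Rightarrow> 'y \<Rightarrow> ('g \<times> 'y \<Rightarrow> complex))
    \<Rightarrow> (('g \<Rightarrow> complex) \<Rightarrow> complex) \<Rightarrow> 'g \<Rightarrow> 'y \<Rightarrow> 'y \<Rightarrow> complex" where
  "phi \<nu> \<nu>h \<Omega> K b x y v = (\<integral>\<xi>. \<xi> x * LK \<nu> K \<xi> v y * b \<xi> \<partial>(restrict_space \<nu>h \<Omega>))"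

definition bop :: "'a measure \<Rightarrow> ('a \<Rightarrow> complex) set
    \<Rightarrow> (('a \<Rightarrow> complex) \<Rightarrow> ('a \<Rightarrow> complex)) set" where
  "bop M H = {S. S \<in> H \<rightarrow> H \<and> S \<in> extensional H \<and>
     (\<forall>f\<in>H. \<forall>g\<in>H. \<forall>c::complex. S (\<lambda>p. c * f p + g p) = (\<lambda>p. c * S f p + S g p)) \<and>
     (\<exists>C. \<forall>f\<in>H. l2norm M (S f) \<le> C * l2norm M f)}"

definition rho :: "'g::ab_group_add \<Rightarrow> ('g \<times> 'y \<Rightarrow> complex) \<Rightarrow> ('g \<times> 'y \<Rightarrow> complex)" where
  "rho a f = (\<lambda>(x, y). f (x - a, y))"

definition Crho :: "('g::ab_group_add \<times> 'y) measure \<Rightarrow> ('g \<times> 'y \<Rightarrow> complex) set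
    \<Rightarrow> (('g \<times> 'y \<Rightarrow> complex) \<Rightarrow> ('g \<times> 'y \<Rightarrow> complex)) set" where
  "Crho M H = {S\<in>bop M H. \<forall>a. \<forall>f\<in>H. S (rho a f) = rho a (S f)}"

definition A0 :: "('g::ab_group_add \<times> 'y \<Rightarrow> complex) set \<Rightarrow> ('g \<Rightarrow> 'y \<Rightarrow> 'y \<Rightarrow> complex) set" where
  "A0 H = {\<psi>. (\<forall>v. (\<lambda>(x, y). \<psi> x y v) \<in> H) \<and> (\<forall>y. (\<lambda>(u, v). cnj (\<psi> (- u) y v)) \<in> H)}"

definition Sop :: "('g::ab_group_add \<times> 'y) measure \<Rightarrow> ('g \<Rightarrow> 'y \<Rightarrow> 'y \<Rightarrow> complex)
    \<Rightarrow> ('g \<times> 'y \<Rightarrow> complex) \<Rightarrow> ('g \<times> 'y \<Rightarrow> complex)" where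
  "Sop M \<psi> f = (\<lambda>(x, y). \<integral>p. f p * \<psi> (x - fst p) y (snd p) \<partial>M)"

definition Aset :: "('g::ab_group_add \<times> 'y) measure \<Rightarrow> ('g \<times> 'y \<Rightarrow> complex) set
    \<Rightarrow> ('g \<Rightarrow> 'y \<Rightarrow> 'y \<Rightarrow> complex) set" where
  "Aset M H = {\<psi>\<in>A0 H. restrict (Sop M \<psi>) H \<in> bop M H}"

end

theory Submission
  imports Defs
begin

text \<open>Let \<open>N\<close> be the restriction of the dual Haar measure to \<open>\<Omega>\<close>. Put
  \<open>e x y \<xi> = \<xi> (- x) * cnj (q \<xi> y)\<close> and \<open>J g (x, y) = \<langle>g, e x y\<rangle>\<close> for \<open>g \<in> L2 N\<close>. Plancherel in the first
  variable and the reproducing property give \<open>\<langle>K x y, K x' y'\<rangle> = \<langle>e x y, e x' y'\<rangle>\<close>, so \<open>J\<close> sends \<open>e x y\<close>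
  to \<open>K x y\<close> and is isometric on the span of the \<open>e x y\<close>. That span is dense: trigonometric
  polynomials are dense in L2 of every finite measure on the dual group, and by separability
  countably many of the functions \<open>q _ y\<close> already have no common zero on \<open>\<Omega>\<close>. Hence \<open>J\<close> is an isometry
  of \<open>L2 N\<close> into \<open>H\<close>; moreover almost every \<open>q \<xi>\<close> is a unit vector, from which \<open>J (R f) = f\<close> follows, so
  \<open>J\<close> is the inverse of the unitary \<open>R\<close>.

  Now \<open>\<phi>\<^sub>b(\<cdot>, \<cdot>, v) = J (b * e 0 v)\<close>, and moving \<open>b\<close> across the inner product shows that convolution with \<open>\<phi>\<^sub>b\<close>
  is \<open>V\<^sub>b\<close>. Conversely, if \<open>S\<close> commutes with the translations, then \<open>R S J\<close> commutes with all trigonometric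
  polynomials, so the norm bound for \<open>S\<close> improves to the pointwise bound \<open>|R S f| \<le> C |R f|\<close>. Applied
  to \<open>f - \<alpha> f\<^sub>0\<close> for a countable dense set of scalars \<open>\<alpha>\<close>, where \<open>R f\<^sub>0\<close> has no zeros, it yields
  \<open>R S f = b R f\<close> with \<open>b = R S f\<^sub>0 / R f\<^sub>0\<close>. Finally \<open>\<psi>\<close> is recovered from its convolution operator by
  applying the latter to the kernel functions.\<close>

section \<open>Square integrable functions\<close>

text \<open>No topology on the dual group is used: its sigma-algebra is the one generated by the
  evaluations. Density of trigonometric polynomials is therefore a statement about sets, namely that
  the sets with approximable indicator form a sigma-algebra making all evaluations measurable. Haar
  measure on the dual may be infinite, and then trigonometric polynomials need not be square
  integrable, so every application first multiplies by an integrable weight.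

  The norm of q_\<xi> comes from an idempotence. Under the transform, the identity K_{0,y}(x,v) =
  <K_{0,y}, K_{x,v}> should become L_{\<xi>,y}(v) = \<integral> L_{\<xi>,y}(w) cnj(L_{\<xi>,v}(w))
  d\<mu>(w). The left side is the transform of a section and square integrable in \<xi>, the right
  side is integrable and has that section as its inverse Fourier integral, so neither Plancherel nor
  L1 uniqueness alone compares them. For v = y the identity makes L_{\<xi>,y} vanish off \<Omega>;
  on \<Omega> it gives the norm 1. It holds off a null set that depends on y and v, which is why
  countably many points y must suffice.\<close>

definition ip :: "'a measure \<Rightarrow> ('a \<Rightarrow> complex) \<Rightarrow> ('a \<Rightarrow> complex) \<Rightarrow> complex" where
  "ip M f g = (\<integral>x. f x * cnj (g x) \<partial>M)"

lemma borel_measurable_cnj [measurable (raw)]: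
  "f \<in> borel_measurable M \<Longrightarrow> (\<lambda>x. cnj (f x)) \<in> borel_measurable M"
  by (rule borel_measurable_continuous_on[of cnj]) (auto intro: continuous_intros)

lemma L2_measurable: "f \<in> L2 M \<Longrightarrow> f \<in> borel_measurable M"
  by (simp add: L2_def)

lemma L2_integrable_square: "f \<in> L2 M \<Longrightarrow> integrable M (\<lambda>x. (cmod (f x))\<^sup>2)"
  by (simp add: L2_def)

lemma L2_iff_nn_integral:
  "f \<in> L2 M \<longleftrightarrow> f \<in> borel_measurable M \<and> (\<integral>\<^sup>+x. ennreal ((cmod (f x))\<^sup>2) \<partial>M) < \<infinity>"
  by (auto simp: L2_def integrable_iff_bounded)

lemma L2_bound:
  assumes "g \<in> L2 M" "f \<in> borel_measurable M" "AE x in M. cmod (f x) \<le> C * cmod (g x)"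
  shows "f \<in> L2 M"
proof -
  have "integrable M (\<lambda>x. C\<^sup>2 * (cmod (g x))\<^sup>2)"
    using assms(1) by (simp add: L2_def)
  moreover have "AE x in M. norm ((cmod (f x))\<^sup>2) \<le> norm (C\<^sup>2 * (cmod (g x))\<^sup>2)"
    using assms(3)
  proof eventually_elim
    case (elim x)
    then have "(cmod (f x))\<^sup>2 \<le> (C * cmod (g x))\<^sup>2" by (intro power_mono) auto
    then show ?case by (simp add: power_mult_distrib)
  qed
  ultimately have "integrable M (\<lambda>x. (cmod (f x))\<^sup>2)"
    by (elim Bochner_Integration.integrable_bound) (use assms(2) in measurable)
  then show ?thesis using assms(2) by (simp add: L2_def)
qed

lemma L2_scale: "f \<in> L2 M \<Longrightarrow> (\<lambda>x. c * f x) \<in> L2 M"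
  by (rule L2_bound[where g=f and C="cmod c"]) (auto simp: norm_mult L2_def)

lemma L2_cnj: "f \<in> L2 M \<Longrightarrow> (\<lambda>x. cnj (f x)) \<in> L2 M"
  by (rule L2_bound[where g=f and C=1]) (auto simp: L2_def)

lemma L2_add:
  assumes "f \<in> L2 M" "g \<in> L2 M"
  shows "(\<lambda>x. f x + g x) \<in> L2 M"
proof -
  have m: "f \<in> borel_measurable M" "g \<in> borel_measurable M"
    using assms by (auto simp: L2_def)
  have "integrable M (\<lambda>x. 2 * (cmod (f x))\<^sup>2 + 2 * (cmod (g x))\<^sup>2)"
    using assms by (simp add: L2_def)
  moreover have "norm ((cmod (f x + g x))\<^sup>2) \<le> norm (2 * (cmod (f x))\<^sup>2 + 2 * (cmod (g x))\<^sup>2)" for x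
  proof -
    have "(cmod (f x + g x))\<^sup>2 \<le> (cmod (f x) + cmod (g x))\<^sup>2"
      by (simp add: norm_triangle_ineq power_mono)
    also have "\<dots> \<le> 2 * (cmod (f x))\<^sup>2 + 2 * (cmod (g x))\<^sup>2"
      using zero_le_power2[of "cmod (f x) - cmod (g x)"] by (simp add: power2_eq_square algebra_simps)
    finally show ?thesis by simp
  qed
  ultimately have "integrable M (\<lambda>x. (cmod (f x + g x))\<^sup>2)"
    by (elim Bochner_Integration.integrable_bound) (use m in \<open>(measurable; fail) | (intro AE_I2; assumption)\<close>)+
  then show ?thesis using m by (simp add: L2_def)
qed

lemma L2_add_scale: "f \<in> L2 M \<Longrightarrow> g \<in> L2 M \<Longrightarrow> (\<lambda>x. f x + c * g x) \<in> L2 M"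
  by (intro L2_add L2_scale)

lemma L2_diff: "f \<in> L2 M \<Longrightarrow> g \<in> L2 M \<Longrightarrow> (\<lambda>x. f x - g x) \<in> L2 M"
  using L2_add_scale[of f M g "-1"] by simp

lemma L2_bounded_mult:
  assumes "f \<in> L2 M" "b \<in> borel_measurable M" "AE x in M. cmod (b x) \<le> C"
  shows "(\<lambda>x. b x * f x) \<in> L2 M"
proof (rule L2_bound[OF assms(1)])
  show "(\<lambda>x. b x * f x) \<in> borel_measurable M" using assms by (auto simp: L2_def)
  show "AE x in M. cmod (b x * f x) \<le> C * cmod (f x)"
    using assms(3) by eventually_elim (simp add: norm_mult mult_right_mono)
qed

lemma L2_cong_AE:
  assumes "f \<in> L2 M" "g \<in> borel_measurable M" "AE x in M. f x = g x"
  shows "g \<in> L2 M"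
  by (rule L2_bound[where g=f and C=1]) (use assms in auto)

lemma L2_mult_integrable:
  assumes "f \<in> L2 M" "g \<in> L2 M"
  shows "integrable M (\<lambda>x. f x * g x)"
proof -
  have m: "f \<in> borel_measurable M" "g \<in> borel_measurable M"
    using assms by (auto simp: L2_def)
  have "integrable M (\<lambda>x. (cmod (f x))\<^sup>2 + (cmod (g x))\<^sup>2)"
    using assms by (simp add: L2_def)
  moreover have "norm (f x * g x) \<le> norm ((cmod (f x))\<^sup>2 + (cmod (g x))\<^sup>2)" for x
    using zero_le_power2[of "cmod (f x) - cmod (g x)"]
      mult_nonneg_nonneg[OF norm_ge_zero[of "f x"] norm_ge_zero[of "g x"]]
    by (simp add: norm_mult power2_eq_square algebra_simps del: mult_nonneg_nonneg zero_le_mult_iff)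
  ultimately show ?thesis
    by (elim Bochner_Integration.integrable_bound) (use m in \<open>(measurable; fail) | (intro AE_I2; assumption)\<close>)+
qed

lemma L2_ip_integrable: "f \<in> L2 M \<Longrightarrow> g \<in> L2 M \<Longrightarrow> integrable M (\<lambda>x. f x * cnj (g x))"
  by (intro L2_mult_integrable L2_cnj)

lemma l2norm_nonneg [simp]: "l2norm M f \<ge> 0"
  by (simp add: l2norm_def)

lemma l2norm_square: "(l2norm M f)\<^sup>2 = (\<integral>x. (cmod (f x))\<^sup>2 \<partial>M)"
  by (simp add: l2norm_def)

lemma l2norm_square_ip: "complex_of_real ((l2norm M f)\<^sup>2) = ip M f f"
  by (simp add: l2norm_square ip_def complex_norm_square[symmetric] flip: integral_complex_of_real)

lemma l2norm_square_nn_integral: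
  "f \<in> L2 M \<Longrightarrow> ennreal ((l2norm M f)\<^sup>2) = (\<integral>\<^sup>+x. ennreal ((cmod (f x))\<^sup>2) \<partial>M)"
  unfolding l2norm_square by (rule nn_integral_eq_integral[symmetric]) (auto simp: L2_def)

lemma l2norm_cong_AE:
  assumes "f \<in> borel_measurable M" "g \<in> borel_measurable M" "AE x in M. f x = g x"
  shows "l2norm M f = l2norm M g"
  unfolding l2norm_def using assms by (intro arg_cong[where f=sqrt] integral_cong_AE) auto

lemma l2norm_cong: "(\<And>x. x \<in> space M \<Longrightarrow> f x = g x) \<Longrightarrow> l2norm M f = l2norm M g"
  unfolding l2norm_def by (intro arg_cong[where f=sqrt] Bochner_Integration.integral_cong) auto

lemma ip_cong_AE:
  assumes "f \<in> borel_measurable M" "f' \<in> borel_measurable M" "g \<in> borel_measurable M" "g' \<in> borel_measurable M"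
    and "AE x in M. f x = f' x" "AE x in M. g x = g' x"
  shows "ip M f g = ip M f' g'"
  unfolding ip_def using assms by (intro integral_cong_AE) auto

lemma l2norm_eq_0_iff:
  assumes "f \<in> L2 M"
  shows "l2norm M f = 0 \<longleftrightarrow> (AE x in M. f x = 0)"
  unfolding l2norm_def using assms by (simp add: L2_def integral_nonneg_eq_0_iff_AE)

lemma l2norm_mono:
  assumes "g \<in> L2 M" "f \<in> borel_measurable M" "AE x in M. cmod (f x) \<le> C * cmod (g x)" "C \<ge> 0"
  shows "l2norm M f \<le> C * l2norm M g"
proof -
  have f: "f \<in> L2 M" using assms by (auto intro: L2_bound)
  have "(l2norm M f)\<^sup>2 \<le> (\<integral>x. C\<^sup>2 * (cmod (g x))\<^sup>2 \<partial>M)"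
    unfolding l2norm_square
  proof (rule integral_mono_AE)
    show "AE x in M. (cmod (f x))\<^sup>2 \<le> C\<^sup>2 * (cmod (g x))\<^sup>2"
      using assms(3) 
    proof eventually_elim
      case (elim x)
      then have "(cmod (f x))\<^sup>2 \<le> (C * cmod (g x))\<^sup>2" by (intro power_mono) auto
      then show ?case by (simp add: power_mult_distrib)
    qed
  qed (use f assms in \<open>auto simp: L2_def\<close>)
  also have "\<dots> = (C * l2norm M g)\<^sup>2"
    by (simp add: l2norm_square power_mult_distrib)
  finally show ?thesis
    using assms(4) by (simp add: power2_le_iff_abs_le)
qed

lemma l2norm_scale: "l2norm M (\<lambda>x. c * f x) = cmod c * l2norm M f"
  by (simp add: l2norm_def norm_mult power_mult_distrib real_sqrt_mult)

lemma l2norm_minus_commute: "l2norm M (\<lambda>x. f x - g x) = l2norm M (\<lambda>x. g x - f x)"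
  by (simp add: l2norm_def norm_minus_commute)

section \<open>Inner product estimates and polarization\<close>

lemma Cauchy_Schwarz_L2:
  assumes "f \<in> L2 M" "g \<in> L2 M"
  shows "(\<integral>x. cmod (f x) * cmod (g x) \<partial>M) \<le> l2norm M f * l2norm M g"
proof -
  have m [measurable]: "f \<in> borel_measurable M" "g \<in> borel_measurable M"
    using assms by (auto simp: L2_def)
  let ?I = "\<integral>x. cmod (f x) * cmod (g x) \<partial>M"
  have int: "integrable M (\<lambda>x. cmod (f x) * cmod (g x))"
    using integrable_norm[OF L2_mult_integrable[OF assms]] by (simp add: norm_mult)
  have "ennreal (?I\<^sup>2) = (\<integral>\<^sup>+x. ennreal (cmod (f x)) * ennreal (cmod (g x)) \<partial>M)\<^sup>2"
    using nn_integral_eq_integral[OF int]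
    by (simp add: ennreal_power ennreal_mult)
  also have "\<dots> \<le> (\<integral>\<^sup>+x. ennreal (cmod (f x))^2 \<partial>M) * (\<integral>\<^sup>+x. ennreal (cmod (g x))^2 \<partial>M)"
    by (rule Cauchy_Schwarz_nn_integral) auto
  also have "\<dots> = ennreal ((l2norm M f)\<^sup>2 * (l2norm M g)\<^sup>2)"
    using assms by (simp add: l2norm_square_nn_integral ennreal_power ennreal_mult)
  finally have "?I\<^sup>2 \<le> (l2norm M f * l2norm M g)\<^sup>2"
    by (simp add: power_mult_distrib)
  then show ?thesis
    by (meson l2norm_nonneg mult_nonneg_nonneg power2_le_imp_le)
qed

lemma ip_Cauchy_Schwarz:
  assumes "f \<in> L2 M" "g \<in> L2 M"
  shows "cmod (ip M f g) \<le> l2norm M f * l2norm M g"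
proof -
  have "cmod (ip M f g) \<le> (\<integral>x. norm (f x * cnj (g x)) \<partial>M)"
    unfolding ip_def by (rule integral_norm_bound)
  also have "\<dots> \<le> l2norm M f * l2norm M g"
    using Cauchy_Schwarz_L2[OF assms] by (simp add: norm_mult)
  finally show ?thesis .
qed

lemma ip_add_left: "f \<in> L2 M \<Longrightarrow> g \<in> L2 M \<Longrightarrow> h \<in> L2 M \<Longrightarrow>
    ip M (\<lambda>x. f x + g x) h = ip M f h + ip M g h"
  by (simp add: ip_def distrib_right L2_ip_integrable)

lemma ip_diff_left: "f \<in> L2 M \<Longrightarrow> g \<in> L2 M \<Longrightarrow> h \<in> L2 M \<Longrightarrow>
    ip M (\<lambda>x. f x - g x) h = ip M f h - ip M g h"
  by (simp add: ip_def left_diff_distrib L2_ip_integrable)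

lemma ip_scale_left: "ip M (\<lambda>x. c * f x) h = c * ip M f h"
  by (simp add: ip_def mult.assoc)

lemma ip_cnj: "cnj (ip M f g) = ip M g f"
  unfolding ip_def Bochner_Integration.integral_cnj[symmetric] by (simp add: mult.commute)

lemma ip_diff_right: "f \<in> L2 M \<Longrightarrow> g \<in> L2 M \<Longrightarrow> h \<in> L2 M \<Longrightarrow>
    ip M h (\<lambda>x. f x - g x) = ip M h f - ip M h g"
  by (simp add: ip_def right_diff_distrib L2_ip_integrable)

lemma l2norm_add_scale_square:
  assumes "f \<in> L2 M" "g \<in> L2 M"
  shows "(l2norm M (\<lambda>x. f x + c * g x))\<^sup>2 =
    (l2norm M f)\<^sup>2 + 2 * Re (cnj c * ip M f g) + (cmod c)\<^sup>2 * (l2norm M g)\<^sup>2"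
proof -
  have eq: "(f x + c * g x) * cnj (f x + c * g x) =
      f x * cnj (f x) + cnj c * (f x * cnj (g x)) + c * (g x * cnj (f x)) + c * cnj c * (g x * cnj (g x))" for x
    by (simp add: algebra_simps)
  have "complex_of_real ((l2norm M (\<lambda>x. f x + c * g x))\<^sup>2) =
     ip M f f + cnj c * ip M f g + c * ip M g f + c * cnj c * ip M g g"
    unfolding l2norm_square_ip ip_def eq using assms by (simp add: L2_ip_integrable)
  also have "ip M g f = cnj (ip M f g)" by (simp add: ip_cnj)
  finally have "Re (complex_of_real ((l2norm M (\<lambda>x. f x + c * g x))\<^sup>2)) =
     Re (complex_of_real ((l2norm M f)\<^sup>2) + cnj c * ip M f g + cnj (cnj c * ip M f g)
      + complex_of_real ((cmod c)\<^sup>2 * (l2norm M g)\<^sup>2))"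
    by (simp add: l2norm_square_ip[symmetric] complex_norm_square[symmetric])
  then show ?thesis by simp
qed

text \<open>Polarization: c = 1 and c = -1 isolate the real part of the inner product, c = \<i> and
  c = -\<i> the imaginary part. The two measures may differ, so the isometry of a transform between
  them yields its Parseval identity.\<close>

lemma ip_eq_if_l2norm_eq:
  assumes "f \<in> L2 M" "g \<in> L2 M" "f' \<in> L2 M'" "g' \<in> L2 M'"
    and eq: "\<And>c. l2norm M (\<lambda>x. f x + c * g x) = l2norm M' (\<lambda>x. f' x + c * g' x)"
  shows "ip M f g = ip M' f' g'"
proof -
  have *: "(l2norm M f)\<^sup>2 + 2 * Re (cnj c * ip M f g) + (cmod c)\<^sup>2 * (l2norm M g)\<^sup>2 =
    (l2norm M' f')\<^sup>2 + 2 * Re (cnj c * ip M' f' g') + (cmod c)\<^sup>2 * (l2norm M' g')\<^sup>2" for c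
    using eq[of c] l2norm_add_scale_square[OF assms(1,2), of c] l2norm_add_scale_square[OF assms(3,4), of c]
    by simp
  have "Re (ip M f g) = Re (ip M' f' g')" using *[of 1] *[of "-1"] by simp
  moreover have "Im (ip M f g) = Im (ip M' f' g')" using *[of \<i>] *[of "-\<i>"] by simp
  ultimately show ?thesis by (simp add: complex_eq_iff)
qed

lemma l2norm_triangle:
  assumes "f \<in> L2 M" "g \<in> L2 M"
  shows "l2norm M (\<lambda>x. f x + g x) \<le> l2norm M f + l2norm M g"
proof -
  have "(l2norm M (\<lambda>x. f x + g x))\<^sup>2 = (l2norm M f)\<^sup>2 + 2 * Re (ip M f g) + (l2norm M g)\<^sup>2"
    using l2norm_add_scale_square[OF assms, of 1] by simp
  also have "Re (ip M f g) \<le> l2norm M f * l2norm M g"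
    using ip_Cauchy_Schwarz[OF assms] complex_Re_le_cmod order_trans by blast
  finally have "(l2norm M (\<lambda>x. f x + g x))\<^sup>2 \<le> (l2norm M f + l2norm M g)\<^sup>2"
    by (simp add: power2_sum)
  then show ?thesis by (meson l2norm_nonneg add_nonneg_nonneg power2_le_imp_le)
qed

lemma l2norm_triangle_diff:
  assumes "f \<in> L2 M" "g \<in> L2 M" "h \<in> L2 M"
  shows "l2norm M (\<lambda>x. f x - h x) \<le> l2norm M (\<lambda>x. f x - g x) + l2norm M (\<lambda>x. g x - h x)"
  using l2norm_triangle[OF L2_diff[OF assms(1,2)] L2_diff[OF assms(2,3)]] by simp

section \<open>Limits and completeness in L2\<close>

lemma ip_tendsto_left:
  assumes "\<And>n. s n \<in> L2 M" "f \<in> L2 M" "g \<in> L2 M"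
    and "(\<lambda>n. l2norm M (\<lambda>x. s n x - f x)) \<longlonglongrightarrow> 0"
  shows "(\<lambda>n. ip M (s n) g) \<longlonglongrightarrow> ip M f g"
proof -
  have "(\<lambda>n. l2norm M (\<lambda>x. s n x - f x) * l2norm M g) \<longlonglongrightarrow> 0"
    using tendsto_mult_right[OF assms(4), of "l2norm M g"] by simp
  then have "(\<lambda>n. ip M (s n) g - ip M f g) \<longlonglongrightarrow> 0"
    by (rule Lim_null_comparison[rotated])
       (use assms in \<open>auto simp: ip_diff_left[symmetric] intro!: always_eventually ip_Cauchy_Schwarz L2_diff\<close>)
  then show ?thesis by (simp add: LIM_zero_iff)
qed

lemma L2_dominated_convergence:
  assumes [measurable]: "\<And>n. s n \<in> borel_measurable M" "f \<in> borel_measurable M" and w: "w \<in> L2 M"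
    and b: "\<And>n. AE x in M. cmod (s n x - f x) \<le> C * cmod (w x)"
    and lim: "AE x in M. (\<lambda>n. s n x) \<longlonglongrightarrow> f x"
  shows "(\<lambda>n. l2norm M (\<lambda>x. s n x - f x)) \<longlonglongrightarrow> 0"
proof -
  have "(\<lambda>n. \<integral>x. (cmod (s n x - f x))\<^sup>2 \<partial>M) \<longlonglongrightarrow> (\<integral>x. 0 \<partial>M)"
  proof (rule integral_dominated_convergence[where w="\<lambda>x. C\<^sup>2 * (cmod (w x))\<^sup>2"])
    show "integrable M (\<lambda>x. C\<^sup>2 * (cmod (w x))\<^sup>2)" using w by (simp add: L2_def)
    show "AE x in M. (\<lambda>i. (cmod (s i x - f x))\<^sup>2) \<longlonglongrightarrow> 0"
      using lim
    proof eventually_elim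
      case (elim x)
      then have "(\<lambda>i. (cmod (s i x - f x))\<^sup>2) \<longlonglongrightarrow> (cmod (f x - f x))\<^sup>2"
        by (intro tendsto_intros)
      then show ?case by simp
    qed
    show "AE x in M. norm ((cmod (s i x - f x))\<^sup>2) \<le> C\<^sup>2 * (cmod (w x))\<^sup>2" for i
      using b[of i] 
    proof eventually_elim
      case (elim x)
      then have "(cmod (s i x - f x))\<^sup>2 \<le> (C * cmod (w x))\<^sup>2" by (intro power_mono) auto
      then show ?case by (simp add: power_mult_distrib)
    qed
  qed auto
  then have "(\<lambda>n. sqrt (\<integral>x. (cmod (s n x - f x))\<^sup>2 \<partial>M)) \<longlonglongrightarrow> sqrt 0"
    by (intro tendsto_intros) simp
  then show ?thesis by (simp add: l2norm_def)
qed

text \<open>Riesz-Fischer. It supplies the limit when the partial Fourier transform is extended by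
  continuity in \<open>FI_exists\<close>.\<close>

lemma L2_complete:
  assumes s: "\<And>n. s n \<in> L2 M"
    and cauchy: "\<And>e. e > 0 \<Longrightarrow> \<exists>N. \<forall>m\<ge>N. \<forall>n\<ge>N. l2norm M (\<lambda>x. s m x - s n x) < e"
  obtains f where "f \<in> L2 M" "(\<lambda>n. l2norm M (\<lambda>x. s n x - f x)) \<longlonglongrightarrow> 0"
proof -
  have [measurable]: "s n \<in> borel_measurable M" for n using s by (auto simp: L2_def)
  \<comment> \<open>The rate 1/4 leaves room for the weight 4^k: the functions
    \<open>4^k * (cmod (D k x))\<^sup>2\<close> have integrals at most (1/4)^k, and summability of
    these functions at x forces |D k x| = O(2^(-k)).\<close>
  have "\<exists>r. \<forall>k. (\<forall>m\<ge>r k. \<forall>n\<ge>r k. l2norm M (\<lambda>x. s m x - s n x) < (1/4)^k) \<and> r k < r (Suc k)"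
  proof (rule dependent_nat_choice)
    show "\<exists>N. \<forall>m\<ge>N. \<forall>n\<ge>N. l2norm M (\<lambda>x. s m x - s n x) < (1/4)^0" using cauchy[of 1] by simp
    fix x :: nat and k
    obtain N where "\<forall>m\<ge>N. \<forall>n\<ge>N. l2norm M (\<lambda>x. s m x - s n x) < (1/4)^Suc k"
      using cauchy[of "(1/4)^Suc k"] by auto
    then show "\<exists>y. (\<forall>m\<ge>y. \<forall>n\<ge>y. l2norm M (\<lambda>x. s m x - s n x) < (1/4)^Suc k) \<and> x < y"
      by (intro exI[of _ "max N (Suc x)"]) auto
  qed
  then obtain r where r: "\<And>k m n. m \<ge> r k \<Longrightarrow> n \<ge> r k \<Longrightarrow> l2norm M (\<lambda>x. s m x - s n x) < (1/4)^k"
    and "\<And>k. r k < r (Suc k)" by blast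
  then have mono: "strict_mono r" by (simp add: strict_mono_Suc_iff)
  define D where "D k x = s (r (Suc k)) x - s (r k) x" for k x
  have DL2: "D k \<in> L2 M" for k unfolding D_def by (intro L2_diff s)
  have [measurable]: "D k \<in> borel_measurable M" for k unfolding D_def by simp
  have Dn: "l2norm M (D k) \<le> (1/4)^k" for k
    unfolding D_def using r[of k "r (Suc k)" "r k"] mono
    by (simp add: less_imp_le strict_mono_less_eq)
  have "(\<integral>\<^sup>+x. (\<Sum>k. ennreal (4^k * (cmod (D k x))\<^sup>2)) \<partial>M) = (\<Sum>k. ennreal (4^k * (l2norm M (D k))\<^sup>2))"
    by (subst nn_integral_suminf)
       (auto simp: ennreal_mult nn_integral_cmult l2norm_square_nn_integral DL2)
  also have "\<dots> \<le> (\<Sum>k. ennreal ((1/4)^k))"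
  proof (intro suminf_le ennreal_leI)
    fix k
    have "4^k * (l2norm M (D k))\<^sup>2 \<le> 4^k * ((1/4)^k)\<^sup>2"
      using Dn by (intro mult_left_mono power_mono) auto
    also have "\<dots> = (1/4)^k" by (simp add: power2_eq_square power_one_over field_simps)
    finally show "4^k * (l2norm M (D k))\<^sup>2 \<le> (1/4)^k" .
  qed auto
  also have "\<dots> = ennreal (\<Sum>k. (1/4)^k)"
    by (intro suminf_ennreal2) (auto intro: summable_geometric)
  finally have "(\<integral>\<^sup>+x. (\<Sum>k. ennreal (4^k * (cmod (D k x))\<^sup>2)) \<partial>M) \<noteq> \<infinity>"
    by (auto simp: top_unique)
  then have "AE x in M. (\<Sum>k. ennreal (4^k * (cmod (D k x))\<^sup>2)) \<noteq> \<infinity>"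
    by (intro nn_integral_PInf_AE) auto
  then have conv: "AE x in M. convergent (\<lambda>k. s (r k) x)"
  proof eventually_elim
    case (elim x)
    have sm: "summable (\<lambda>k. 4^k * (cmod (D k x))\<^sup>2)"
      using elim by (intro summable_suminf_not_top) (auto simp: top_unique)
    then obtain B where B: "\<And>k. norm (4^k * (cmod (D k x))\<^sup>2) \<le> B"
      using summable_imp_Bseq[OF sm] unfolding Bseq_def by blast
    have "cmod (D k x) \<le> sqrt B * (1/2)^k" for k
    proof -
      have "(2^k * cmod (D k x))\<^sup>2 \<le> B"
        using B[of k] power_mult_distrib[of "2::real" 2 k] by (simp add: power2_eq_square mult.assoc mult.left_commute)
      then have "2^k * cmod (D k x) \<le> sqrt B"
        by (simp add: real_le_rsqrt)
      then show ?thesis by (simp add: field_simps power_one_over)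
    qed
    moreover have "summable (\<lambda>k. sqrt B * (1/2)^k)"
      by (intro summable_mult summable_geometric) auto
    ultimately have "summable (\<lambda>k. D k x)"
      by (intro summable_comparison_test[where g="\<lambda>k. sqrt B * (1/2)^k" and f="\<lambda>k. D k x"] exI[of _ 0] allI impI)
    then have "convergent (\<lambda>n. \<Sum>k<n. D k x)"
      by (simp add: summable_iff_convergent)
    moreover have "(\<Sum>k<n. D k x) = s (r n) x - s (r 0) x" for n
      unfolding D_def by (rule sum_lessThan_telescope)
    ultimately have "convergent (\<lambda>n. s (r n) x - s (r 0) x)" by simp
    then show ?case
      using convergent_add[OF _ convergent_const[of "s (r 0) x"]] by fastforce
  qed
  define f where "f x = lim (\<lambda>k. s (r k) x)" for x
  have [measurable]: "f \<in> borel_measurable M" unfolding f_def by measurable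
  have lim: "AE x in M. (\<lambda>k. s (r k) x) \<longlonglongrightarrow> f x"
    using conv by eventually_elim (simp add: f_def convergent_LIMSEQ_iff)
  \<comment> \<open>Fatou along the subsequence carries a bound on \<open>s n - s m\<close> over to
    \<open>s n - f\<close>. It serves twice: for membership of f in L2 and for convergence of the
    whole sequence.\<close>
  have fatou: "(\<integral>\<^sup>+x. ennreal ((cmod (s n x - f x))\<^sup>2) \<partial>M) \<le> ennreal (e\<^sup>2)"
    if "\<And>m. m \<ge> N \<Longrightarrow> l2norm M (\<lambda>x. s n x - s m x) \<le> e" "e \<ge> 0" for n e N
  proof -
    have "(\<integral>\<^sup>+x. ennreal ((cmod (s n x - f x))\<^sup>2) \<partial>M) =
        (\<integral>\<^sup>+x. liminf (\<lambda>k. ennreal ((cmod (s n x - s (r k) x))\<^sup>2)) \<partial>M)"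
    proof (rule nn_integral_cong_AE)
      show "AE x in M. ennreal ((cmod (s n x - f x))\<^sup>2) = liminf (\<lambda>k. ennreal ((cmod (s n x - s (r k) x))\<^sup>2))"
        using lim
      proof eventually_elim
        case (elim x)
        have "(\<lambda>k. ennreal ((cmod (s n x - s (r k) x))\<^sup>2)) \<longlonglongrightarrow> ennreal ((cmod (s n x - f x))\<^sup>2)"
          by (intro tendsto_intros elim)
        from lim_imp_Liminf[OF _ this] show ?case by simp
      qed
    qed
    also have "\<dots> \<le> liminf (\<lambda>k. \<integral>\<^sup>+x. ennreal ((cmod (s n x - s (r k) x))\<^sup>2) \<partial>M)"
      by (intro nn_integral_liminf) auto
    also have "\<dots> \<le> liminf (\<lambda>k. ennreal (e\<^sup>2))"
    proof (rule Liminf_mono)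
      have "eventually (\<lambda>k. r k \<ge> N) sequentially"
        using filterlim_subseq[OF mono] by (auto simp: filterlim_at_top)
      then show "\<forall>\<^sub>F k in sequentially. (\<integral>\<^sup>+x. ennreal ((cmod (s n x - s (r k) x))\<^sup>2) \<partial>M) \<le> ennreal (e\<^sup>2)"
        by eventually_elim
          (use that in \<open>auto simp: l2norm_square_nn_integral[symmetric] L2_diff s intro!: ennreal_leI power_mono\<close>)
    qed
    also have "\<dots> = ennreal (e\<^sup>2)" by (simp add: Liminf_const)
    finally show ?thesis .
  qed
  have L2d: "(\<lambda>x. s n x - f x) \<in> L2 M" for n
  proof -
    obtain N where N: "\<And>m n. m \<ge> N \<Longrightarrow> n \<ge> N \<Longrightarrow> l2norm M (\<lambda>x. s m x - s n x) < 1" using cauchy[of 1] by auto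
    have "(\<integral>\<^sup>+x. ennreal ((cmod (s N x - f x))\<^sup>2) \<partial>M) \<le> ennreal (1\<^sup>2)"
      using N by (intro fatou[where N=N]) (auto intro: less_imp_le)
    then have "(\<lambda>x. s N x - f x) \<in> L2 M"
      unfolding L2_iff_nn_integral by (auto intro: le_less_trans)
    from L2_add[OF L2_diff[OF s[of n] s[of N]] this] show ?thesis by simp
  qed
  have "f \<in> L2 M"
    using L2_diff[OF s[of 0] L2d[of 0]] by simp
  moreover have "(\<lambda>n. l2norm M (\<lambda>x. s n x - f x)) \<longlonglongrightarrow> 0"
  proof (rule LIMSEQ_I)
    fix e :: real assume "e > 0"
    then obtain N where N: "\<And>m n. m \<ge> N \<Longrightarrow> n \<ge> N \<Longrightarrow> l2norm M (\<lambda>x. s m x - s n x) < e/2" using cauchy[of "e/2"] by auto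
    have "l2norm M (\<lambda>x. s n x - f x) < e" if "n \<ge> N" for n
    proof -
      have "ennreal ((l2norm M (\<lambda>x. s n x - f x))\<^sup>2) \<le> ennreal ((e/2)\<^sup>2)"
        unfolding l2norm_square_nn_integral[OF L2d]
        using N that \<open>e > 0\<close> by (intro fatou[where N=N]) (auto intro: less_imp_le)
      then have "l2norm M (\<lambda>x. s n x - f x) \<le> e/2"
        using \<open>e > 0\<close> by (simp add: power2_le_iff_abs_le)
      then show ?thesis using \<open>e > 0\<close> by simp
    qed
    then show "\<exists>N. \<forall>n\<ge>N. norm (l2norm M (\<lambda>x. s n x - f x) - 0) < e" by auto
  qed
  ultimately show ?thesis by (rule that)
qed

lemma indicator_L2:
  assumes "A \<in> sets M" "emeasure M A < \<infinity>"
  shows "(indicator A :: _ \<Rightarrow> complex) \<in> L2 M"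
proof -
  have "(\<lambda>x. (cmod (indicator A x))\<^sup>2) = indicator A" by (auto simp: indicator_def)
  moreover have "integrable M (indicator A :: _ \<Rightarrow> real)" using assms by (intro integrable_real_indicator)
  ultimately show ?thesis using assms by (simp add: L2_def)
qed

section \<open>Closures of subsets of L2\<close>

definition L2_closure :: "'a measure \<Rightarrow> ('a \<Rightarrow> complex) set \<Rightarrow> ('a \<Rightarrow> complex) set" where
  "L2_closure M A = {g \<in> L2 M. \<forall>e>0. \<exists>a\<in>A. l2norm M (\<lambda>x. g x - a x) < e}"

lemma L2_closure_L2: "g \<in> L2_closure M A \<Longrightarrow> g \<in> L2 M"
  by (simp add: L2_closure_def)

lemma L2_closureE:
  assumes "g \<in> L2_closure M A" "e > 0"
  obtains a where "a \<in> A" "l2norm M (\<lambda>x. g x - a x) < e"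
  using assms unfolding L2_closure_def by blast

lemma L2_closure_base: "A \<subseteq> L2 M \<Longrightarrow> a \<in> A \<Longrightarrow> a \<in> L2_closure M A"
  unfolding L2_closure_def by (auto simp: l2norm_def intro!: bexI[of _ a])

lemma L2_closure_closed:
  assumes A: "A \<subseteq> L2 M" and g: "g \<in> L2 M"
    and ex: "\<And>e. e > 0 \<Longrightarrow> \<exists>h\<in>L2_closure M A. l2norm M (\<lambda>x. g x - h x) < e"
  shows "g \<in> L2_closure M A"
  unfolding L2_closure_def
proof (intro CollectI conjI allI impI g)
  fix e :: real assume "e > 0"
  then have "e / 2 > 0" by simp
  obtain h where h: "h \<in> L2_closure M A" "l2norm M (\<lambda>x. g x - h x) < e / 2"
    using ex[OF \<open>e / 2 > 0\<close>] by blast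
  obtain a where a: "a \<in> A" "l2norm M (\<lambda>x. h x - a x) < e / 2"
    using L2_closureE[OF h(1) \<open>e / 2 > 0\<close>] by blast
  have "l2norm M (\<lambda>x. g x - a x) < e"
    using l2norm_triangle_diff[OF g L2_closure_L2[OF h(1)], of a] A a h(2) by auto
  then show "\<exists>a\<in>A. l2norm M (\<lambda>x. g x - a x) < e" using a(1) by (intro bexI)
qed

lemma L2_closure_limit:
  assumes "A \<subseteq> L2 M" "\<And>n. s n \<in> L2_closure M A" "g \<in> L2 M"
    and lim: "(\<lambda>n. l2norm M (\<lambda>x. s n x - g x)) \<longlonglongrightarrow> 0"
  shows "g \<in> L2_closure M A"
proof (rule L2_closure_closed[OF assms(1,3)])
  fix e :: real assume "e > 0"
  then obtain n where "norm (l2norm M (\<lambda>x. s n x - g x) - 0) < e"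
    using LIMSEQ_D[OF lim] by blast
  then show "\<exists>h\<in>L2_closure M A. l2norm M (\<lambda>x. g x - h x) < e"
    using assms(2) by (intro bexI[of _ "s n"]) (auto simp: l2norm_minus_commute)
qed

lemma L2_closure_add:
  assumes A: "A \<subseteq> L2 M" and add: "\<And>a b. a \<in> A \<Longrightarrow> b \<in> A \<Longrightarrow> (\<lambda>x. a x + b x) \<in> A"
    and g: "g \<in> L2_closure M A" and h: "h \<in> L2_closure M A"
  shows "(\<lambda>x. g x + h x) \<in> L2_closure M A"
proof (rule L2_closure_closed[OF A])
  note L = L2_closure_L2[OF g] L2_closure_L2[OF h]
  then show "(\<lambda>x. g x + h x) \<in> L2 M" by (rule L2_add)
  fix e :: real assume "e > 0"
  then have "e / 2 > 0" by simp
  obtain a where a: "a \<in> A" "l2norm M (\<lambda>x. g x - a x) < e / 2" using L2_closureE[OF g \<open>e / 2 > 0\<close>] .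
  obtain b where b: "b \<in> A" "l2norm M (\<lambda>x. h x - b x) < e / 2" using L2_closureE[OF h \<open>e / 2 > 0\<close>] .
  have "a \<in> L2 M" "b \<in> L2 M" using A a b by auto
  from l2norm_triangle[OF L2_diff[OF L(1) this(1)] L2_diff[OF L(2) this(2)]] a(2) b(2)
  have "l2norm M (\<lambda>x. g x + h x - (a x + b x)) < e" by (simp add: algebra_simps)
  then show "\<exists>k\<in>L2_closure M A. l2norm M (\<lambda>x. g x + h x - k x) < e"
    using L2_closure_base[OF A add[OF a(1) b(1)]] by (intro bexI)
qed

section \<open>Trigonometric polynomials on the dual group\<close>

lemma character_norm: "\<xi> \<in> characters \<Longrightarrow> cmod (\<xi> u) = 1"
  by (simp add: characters_def)

lemma character_add: "\<xi> \<in> characters \<Longrightarrow> \<xi> (u + v) = \<xi> u * \<xi> v"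
  by (simp add: characters_def)

lemma character_zero: "\<xi> \<in> characters \<Longrightarrow> \<xi> 0 = 1"
  using character_add[of \<xi> 0 0] character_norm[of \<xi> 0] by (auto simp del: character_add)

lemma character_minus:
  assumes "\<xi> \<in> characters"
  shows "\<xi> (- u) = cnj (\<xi> u)"
proof -
  have "\<xi> u * \<xi> (- u) = 1"
    using character_add[OF assms, of u "- u"] character_zero[OF assms] by simp
  moreover have "\<xi> u * cnj (\<xi> u) = 1"
    using character_norm[OF assms, of u] by (simp flip: complex_norm_square)
  ultimately show ?thesis
    by (metis mult_cancel_left mult_zero_left zero_neq_one)
qed

lemma character_diff: "\<xi> \<in> characters \<Longrightarrow> \<xi> (u - v) = \<xi> u * cnj (\<xi> v)"
  using character_add[of \<xi> u "- v"] character_minus[of \<xi> v] by simp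

abbreviation evaluation_sets :: "('g::{ab_group_add,topological_space} \<Rightarrow> complex) set set" where
  "evaluation_sets \<equiv>
     sigma_sets characters {(\<lambda>\<xi>. \<xi> u) -` B \<inter> characters | u B. B \<in> sets (borel :: complex measure)}"

lemma evaluation_measurable:
  assumes "space P = characters" "sets P = evaluation_sets"
  shows "(\<lambda>\<xi>. \<xi> a) \<in> borel_measurable P"
  by (rule measurableI) (auto simp: assms)

text \<open>Identities such as \<open>\<xi> a * \<xi> b = \<xi> (a + b)\<close> hold on characters only, hence the rule \<open>ext\<close>.\<close>

inductive_set trig :: "(('g::{ab_group_add,topological_space} \<Rightarrow> complex) \<Rightarrow> complex) set" where
  ev: "(\<lambda>\<xi>. \<xi> a) \<in> trig"
| add: "p \<in> trig \<Longrightarrow> p' \<in> trig \<Longrightarrow> (\<lambda>\<xi>. p \<xi> + p' \<xi>) \<in> trig"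
| scale: "p \<in> trig \<Longrightarrow> (\<lambda>\<xi>. c * p \<xi>) \<in> trig"
| ext: "p \<in> trig \<Longrightarrow> (\<And>\<xi>. \<xi> \<in> characters \<Longrightarrow> p' \<xi> = p \<xi>) \<Longrightarrow> p' \<in> trig"

lemma trig_const: "(\<lambda>_. c) \<in> trig"
  by (rule trig.ext[OF trig.scale[OF trig.ev[of 0], of c]]) (simp add: character_zero)

lemma trig_mult:
  assumes "p \<in> trig" "p' \<in> trig"
  shows "(\<lambda>\<xi>. p \<xi> * p' \<xi>) \<in> trig"
  using assms(1)
proof induction
  case (ev a)
  show ?case using assms(2)
  proof induction
    case (ev b)
    show ?case by (rule trig.ext[OF trig.ev[of "a + b"]]) (simp add: character_add)
  next
    case (add p p')
    then show ?case using trig.add by (fastforce simp: distrib_left)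
  next
    case (scale p c)
    then show ?case using trig.scale[of "\<lambda>\<xi>. \<xi> a * p \<xi>" c] by (simp add: mult.left_commute)
  next
    case (ext p p')
    then show ?case by (auto intro: trig.ext)
  qed
next
  case (add p p')
  then show ?case using trig.add by (fastforce simp: distrib_right)
next
  case (scale p c)
  then show ?case using trig.scale[of "\<lambda>\<xi>. p \<xi> * p' \<xi>" c] by (simp add: mult.assoc)
next
  case (ext p p'')
  then show ?case by (auto intro: trig.ext)
qed

lemma trig_bounded:
  assumes "p \<in> trig"
  obtains B where "B \<ge> 0" "\<And>\<xi>. \<xi> \<in> characters \<Longrightarrow> cmod (p \<xi>) \<le> B"
proof -
  have "\<exists>B\<ge>0. \<forall>\<xi>\<in>characters. cmod (p \<xi>) \<le> B"
    using assms
  proof induction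
    case (ev a)
    show ?case by (intro exI[of _ 1]) (auto simp: character_norm)
  next
    case (add p p')
    then obtain B B' where "B \<ge> 0" "B' \<ge> 0" "\<forall>\<xi>\<in>characters. cmod (p \<xi>) \<le> B" "\<forall>\<xi>\<in>characters. cmod (p' \<xi>) \<le> B'"
      by blast
    then show ?case by (intro exI[of _ "B + B'"]) (auto intro!: norm_triangle_le add_mono)
  next
    case (scale p c)
    then obtain B where "B \<ge> 0" "\<forall>\<xi>\<in>characters. cmod (p \<xi>) \<le> B" by blast
    then show ?case by (intro exI[of _ "cmod c * B"]) (auto simp: norm_mult intro: mult_left_mono)
  next
    case (ext p p')
    then show ?case by auto
  qed
  then show ?thesis using that by blast
qed

lemma trig_measurable:
  assumes "p \<in> trig" "space P = characters" "sets P = evaluation_sets"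
  shows "p \<in> borel_measurable P"
  using assms(1)
proof induction
  case (ev a)
  show ?case using assms by (intro evaluation_measurable)
next
  case (ext p p')
  then show ?case using measurable_cong[of P p' p borel] assms(2) by auto
qed auto

section \<open>Density of trigonometric polynomials in L2 of a finite measure\<close>

locale finite_measure_on_characters = finite_measure P
  for P :: "('g::{ab_group_add,topological_space} \<Rightarrow> complex) measure" +
  assumes space_P: "space P = characters" and sets_P: "sets P = evaluation_sets"
begin

abbreviation approx :: "(('g \<Rightarrow> complex) \<Rightarrow> complex) set" where
  "approx \<equiv> L2_closure P trig"

text \<open>The closure itself is not closed under products. Its bounded members are, and they are
  stable under uniformly bounded pointwise limits, which is what the passage to indicators requires.
  The bound is demanded at every character, not almost everywhere.\<close>

definition bapprox :: "(('g \<Rightarrow> complex) \<Rightarrow> complex) set" where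
  "bapprox = {m \<in> approx. \<exists>B. \<forall>\<xi>\<in>characters. cmod (m \<xi>) \<le> B}"

lemma bounded_L2:
  assumes "m \<in> borel_measurable P" "\<And>\<xi>. \<xi> \<in> characters \<Longrightarrow> cmod (m \<xi>) \<le> B"
  shows "m \<in> L2 P"
proof -
  have "(\<lambda>_. 1) \<in> L2 P" by (simp add: L2_def)
  then show ?thesis using assms by (rule_tac L2_bound[where C=B]) (auto simp: space_P)
qed

lemma trig_L2: "p \<in> trig \<Longrightarrow> p \<in> L2 P"
  using trig_bounded[of p] bounded_L2[of p] trig_measurable[of p P] space_P sets_P by metis

lemma trig_subset: "trig \<subseteq> L2 P"
  using trig_L2 by blast

lemmas approxI = L2_closure_closed[OF trig_subset]
lemmas approx_limit = L2_closure_limit[OF trig_subset]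
lemmas trig_approx = L2_closure_base[OF trig_subset]

lemma approx_add: "m \<in> approx \<Longrightarrow> m' \<in> approx \<Longrightarrow> (\<lambda>\<xi>. m \<xi> + m' \<xi>) \<in> approx"
  by (rule L2_closure_add[OF trig_subset trig.add])

lemma approx_scale:
  assumes "m \<in> approx"
  shows "(\<lambda>\<xi>. c * m \<xi>) \<in> approx"
proof (rule approxI)
  show "(\<lambda>\<xi>. c * m \<xi>) \<in> L2 P" using assms by (intro L2_scale L2_closure_L2)
  fix e :: real assume "e > 0"
  then have "e / (cmod c + 1) > 0" by (simp add: add_nonneg_pos)
  then obtain p where p: "p \<in> trig" "l2norm P (\<lambda>\<xi>. m \<xi> - p \<xi>) < e / (cmod c + 1)"
    using assms unfolding L2_closure_def by blast
  have "l2norm P (\<lambda>\<xi>. c * m \<xi> - c * p \<xi>) = cmod c * l2norm P (\<lambda>\<xi>. m \<xi> - p \<xi>)"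
    using l2norm_scale[of P c "\<lambda>\<xi>. m \<xi> - p \<xi>"] by (simp add: right_diff_distrib)
  also have "\<dots> \<le> (cmod c + 1) * l2norm P (\<lambda>\<xi>. m \<xi> - p \<xi>)"
    by (intro mult_right_mono) auto
  also have "\<dots> < e" using p(2) by (simp add: pos_less_divide_eq add_nonneg_pos mult.commute)
  finally show "\<exists>m'\<in>approx. l2norm P (\<lambda>\<xi>. c * m \<xi> - m' \<xi>) < e"
    using trig_approx[OF trig.scale[OF p(1), of c]] by (intro bexI[of _ "\<lambda>\<xi>. c * p \<xi>"])
qed

lemma approx_mult_trig:
  assumes "m \<in> approx" "p \<in> trig"
  shows "(\<lambda>\<xi>. m \<xi> * p \<xi>) \<in> approx"
proof -
  obtain B where B: "B \<ge> 0" "\<And>\<xi>. \<xi> \<in> characters \<Longrightarrow> cmod (p \<xi>) \<le> B"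
    using trig_bounded[OF assms(2)] by blast
  have pm: "p \<in> borel_measurable P" using trig_L2[OF assms(2)] by (simp add: L2_def)
  have mp: "(\<lambda>\<xi>. m \<xi> * p \<xi>) \<in> L2 P" if "m \<in> L2 P" for m
    using L2_bounded_mult[OF that pm AE_I2, of B] B unfolding space_P by (simp add: mult.commute)
  show ?thesis
  proof (rule approxI)
    show "(\<lambda>\<xi>. m \<xi> * p \<xi>) \<in> L2 P" using assms by (intro mp L2_closure_L2)
    fix e :: real assume "e > 0"
    then have "e / (B + 1) > 0" using B by simp
    then obtain p' where p': "p' \<in> trig" "l2norm P (\<lambda>\<xi>. m \<xi> - p' \<xi>) < e / (B + 1)"
      using assms(1) unfolding L2_closure_def by blast
    have d: "(\<lambda>\<xi>. m \<xi> - p' \<xi>) \<in> L2 P" using assms p' by (intro L2_diff L2_closure_L2 trig_L2)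
    have "l2norm P (\<lambda>\<xi>. (m \<xi> - p' \<xi>) * p \<xi>) \<le> (B + 1) * l2norm P (\<lambda>\<xi>. m \<xi> - p' \<xi>)"
    proof (rule l2norm_mono[OF d])
      show "(\<lambda>\<xi>. (m \<xi> - p' \<xi>) * p \<xi>) \<in> borel_measurable P" using mp[OF d] by (simp add: L2_def)
      have "cmod (m \<xi> - p' \<xi>) * cmod (p \<xi>) \<le> cmod (m \<xi> - p' \<xi>) * (B + 1)" if "\<xi> \<in> characters" for \<xi>
        using B(2)[OF that] by (intro mult_left_mono) auto
      then show "AE \<xi> in P. cmod ((m \<xi> - p' \<xi>) * p \<xi>) \<le> (B + 1) * cmod (m \<xi> - p' \<xi>)"
        by (intro AE_I2) (simp add: space_P norm_mult mult.commute)
    qed (use B in auto)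
    also have "\<dots> < e" using p'(2) B(1) by (simp add: pos_less_divide_eq mult.commute)
    finally show "\<exists>m'\<in>approx. l2norm P (\<lambda>\<xi>. m \<xi> * p \<xi> - m' \<xi>) < e"
      using trig_approx[OF trig_mult[OF p'(1) assms(2)]]
      by (intro bexI[of _ "\<lambda>\<xi>. p' \<xi> * p \<xi>"]) (auto simp: left_diff_distrib)
  qed
qed

text \<open>One factor is approximated at a time: since m is bounded, m * p is close to m * m' when
  p is close to m', and m * p lies in the closure by \<open>approx_mult_trig\<close>.\<close>

lemma bapprox_mult:
  assumes "m \<in> bapprox" "m' \<in> bapprox"
  shows "(\<lambda>\<xi>. m \<xi> * m' \<xi>) \<in> bapprox"
proof -
  obtain B where B: "\<And>\<xi>. \<xi> \<in> characters \<Longrightarrow> cmod (m \<xi>) \<le> B" using assms(1) unfolding bapprox_def by blast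
  obtain B' where B': "\<And>\<xi>. \<xi> \<in> characters \<Longrightarrow> cmod (m' \<xi>) \<le> B'" using assms(2) unfolding bapprox_def by blast
  have m: "m \<in> approx" and m': "m' \<in> approx" using assms by (auto simp: bapprox_def)
  have mm: "m \<in> borel_measurable P" using L2_closure_L2[OF m] by (simp add: L2_def)
  have Bn: "cmod (m \<xi>) \<le> \<bar>B\<bar>" if "\<xi> \<in> characters" for \<xi> using B[OF that] by auto
  have L: "(\<lambda>\<xi>. m \<xi> * f \<xi>) \<in> L2 P" if "f \<in> L2 P" for f
    using L2_bounded_mult[OF that mm AE_I2, of B] B unfolding space_P by simp
  have "(\<lambda>\<xi>. m \<xi> * m' \<xi>) \<in> approx"
  proof (rule approxI)
    show "(\<lambda>\<xi>. m \<xi> * m' \<xi>) \<in> L2 P" using m' by (intro L L2_closure_L2)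
    fix e :: real assume "e > 0"
    then have "e / (\<bar>B\<bar> + 1) > 0" by simp
    then obtain p where p: "p \<in> trig" "l2norm P (\<lambda>\<xi>. m' \<xi> - p \<xi>) < e / (\<bar>B\<bar> + 1)"
      using m' unfolding L2_closure_def by blast
    have d: "(\<lambda>\<xi>. m' \<xi> - p \<xi>) \<in> L2 P" using m' p by (intro L2_diff L2_closure_L2 trig_L2)
    have "l2norm P (\<lambda>\<xi>. m \<xi> * (m' \<xi> - p \<xi>)) \<le> (\<bar>B\<bar> + 1) * l2norm P (\<lambda>\<xi>. m' \<xi> - p \<xi>)"
    proof (rule l2norm_mono[OF d])
      show "(\<lambda>\<xi>. m \<xi> * (m' \<xi> - p \<xi>)) \<in> borel_measurable P" using L[OF d] by (simp add: L2_def)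
      have "cmod (m \<xi>) * cmod (m' \<xi> - p \<xi>) \<le> (\<bar>B\<bar> + 1) * cmod (m' \<xi> - p \<xi>)" if "\<xi> \<in> characters" for \<xi>
        using Bn[OF that] by (intro mult_right_mono) auto
      then show "AE \<xi> in P. cmod (m \<xi> * (m' \<xi> - p \<xi>)) \<le> (\<bar>B\<bar> + 1) * cmod (m' \<xi> - p \<xi>)"
        by (intro AE_I2) (simp add: space_P norm_mult)
    qed auto
    also have "\<dots> < e" using p(2) by (simp add: pos_less_divide_eq mult.commute)
    finally show "\<exists>m''\<in>approx. l2norm P (\<lambda>\<xi>. m \<xi> * m' \<xi> - m'' \<xi>) < e"
      using approx_mult_trig[OF m p(1)]
      by (intro bexI[of _ "\<lambda>\<xi>. m \<xi> * p \<xi>"]) (auto simp: right_diff_distrib)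
  qed
  moreover have "cmod (m \<xi> * m' \<xi>) \<le> \<bar>B\<bar> * \<bar>B'\<bar>" if "\<xi> \<in> characters" for \<xi>
    using B[OF that] B'[OF that] by (auto simp: norm_mult intro!: mult_mono)
  ultimately show ?thesis unfolding bapprox_def by blast
qed

lemma bapprox_bounded_limit:
  assumes "\<And>n. s n \<in> approx" "\<And>n \<xi>. \<xi> \<in> characters \<Longrightarrow> cmod (s n \<xi>) \<le> B"
    and "\<And>\<xi>. \<xi> \<in> characters \<Longrightarrow> (\<lambda>n. s n \<xi>) \<longlonglongrightarrow> m \<xi>"
  shows "m \<in> bapprox"
proof -
  have sm: "s n \<in> borel_measurable P" for n using L2_closure_L2[OF assms(1)] by (simp add: L2_def)
  have mm: "m \<in> borel_measurable P"
    by (rule borel_measurable_LIMSEQ_metric[where f=s, OF sm]) (simp add: space_P assms(3))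
  have mB: "cmod (m \<xi>) \<le> B" if "\<xi> \<in> characters" for \<xi>
    using tendsto_norm[OF assms(3)[OF that]] assms(2)[OF that] by (intro LIMSEQ_le_const2) auto
  have mL: "m \<in> L2 P" by (rule bounded_L2[OF mm mB])
  have "(\<lambda>_. 1) \<in> L2 P" by (simp add: L2_def)
  then have "(\<lambda>n. l2norm P (\<lambda>\<xi>. s n \<xi> - m \<xi>)) \<longlonglongrightarrow> 0"
  proof (rule L2_dominated_convergence[OF sm mm])
    have "cmod (s n \<xi> - m \<xi>) \<le> 2 * B" if "\<xi> \<in> characters" for n \<xi>
      using norm_triangle_ineq4[of "s n \<xi>" "m \<xi>"] assms(2)[OF that, of n] mB[OF that] by linarith
    then show "AE \<xi> in P. cmod (s n \<xi> - m \<xi>) \<le> (2 * B) * cmod 1" for n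
      by (intro AE_I2) (simp add: space_P)
  qed (use assms(3) space_P in auto)
  then have "m \<in> approx" by (rule approx_limit[where s=s, OF assms(1) mL])
  then show ?thesis using mB by (auto simp: bapprox_def)
qed

definition approx_sets :: "('g \<Rightarrow> complex) set set" where
  "approx_sets = {A. A \<subseteq> characters \<and> indicator A \<in> approx}"

lemma approx_sets_bapprox: "A \<in> approx_sets \<Longrightarrow> (indicator A :: _ \<Rightarrow> complex) \<in> bapprox"
  unfolding approx_sets_def bapprox_def by (auto intro!: exI[of _ 1] simp: indicator_def)

text \<open>Intersections are products of indicators, complements are differences from the constant
  1, and countable unions are bounded limits of finite ones.\<close>

lemma sigma_algebra_approx_sets: "sigma_algebra characters approx_sets"
proof -
  have one: "(\<lambda>_. 1) \<in> approx" by (intro trig_approx trig_const)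
  have compl: "characters - A \<in> approx_sets" if "A \<in> approx_sets" for A
  proof -
    have "(\<lambda>\<xi>. 1 + (-1) * indicator A \<xi>) \<in> approx"
      using that by (intro approx_add approx_scale one) (simp add: approx_sets_def)
    then have a: "(\<lambda>\<xi>. 1 + (-1) * indicator A \<xi>) \<in> bapprox"
      unfolding bapprox_def by (auto intro!: exI[of _ 1] simp: indicator_def)
    \<comment> \<open>The two functions differ outside the characters. The bounded limit lemma
      compares values on characters only, so a constant sequence passes from one to the
      other.\<close>
    have "(indicator (characters - A) :: _ \<Rightarrow> complex) \<in> bapprox"
      by (rule bapprox_bounded_limit[where s="\<lambda>_ \<xi>. 1 + (-1) * indicator A \<xi>" and B=1])
        (use a in \<open>auto simp: indicator_def bapprox_def\<close>)
    then show ?thesis by (auto simp: approx_sets_def bapprox_def)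
  qed
  have inter: "A \<inter> B \<in> approx_sets" if "A \<in> approx_sets" "B \<in> approx_sets" for A B
  proof -
    have "(\<lambda>\<xi>. indicator A \<xi> * indicator B \<xi> :: complex) \<in> bapprox"
      using that by (intro bapprox_mult approx_sets_bapprox)
    then show ?thesis using that
      by (auto simp: approx_sets_def bapprox_def indicator_inter_arith[symmetric, abs_def])
  qed
  have emp: "{} \<in> approx_sets"
    using trig_approx[OF trig_const[of 0]] by (simp add: approx_sets_def indicator_def[abs_def])
  have un: "A \<union> B \<in> approx_sets" if "A \<in> approx_sets" "B \<in> approx_sets" for A B
  proof -
    have "A \<union> B = characters - ((characters - A) \<inter> (characters - B))"
      using that by (auto simp: approx_sets_def)
    then show ?thesis using that by (auto intro: compl inter)
  qed
  have fin: "(\<Union>i<n. A i) \<in> approx_sets" if "\<And>i. A i \<in> approx_sets" for A and n :: nat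
    by (induction n) (auto simp: emp lessThan_Suc un that)
  have union: "(\<Union>i. A i) \<in> approx_sets" if "\<And>i::nat. A i \<in> approx_sets" for A
  proof -
    have "(indicator (\<Union>i. A i) :: _ \<Rightarrow> complex) \<in> bapprox"
    proof (rule bapprox_bounded_limit[where s="\<lambda>n. indicator (\<Union>i<n. A i)" and B=1])
      show "indicator (\<Union>i<n. A i) \<in> approx" for n using fin[OF that] by (simp add: approx_sets_def)
      show "(\<lambda>n. indicator (\<Union>i<n. A i) \<xi> :: complex) \<longlonglongrightarrow> indicator (\<Union>i. A i) \<xi>" for \<xi>
        by (rule LIMSEQ_indicator_UN)
    qed (auto simp: indicator_def)
    then show ?thesis using that by (auto simp: approx_sets_def bapprox_def)
  qed
  show ?thesis
    unfolding sigma_algebra_iff2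
  proof (intro conjI ballI allI impI)
    show "approx_sets \<subseteq> Pow characters" by (auto simp: approx_sets_def)
    show "\<Union> (range A) \<in> approx_sets" if "range A \<subseteq> approx_sets" for A :: "nat \<Rightarrow> _"
      using that by (intro union) auto
  qed (use emp compl in auto)
qed

lemma polynomial_trig:
  fixes t :: "('g \<Rightarrow> complex) \<Rightarrow> real"
  assumes "real_polynomial_function g" "(\<lambda>\<xi>. complex_of_real (t \<xi>)) \<in> trig"
  shows "(\<lambda>\<xi>. complex_of_real (g (t \<xi>))) \<in> trig"
  using assms(1)
proof induction
  case (linear f)
  then have "f x = x * f 1" for x using linear_simps(5)[of f x 1] by simp
  then have "(\<lambda>\<xi>. complex_of_real (f (t \<xi>))) = (\<lambda>\<xi>. complex_of_real (f 1) * complex_of_real (t \<xi>))"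
    by (metis mult.commute of_real_mult)
  then show ?case using trig.scale[OF assms(2)] by simp
next
  case (const c)
  show ?case by (rule trig_const)
next
  case (add f g)
  then show ?case using trig.add by fastforce
next
  case (mult f g)
  then show ?case using trig_mult by fastforce
qed

text \<open>By Weierstrass, a continuous function of a real trigonometric polynomial with values in
  [-1,1] is a uniform limit of polynomials in it. The ramps min 1 (max 0 (n (t - c))) then converge
  pointwise to the indicator of {t > c}; at t = c they are 0, in accordance with the strict
  inequality.\<close>

lemma greater_in_approx_sets:
  fixes t :: "('g \<Rightarrow> complex) \<Rightarrow> real"
  assumes t: "(\<lambda>\<xi>. complex_of_real (t \<xi>)) \<in> trig" and b: "\<And>\<xi>. \<xi> \<in> characters \<Longrightarrow> \<bar>t \<xi>\<bar> \<le> 1"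
  shows "{\<xi>\<in>characters. c < t \<xi>} \<in> approx_sets"
proof -
  have cont: "(\<lambda>\<xi>. complex_of_real (h (t \<xi>))) \<in> approx" if h: "continuous_on {-1..1} h" for h :: "real \<Rightarrow> real"
  proof -
    have "\<exists>g. real_polynomial_function g \<and> (\<forall>x\<in>{-1..1}. \<bar>h x - g x\<bar> < 1 / Suc n)" for n
      by (rule Stone_Weierstrass_real_polynomial_function[OF _ h, of "1 / Suc n"]) auto
    then obtain g where g: "\<And>n. real_polynomial_function (g n)"
        "\<And>n x. x \<in> {-1..1} \<Longrightarrow> \<bar>h x - g n x\<bar> < 1 / Suc n" by metis
    obtain C where C: "\<And>x. x \<in> {-1..1} \<Longrightarrow> \<bar>h x\<bar> \<le> C"
    proof -
      have "bounded (h ` {-1..1})" by (intro compact_imp_bounded compact_continuous_image h) auto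
      then obtain C where "\<forall>x\<in>h ` {-1..1}. norm x \<le> C" unfolding bounded_iff by blast
      then show ?thesis by (intro that[of C]) auto
    qed
    have "(\<lambda>\<xi>. complex_of_real (h (t \<xi>))) \<in> bapprox"
    proof (rule bapprox_bounded_limit[where s="\<lambda>n \<xi>. complex_of_real (g n (t \<xi>))" and B="C + 1"])
      show "(\<lambda>\<xi>. complex_of_real (g n (t \<xi>))) \<in> approx" for n
        by (rule trig_approx[OF polynomial_trig[OF g(1) t]])
      fix \<xi> :: "'g \<Rightarrow> complex" assume "\<xi> \<in> characters"
      then have x: "t \<xi> \<in> {-1..1}" using b[of \<xi>] by (auto simp: abs_le_iff)
      show "cmod (complex_of_real (g n (t \<xi>))) \<le> C + 1" for n
      proof -
        have "1 / real (Suc n) \<le> 1" by simp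
        then show ?thesis using g(2)[OF x, of n] C[OF x] unfolding norm_of_real by linarith
      qed
      have "(\<lambda>n. g n (t \<xi>)) \<longlonglongrightarrow> h (t \<xi>)"
      proof (rule LIM_zero_cancel, rule Lim_null_comparison)
        show "\<forall>\<^sub>F n in sequentially. norm (g n (t \<xi>) - h (t \<xi>)) \<le> 1 / Suc n"
          using g(2)[OF x] by (intro always_eventually allI) (auto simp: abs_minus_commute less_imp_le)
        show "(\<lambda>n. 1 / real (Suc n)) \<longlonglongrightarrow> 0" using LIMSEQ_inverse_real_of_nat by (simp add: divide_inverse)
      qed
      then show "(\<lambda>n. complex_of_real (g n (t \<xi>))) \<longlonglongrightarrow> complex_of_real (h (t \<xi>))"
        by (rule tendsto_of_real)
    qed
    then show ?thesis by (simp add: bapprox_def)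
  qed
  define h :: "nat \<Rightarrow> real \<Rightarrow> real" where "h n x = min 1 (max 0 (real n * (x - c)))" for n x
  have "(indicator {\<xi>\<in>characters. c < t \<xi>} :: _ \<Rightarrow> complex) \<in> bapprox"
  proof (rule bapprox_bounded_limit[where s="\<lambda>n \<xi>. complex_of_real (h n (t \<xi>))" and B=1])
    show "(\<lambda>\<xi>. complex_of_real (h n (t \<xi>))) \<in> approx" for n
      unfolding h_def by (intro cont continuous_intros)
    show "cmod (complex_of_real (h n (t \<xi>))) \<le> 1" for n \<xi> unfolding norm_of_real by (auto simp: h_def)
    fix \<xi> :: "'g \<Rightarrow> complex" assume \<xi>: "\<xi> \<in> characters"
    show "(\<lambda>n. complex_of_real (h n (t \<xi>))) \<longlonglongrightarrow> indicator {\<xi> \<in> characters. c < t \<xi>} \<xi>"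
    proof (cases "c < t \<xi>")
      case True
      obtain N where N: "1 / (t \<xi> - c) < real N" using reals_Archimedean2 by blast
      have "h n (t \<xi>) = 1" if "n \<ge> N" for n
      proof -
        have "1 / (t \<xi> - c) \<le> real n" using N that by linarith
        then have "1 \<le> real n * (t \<xi> - c)" using True by (simp add: field_simps)
        then show ?thesis by (simp add: h_def)
      qed
      then have "eventually (\<lambda>n. complex_of_real (h n (t \<xi>)) = 1) sequentially"
        unfolding eventually_sequentially by (intro exI[of _ N]) auto
      then show ?thesis using True \<xi> by (simp add: tendsto_eventually)
    next
      case False
      then have "h n (t \<xi>) = 0" for n by (simp add: h_def mult_nonneg_nonpos)
      then show ?thesis using False by simp
    qed
  qed
  then show ?thesis by (auto simp: approx_sets_def bapprox_def)
qed

text \<open>Because cnj(\<xi> a) = \<xi>(-a), the real and imaginary parts of an evaluation are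
  trigonometric polynomials with values in [-1,1]. Hence evaluations are measurable for
  \<open>approx_sets\<close>, and they generate \<open>sets P\<close>.\<close>

lemma sets_subset_approx_sets: "sets P \<subseteq> approx_sets"
proof -
  interpret S: sigma_algebra characters approx_sets by (rule sigma_algebra_approx_sets)
  define Q where "Q = sigma (characters :: ('g \<Rightarrow> complex) set) approx_sets"
  have spQ: "space Q = characters" and sQ: "sets Q = approx_sets"
    unfolding Q_def using S.space_closed by (auto simp: S.sigma_sets_eq)
  have "(\<lambda>\<xi>. \<xi> a) \<in> borel_measurable Q" for a :: 'g
    unfolding borel_measurable_complex_iff
  proof
    have re: "(\<lambda>\<xi>. complex_of_real (Re (\<xi> a))) \<in> trig"
    proof (rule trig.ext[OF trig.add[OF trig.scale[OF trig.ev[of a], of "1/2"] trig.scale[OF trig.ev[of "-a"], of "1/2"]]])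
      fix \<xi> :: "'g \<Rightarrow> complex" assume "\<xi> \<in> characters"
      then show "complex_of_real (Re (\<xi> a)) = 1 / 2 * \<xi> a + 1 / 2 * \<xi> (- a)"
        by (simp add: character_minus complex_eq_iff)
    qed
    have im: "(\<lambda>\<xi>. complex_of_real (Im (\<xi> a))) \<in> trig"
    proof (rule trig.ext[OF trig.add[OF trig.scale[OF trig.ev[of a], of "-\<i>/2"] trig.scale[OF trig.ev[of "-a"], of "\<i>/2"]]])
      fix \<xi> :: "'g \<Rightarrow> complex" assume "\<xi> \<in> characters"
      then show "complex_of_real (Im (\<xi> a)) = -\<i> / 2 * \<xi> a + \<i> / 2 * \<xi> (- a)"
        by (simp add: character_minus complex_eq_iff)
    qed
    have "\<bar>Re (\<xi> a)\<bar> \<le> 1" "\<bar>Im (\<xi> a)\<bar> \<le> 1" if "\<xi> \<in> characters" for \<xi>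
      using abs_Re_le_cmod[of "\<xi> a"] abs_Im_le_cmod[of "\<xi> a"] character_norm[OF that] by auto
    then show "(\<lambda>\<xi>. Re (\<xi> a)) \<in> borel_measurable Q" "(\<lambda>\<xi>. Im (\<xi> a)) \<in> borel_measurable Q"
      unfolding borel_measurable_iff_greater spQ sQ
      by (auto intro!: greater_in_approx_sets re im)
  qed
  then have "(\<lambda>\<xi>. \<xi> a) -` B \<inter> characters \<in> approx_sets" if "B \<in> sets borel" for a :: 'g and B
    using measurable_sets[OF _ that, of "\<lambda>\<xi>. \<xi> a" Q] by (simp add: spQ sQ)
  then show ?thesis
    unfolding sets_P by (intro S.sigma_sets_subset) auto
qed

theorem trig_dense:
  assumes m: "m \<in> L2 P" and "e > 0"
  obtains p where "p \<in> trig" "l2norm P (\<lambda>\<xi>. m \<xi> - p \<xi>) < e"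
proof -
  have mm: "m \<in> borel_measurable P" using m by (simp add: L2_def)
  obtain F where F: "\<And>i. simple_function P (F i)" "\<And>x. x \<in> space P \<Longrightarrow> (\<lambda>i. F i x) \<longlonglongrightarrow> m x"
    "\<And>i x. x \<in> space P \<Longrightarrow> dist (F i x) 0 \<le> 2 * dist (m x) 0"
    using borel_measurable_implies_sequence_metric[OF mm, of 0] by metis
  have Fm: "F i \<in> borel_measurable P" for i using F(1) by (rule borel_measurable_simple_function)
  have Fa: "F i \<in> approx" for i
  proof -
    have fin: "finite (F i ` space P)" using F(1) by (simp add: simple_function_def)
    have simple: "(\<lambda>x. \<Sum>y\<in>Y. y * indicator (F i -` {y} \<inter> space P) x) \<in> approx" if "finite Y" for Y :: "complex set"
      using that
    proof induction
      case empty
      show ?case using trig_approx[OF trig_const[of 0]] by simp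
    next
      case (insert y Y)
      have "F i -` {y} \<inter> space P \<in> approx_sets"
        using sets_subset_approx_sets Fm[of i] by (auto intro: measurable_sets)
      then have a: "(\<lambda>x. y * indicator (F i -` {y} \<inter> space P) x) \<in> approx"
        by (intro approx_scale) (simp add: approx_sets_def)
      have eq: "(\<lambda>x. \<Sum>z\<in>insert y Y. z * indicator (F i -` {z} \<inter> space P) x) =
          (\<lambda>x. y * indicator (F i -` {y} \<inter> space P) x + (\<Sum>z\<in>Y. z * indicator (F i -` {z} \<inter> space P) x))"
        by (intro HOL.ext sum.insert insert.hyps)
      show ?case unfolding eq by (rule approx_add[OF a insert.IH])
    qed
    define S where "S x = (\<Sum>y\<in>F i ` space P. y * indicator (F i -` {y} \<inter> space P) x)" for x
    have S: "S \<in> approx" unfolding S_def[abs_def] by (rule simple[OF fin])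
    have SF: "S x = F i x" if "x \<in> space P" for x
    proof -
      have "S x = (\<Sum>y\<in>F i ` space P. if y = F i x then y else 0)"
        unfolding S_def using that by (intro sum.cong) (auto simp: indicator_def)
      then show ?thesis using fin that by simp
    qed
    have FL: "F i \<in> L2 P"
      by (rule L2_bound[OF m Fm, of _ 2]) (use F(3) in \<open>auto simp: dist_norm\<close>)
    have "l2norm P (\<lambda>x. F i x - S x) = l2norm P (\<lambda>_. 0)"
      by (rule l2norm_cong) (simp add: SF)
    then have "l2norm P (\<lambda>x. F i x - S x) = 0" by (simp add: l2norm_def)
    then show ?thesis using S by (intro approxI[OF FL] bexI[of _ S]) auto
  qed
  have "(\<lambda>n. l2norm P (\<lambda>x. F n x - m x)) \<longlonglongrightarrow> 0"
  proof (rule L2_dominated_convergence[OF Fm mm m])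
    have "cmod (F n x - m x) \<le> 3 * cmod (m x)" if "x \<in> space P" for n x
      using F(3)[OF that, of n] norm_triangle_ineq4[of "F n x" "m x"] by (simp add: dist_norm)
    then show "AE x in P. cmod (F n x - m x) \<le> 3 * cmod (m x)" for n by auto
  qed (use F(2) in auto)
  then have "m \<in> approx" by (rule approx_limit[where s=F, OF Fa m])
  then show ?thesis using \<open>e > 0\<close> that unfolding L2_closure_def by blast
qed

end

section \<open>Haar measure and uniqueness of Fourier coefficients\<close>

text \<open>Each compact piece has finite nets of every radius 1/(j+1). The resulting sequence
  discretizes the group variable in \<open>caratheodory_measurable\<close>.\<close>

lemma sigma_compact_dense_sequence:
  fixes C :: "nat \<Rightarrow> 'g::metric_space set"
  assumes "\<And>n. compact (C n)" "(\<Union>n. C n) = UNIV"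
  obtains d :: "nat \<Rightarrow> 'g" where "\<And>x e. e > 0 \<Longrightarrow> \<exists>n. dist x (d n) < e"
proof -
  have "\<exists>k. finite k \<and> C n \<subseteq> (\<Union>x\<in>k. ball x (1 / Suc j))" for n j
    using assms(1)[of n] unfolding compact_eq_totally_bounded by simp
  then obtain k where k: "\<And>n j. finite (k n j)" "\<And>n j. C n \<subseteq> (\<Union>x\<in>k n j. ball x (1 / Suc j))"
    by metis
  define D where "D = (\<Union>n j. k n j)"
  have "countable D" unfolding D_def by (intro countable_UN countableI_type countable_finite k(1))
  have dense: "\<exists>y\<in>D. dist x y < e" if "e > 0" for x e
  proof -
    obtain n where n: "x \<in> C n" using assms(2) by blast
    obtain j where j: "1 / real (Suc j) < e" using nat_approx_posE[of e] \<open>e > 0\<close> by metis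
    obtain y where "y \<in> k n j" "x \<in> ball y (1 / Suc j)" using k(2)[of n j] n by blast
    then have "y \<in> D" "dist x y < e" using j by (auto simp: D_def dist_commute)
    then show ?thesis by blast
  qed
  then have "D \<noteq> {}" by (metis empty_iff zero_less_one)
  show ?thesis
  proof (rule that[of "from_nat_into D"])
    fix x :: 'g and e :: real assume "e > 0"
    then obtain y where "y \<in> D" "dist x y < e" using dense by blast
    then show "\<exists>n. dist x (from_nat_into D n) < e"
      using from_nat_into_surj[OF \<open>countable D\<close>] by metis
  qed
qed

text \<open>A function measurable in one variable and continuous in the other is jointly measurable.
  It is meant for (\<xi>, u) \<mapsto> \<xi> u: each evaluation is measurable by construction of the
  dual sigma-algebra, each character is continuous, and Fubini needs both variables
  together.\<close>

lemma caratheodory_measurable: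
  fixes f :: "'a \<Rightarrow> 'g::metric_space \<Rightarrow> complex"
  assumes dense: "\<And>(x::'g) e. e > 0 \<Longrightarrow> \<exists>n::nat. dist x (d n) < e"
    and f: "\<And>u. (\<lambda>x. f x u) \<in> borel_measurable P"
    and cont: "\<And>x. x \<in> space P \<Longrightarrow> continuous_on UNIV (f x)"
    and N: "sets N = sets borel"
  shows "(\<lambda>p. f (fst p) (snd p)) \<in> borel_measurable (P \<Otimes>\<^sub>M N)"
proof -
  \<comment> \<open>Taking the least index makes the rounding of u to a point of the dense sequence
    a measurable map with countably many values.\<close>
  define k where "k n u = (LEAST i. dist u (d i) < 1 / Suc n)" for n u
  have kprop: "dist u (d (k n u)) < 1 / Suc n" for n u
    unfolding k_def by (rule LeastI_ex) (rule dense, simp)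
  have dm [measurable]: "(\<lambda>u. dist u (d i)) \<in> borel_measurable N" for i
    unfolding measurable_cong_sets[OF N refl]
    by (intro borel_measurable_continuous_onI continuous_intros)
  have km: "k n \<in> measurable N (count_space UNIV)" for n
    unfolding k_def by measurable
  show ?thesis
  proof (rule borel_measurable_LIMSEQ_metric[where f="\<lambda>n p. f (fst p) (d (k n (snd p)))"])
    fix n
    show "(\<lambda>p. f (fst p) (d (k n (snd p)))) \<in> borel_measurable (P \<Otimes>\<^sub>M N)"
      by (rule measurable_compose_countable[where f="\<lambda>i p. f (fst p) (d i)"])
        (use f km in measurable)
  next
    fix p assume "p \<in> space (P \<Otimes>\<^sub>M N)"
    then have "fst p \<in> space P" by (auto simp: space_pair_measure)
    from cont[OF this] have "isCont (f (fst p)) (snd p)" by (simp add: continuous_on_eq_continuous_at)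
    moreover have "(\<lambda>n. d (k n (snd p))) \<longlonglongrightarrow> snd p"
    proof (rule metric_tendsto_imp_tendsto)
      show "(\<lambda>n. 1 / real (Suc n)) \<longlonglongrightarrow> 0" using LIMSEQ_inverse_real_of_nat by (simp add: divide_inverse)
      show "\<forall>\<^sub>F n in sequentially. dist (d (k n (snd p))) (snd p) \<le> dist (1 / real (Suc n)) 0"
        using kprop[of "snd p"] by (intro always_eventually allI) (auto simp: dist_commute less_imp_le)
    qed
    ultimately show "(\<lambda>n. f (fst p) (d (k n (snd p)))) \<longlonglongrightarrow> f (fst p) (snd p)"
      by (rule isCont_tendsto_compose)
  qed
qed

section \<open>Translation invariance of Haar measure\<close>

locale haar_group =
  fixes \<nu> :: "'g::{ab_group_add,metric_space} measure"
  assumes G: "lc_metr_sigma_compact_group TYPE('g)" and haar: "haar_measure \<nu>"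
begin

lemma sigma_compact: "\<exists>C::nat \<Rightarrow> 'g set. (\<forall>n. compact (C n)) \<and> (\<Union>n. C n) = UNIV"
  using G unfolding lc_metr_sigma_compact_group_def by (elim conjE)

lemma sets_haar [measurable_cong]: "sets \<nu> = sets borel"
  using haar by (simp add: haar_measure_def)

lemma space_haar [simp]: "space \<nu> = UNIV"
  using sets_eq_imp_space_eq[OF sets_haar] by simp

sublocale nu: sigma_finite_measure \<nu>
proof
  obtain C :: "nat \<Rightarrow> 'g set" where C: "\<And>n. compact (C n)" "(\<Union>n. C n) = UNIV"
    using sigma_compact by metis
  show "\<exists>A. countable A \<and> A \<subseteq> sets \<nu> \<and> \<Union> A = space \<nu> \<and> (\<forall>a\<in>A. emeasure \<nu> a \<noteq> \<infinity>)"
  proof (intro exI[of _ "range C"] conjI ballI)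
    show "range C \<subseteq> sets \<nu>" using C(1) by (auto simp: sets_haar compact_imp_closed)
    show "emeasure \<nu> a \<noteq> \<infinity>" if "a \<in> range C" for a
    proof -
      have "compact a" using C(1) that by auto
      then have "emeasure \<nu> a < top" using haar by (simp add: haar_measure_def)
      then show ?thesis by simp
    qed
  qed (use C in auto)
qed

lemma translation_measurable [measurable]: "(\<lambda>u. u - a) \<in> measurable \<nu> \<nu>"
proof -
  have add: "continuous_on UNIV (\<lambda>p::'g\<times>'g. fst p + snd p)"
    using G by (simp add: lc_metr_sigma_compact_group_def)
  have "continuous_on UNIV (\<lambda>u. (u, - a))" by (intro continuous_intros)
  then have "continuous_on UNIV (\<lambda>u. fst (u, - a) + snd (u, - a))"
    by (rule continuous_on_compose2[OF add]) auto
  then have "continuous_on UNIV (\<lambda>u. u - a)" by simp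
  then have "(\<lambda>u. u - a) \<in> borel_measurable borel" by (rule borel_measurable_continuous_onI)
  then show ?thesis by (simp add: measurable_cong_sets[OF sets_haar sets_haar])
qed

lemma distr_translation: "distr \<nu> \<nu> (\<lambda>u. u - a) = \<nu>"
proof (rule measure_eqI)
  fix A assume "A \<in> sets (distr \<nu> \<nu> (\<lambda>u. u - a))"
  then have A: "A \<in> sets \<nu>" by simp
  have "(\<lambda>u. u - a) -` A = (\<lambda>u. a + u) ` A"
    by (auto simp: image_iff) (metis add.commute diff_add_cancel)
  then have "emeasure (distr \<nu> \<nu> (\<lambda>u. u - a)) A = emeasure \<nu> ((\<lambda>u. a + u) ` A)"
    using A by (simp add: emeasure_distr)
  also have "\<dots> = emeasure \<nu> A" using haar A unfolding haar_measure_def by (simp add: sets_haar)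
  finally show "emeasure (distr \<nu> \<nu> (\<lambda>u. u - a)) A = emeasure \<nu> A" .
qed simp

lemma integral_translation:
  fixes f :: "'g \<Rightarrow> complex"
  assumes "f \<in> borel_measurable \<nu>"
  shows "(\<integral>u. f (u - a) \<partial>\<nu>) = (\<integral>u. f u \<partial>\<nu>)"
  using integral_distr[OF translation_measurable assms, of a] by (simp add: distr_translation)

lemma integrable_translation:
  fixes f :: "'g \<Rightarrow> complex"
  assumes "integrable \<nu> f"
  shows "integrable \<nu> (\<lambda>u. f (u - a))"
  using integrable_distr[OF translation_measurable, of a f] assms by (simp add: distr_translation)

lemma L2_translation:
  assumes "f \<in> L2 \<nu>"
  shows "(\<lambda>u. f (u - a)) \<in> L2 \<nu>"
proof -
  have "integrable \<nu> (\<lambda>u. (cmod (f (u - a)))\<^sup>2)"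
    using integrable_distr[OF translation_measurable, of a "\<lambda>u. (cmod (f u))\<^sup>2"] assms
    by (simp add: distr_translation L2_def)
  moreover have "(\<lambda>u. f (u - a)) \<in> borel_measurable \<nu>"
    by (rule measurable_compose[OF translation_measurable]) (use assms in \<open>simp add: L2_def\<close>)
  ultimately show ?thesis by (simp add: L2_def)
qed

lemma dense_sequence: obtains d :: "nat \<Rightarrow> 'g" where "\<And>x e. e > 0 \<Longrightarrow> \<exists>n. dist x (d n) < e"
proof -
  obtain C :: "nat \<Rightarrow> 'g set" where "\<And>n. compact (C n)" "(\<Union>n. C n) = UNIV"
    using sigma_compact by metis
  then show ?thesis using sigma_compact_dense_sequence that by metis
qed

lemma fourier_translation:
  assumes "f \<in> borel_measurable \<nu>" "\<xi> \<in> characters"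
  shows "fourier \<nu> (\<lambda>u. f (u - a)) \<xi> = cnj (\<xi> a) * fourier \<nu> f \<xi>"
proof -
  have \<xi>m: "\<xi> \<in> borel_measurable \<nu>"
    unfolding measurable_cong_sets[OF sets_haar refl]
    using assms(2) by (intro borel_measurable_continuous_onI) (simp add: characters_def)
  have "fourier \<nu> (\<lambda>u. f (u - a)) \<xi> = (\<integral>u. cnj (\<xi> a) * (f (u - a) * cnj (\<xi> (u - a))) \<partial>\<nu>)"
    unfolding fourier_def
  proof (rule Bochner_Integration.integral_cong[OF refl])
    fix u
    have "\<xi> u = \<xi> (u - a) * \<xi> a" using character_add[OF assms(2), of "u - a" a] by simp
    then show "f (u - a) * cnj (\<xi> u) = cnj (\<xi> a) * (f (u - a) * cnj (\<xi> (u - a)))" by simp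
  qed
  also have "\<dots> = cnj (\<xi> a) * (\<integral>u. f (u - a) * cnj (\<xi> (u - a)) \<partial>\<nu>)" by simp
  also have "(\<integral>u. f (u - a) * cnj (\<xi> (u - a)) \<partial>\<nu>) = fourier \<nu> f \<xi>"
    unfolding fourier_def by (rule integral_translation) (use assms(1) \<xi>m in measurable)
  finally show ?thesis .
qed

end

section \<open>Plancherel, weighted approximation and L1 uniqueness\<close>

locale plancherel_pair = haar_group \<nu> for \<nu> :: "'g::{ab_group_add,metric_space} measure" +
  fixes \<nu>h :: "('g \<Rightarrow> complex) measure"
  assumes dual: "dual_plancherel_measure \<nu> \<nu>h"
begin

lemma space_dual: "space \<nu>h = characters"
  and sets_dual: "sets \<nu>h = evaluation_sets"
  using dual unfolding dual_plancherel_measure_def by auto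

sublocale nuh: sigma_finite_measure \<nu>h
  using dual by (simp add: dual_plancherel_measure_def)

lemma plancherel:
  assumes "h \<in> L2 \<nu>" "integrable \<nu> h"
  shows "fourier \<nu> h \<in> L2 \<nu>h" "l2norm \<nu>h (fourier \<nu> h) = l2norm \<nu> h"
  using dual assms unfolding dual_plancherel_measure_def by auto

lemma fourier_dense:
  assumes "g \<in> L2 \<nu>h" "e > 0"
  obtains h where "h \<in> L2 \<nu>" "integrable \<nu> h" "l2norm \<nu>h (\<lambda>\<xi>. g \<xi> - fourier \<nu> h \<xi>) < e"
  using dual assms unfolding dual_plancherel_measure_def by meson

lemma ev_measurable [measurable]: "(\<lambda>\<xi>. \<xi> a) \<in> borel_measurable \<nu>h"
  by (rule evaluation_measurable[OF space_dual sets_dual])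

lemma joint_ev_measurable [measurable]: "(\<lambda>p. fst p (snd p)) \<in> borel_measurable (\<nu>h \<Otimes>\<^sub>M \<nu>)"
proof -
  obtain d :: "nat \<Rightarrow> 'g" where "\<And>x e. e > 0 \<Longrightarrow> \<exists>n. dist x (d n) < e"
    using dense_sequence by blast
  then show ?thesis
    by (rule caratheodory_measurable) (auto simp: space_dual characters_def sets_haar)
qed

lemma character_measurable: "\<xi> \<in> characters \<Longrightarrow> \<xi> \<in> borel_measurable \<nu>"
  unfolding measurable_cong_sets[OF sets_haar refl]
  by (intro borel_measurable_continuous_onI) (simp add: characters_def)

lemma fourier_bound:
  assumes "integrable \<nu> h" "\<xi> \<in> characters"
  shows "cmod (fourier \<nu> h \<xi>) \<le> (\<integral>u. cmod (h u) \<partial>\<nu>)"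
proof -
  have "cmod (fourier \<nu> h \<xi>) \<le> (\<integral>u. cmod (h u * cnj (\<xi> u)) \<partial>\<nu>)"
    unfolding fourier_def by (rule integral_norm_bound)
  then show ?thesis using assms(2) by (simp add: norm_mult character_norm)
qed

lemma integrable_character_mult:
  assumes "integrable \<nu> h" "\<xi> \<in> characters"
  shows "integrable \<nu> (\<lambda>u. h u * cnj (\<xi> u))"
proof (rule Bochner_Integration.integrable_bound[OF assms(1)])
  show "(\<lambda>u. h u * cnj (\<xi> u)) \<in> borel_measurable \<nu>"
    using assms character_measurable by measurable
qed (use assms in \<open>auto simp: norm_mult character_norm\<close>)

lemma fourier_add_scale:
  assumes "integrable \<nu> h" "integrable \<nu> k" "\<xi> \<in> characters"
  shows "fourier \<nu> (\<lambda>u. h u + c * k u) \<xi> = fourier \<nu> h \<xi> + c * fourier \<nu> k \<xi>"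
proof -
  have "(\<lambda>u. (h u + c * k u) * cnj (\<xi> u)) = (\<lambda>u. h u * cnj (\<xi> u) + c * (k u * cnj (\<xi> u)))"
    by (auto simp: algebra_simps)
  then show ?thesis
    unfolding fourier_def using assms by (simp add: integrable_character_mult)
qed

lemma parseval:
  assumes h: "h \<in> L2 \<nu>" "integrable \<nu> h" and k: "k \<in> L2 \<nu>" "integrable \<nu> k"
  shows "ip \<nu>h (fourier \<nu> h) (fourier \<nu> k) = ip \<nu> h k"
proof (rule ip_eq_if_l2norm_eq)
  fix c
  have "l2norm \<nu>h (\<lambda>\<xi>. fourier \<nu> h \<xi> + c * fourier \<nu> k \<xi>) = l2norm \<nu>h (fourier \<nu> (\<lambda>u. h u + c * k u))"
    using h k by (intro l2norm_cong) (simp add: fourier_add_scale space_dual)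
  also have "\<dots> = l2norm \<nu> (\<lambda>u. h u + c * k u)"
    using h k by (intro plancherel L2_add_scale) auto
  finally show "l2norm \<nu>h (\<lambda>\<xi>. fourier \<nu> h \<xi> + c * fourier \<nu> k \<xi>) = l2norm \<nu> (\<lambda>u. h u + c * k u)" .
qed (use h k plancherel in auto)

lemma finite_measure_on_characters_density:
  assumes w: "integrable \<nu>h w" "\<And>\<xi>. \<xi> \<in> characters \<Longrightarrow> 0 \<le> w \<xi>"
  shows "finite_measure_on_characters (density \<nu>h (\<lambda>\<xi>. ennreal (w \<xi>)))"
proof (intro finite_measure_on_characters.intro finite_measureI finite_measure_on_characters_axioms.intro)
  have "emeasure (density \<nu>h (\<lambda>\<xi>. ennreal (w \<xi>))) (space \<nu>h) = (\<integral>\<^sup>+\<xi>. ennreal (w \<xi>) \<partial>\<nu>h)"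
    using w by (subst emeasure_density) (auto intro!: nn_integral_cong)
  also have "\<dots> = ennreal (\<integral>\<xi>. w \<xi> \<partial>\<nu>h)"
    using w by (intro nn_integral_eq_integral) (auto simp: space_dual)
  finally show "emeasure (density \<nu>h (\<lambda>\<xi>. ennreal (w \<xi>))) (space (density \<nu>h (\<lambda>\<xi>. ennreal (w \<xi>)))) \<noteq> \<infinity>"
    by simp
qed (auto simp: space_dual sets_dual)

text \<open>The form in which density is applied: w times Haar measure is finite, so
  \<open>trig_dense\<close> is available for it. The weights will be |D| in
  \<open>L1_uniqueness\<close>, |q_\<xi>(y)|^2 on \<Omega> in \<open>L2_closure_piece\<close>, and
  the modulus of the defect function in \<open>Crho_pointwise_bound\<close>.\<close>

lemma weighted_trig_dense:
  assumes w: "integrable \<nu>h w" "\<And>\<xi>. \<xi> \<in> characters \<Longrightarrow> 0 \<le> w \<xi>"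
    and m: "m \<in> borel_measurable \<nu>h" "integrable \<nu>h (\<lambda>\<xi>. w \<xi> * (cmod (m \<xi>))\<^sup>2)" and "e > 0"
  obtains p where "p \<in> trig" "(\<integral>\<xi>. w \<xi> * (cmod (m \<xi> - p \<xi>))\<^sup>2 \<partial>\<nu>h) < e"
    "integrable \<nu>h (\<lambda>\<xi>. w \<xi> * (cmod (m \<xi> - p \<xi>))\<^sup>2)"
proof -
  let ?P = "density \<nu>h (\<lambda>\<xi>. ennreal (w \<xi>))"
  interpret P: finite_measure_on_characters ?P by (rule finite_measure_on_characters_density[OF w])
  have wm: "w \<in> borel_measurable \<nu>h" using w(1) by (rule borel_measurable_integrable)
  have wn: "AE \<xi> in \<nu>h. 0 \<le> w \<xi>" using w(2) by (auto simp: space_dual)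
  have L2P: "f \<in> L2 ?P \<longleftrightarrow> integrable \<nu>h (\<lambda>\<xi>. w \<xi> * (cmod (f \<xi>))\<^sup>2)" if "f \<in> borel_measurable \<nu>h" for f
    using that wm wn by (simp add: L2_def integrable_density[of "\<lambda>\<xi>. (cmod (f \<xi>))\<^sup>2"])
  have "m \<in> L2 ?P" using L2P[OF m(1)] m(2) by simp
  moreover have "sqrt e > 0" using \<open>e > 0\<close> by simp
  ultimately obtain p where p: "p \<in> trig" "l2norm ?P (\<lambda>\<xi>. m \<xi> - p \<xi>) < sqrt e"
    by (rule P.trig_dense)
  have pm: "p \<in> borel_measurable \<nu>h" using p(1) by (rule trig_measurable[OF _ space_dual sets_dual])
  have mpm: "(\<lambda>\<xi>. m \<xi> - p \<xi>) \<in> borel_measurable \<nu>h" using m(1) pm by measurable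
  have "(\<lambda>\<xi>. m \<xi> - p \<xi>) \<in> L2 ?P" by (intro L2_diff P.trig_L2 p \<open>m \<in> L2 ?P\<close>)
  then have i: "integrable \<nu>h (\<lambda>\<xi>. w \<xi> * (cmod (m \<xi> - p \<xi>))\<^sup>2)" using L2P[OF mpm] by simp
  have "(\<integral>\<xi>. w \<xi> * (cmod (m \<xi> - p \<xi>))\<^sup>2 \<partial>\<nu>h) = (l2norm ?P (\<lambda>\<xi>. m \<xi> - p \<xi>))\<^sup>2"
    unfolding l2norm_square using mpm wm wn by (subst integral_density) auto
  also have "\<dots> < (sqrt e)\<^sup>2" using p(2) by (intro power_strict_mono) auto
  also have "\<dots> = e" using \<open>e > 0\<close> by simp
  finally show ?thesis using that p(1) i by blast
qed

lemma trig_mult_integrable: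
  assumes "integrable \<nu>h D" "p \<in> trig"
  shows "integrable \<nu>h (\<lambda>\<xi>. D \<xi> * p \<xi>)"
proof -
  obtain B where B: "B \<ge> 0" "\<And>\<xi>. \<xi> \<in> characters \<Longrightarrow> cmod (p \<xi>) \<le> B" using trig_bounded[OF assms(2)] by blast
  have "p \<in> borel_measurable \<nu>h" using assms(2) by (rule trig_measurable[OF _ space_dual sets_dual])
  show ?thesis
  proof (rule Bochner_Integration.integrable_bound)
    show "integrable \<nu>h (\<lambda>\<xi>. B * cmod (D \<xi>))" using assms(1) by simp
    show "(\<lambda>\<xi>. D \<xi> * p \<xi>) \<in> borel_measurable \<nu>h"
      using assms(1) \<open>p \<in> borel_measurable \<nu>h\<close> by measurable
    show "AE \<xi> in \<nu>h. norm (D \<xi> * p \<xi>) \<le> norm (B * cmod (D \<xi>))"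
      using B by (intro AE_I2) (simp add: space_dual norm_mult mult.commute[of B] mult_left_mono)
  qed
qed

text \<open>D is orthogonal to all trigonometric polynomials. Approximating the indicator of A by
  such p in L2 of the measure with density |D| bounds the square of \<integral> D * 1_A by a
  multiple of the error.\<close>

lemma L1_uniqueness:
  assumes D: "integrable \<nu>h D" and zero: "\<And>a. (\<integral>\<xi>. D \<xi> * \<xi> a \<partial>\<nu>h) = 0"
  shows "AE \<xi> in \<nu>h. D \<xi> = 0"
proof (rule nuh.density_zero[OF D])
  fix A assume A: "A \<in> sets \<nu>h"
  have Dm [measurable]: "D \<in> borel_measurable \<nu>h" using D by (rule borel_measurable_integrable)
  have trig0: "(\<integral>\<xi>. D \<xi> * p \<xi> \<partial>\<nu>h) = 0" if "p \<in> trig" for p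
    using that
  proof induction
    case (ev a)
    show ?case by (rule zero)
  next
    case (add p p')
    then show ?case using trig_mult_integrable[OF D] by (simp add: distrib_left)
  next
    case (scale p c)
    then show ?case by (simp add: mult.left_commute)
  next
    case (ext p p')
    then show ?case
      by (metis (no_types, lifting) Bochner_Integration.integral_cong space_dual)
  qed
  let ?I = "\<integral>\<xi>. D \<xi> * indicator A \<xi> \<partial>\<nu>h"
  have intA: "integrable \<nu>h (\<lambda>\<xi>. D \<xi> * indicator A \<xi>)"
    using integrable_mult_indicator[OF A D] by (simp add: scaleR_conv_of_real mult.commute of_real_indicator)
  have "(cmod ?I)\<^sup>2 \<le> (\<integral>\<xi>. cmod (D \<xi>) \<partial>\<nu>h) * e" if "e > 0" for e
  proof -
    have "integrable \<nu>h (\<lambda>\<xi>. cmod (D \<xi>) * (cmod (indicator A \<xi>))\<^sup>2)"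
      by (rule Bochner_Integration.integrable_bound[OF integrable_norm[OF D]])
        (use A in \<open>auto simp: indicator_def\<close>)
    then obtain p where p: "p \<in> trig" "(\<integral>\<xi>. cmod (D \<xi>) * (cmod (indicator A \<xi> - p \<xi>))\<^sup>2 \<partial>\<nu>h) < e"
        and i: "integrable \<nu>h (\<lambda>\<xi>. cmod (D \<xi>) * (cmod (indicator A \<xi> - p \<xi>))\<^sup>2)"
      using A by (rule_tac weighted_trig_dense[OF integrable_norm[OF D] norm_ge_zero _ _ \<open>e > 0\<close>, of "indicator A"]) auto
    have pm [measurable]: "p \<in> borel_measurable \<nu>h" using p(1) by (rule trig_measurable[OF _ space_dual sets_dual])
    \<comment> \<open>The weight is split as |D| = sqrt|D| * sqrt|D|, so that Cauchy-Schwarz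
      separates the L1 norm of D from the weighted distance between p and the indicator.\<close>
    define f where "f \<xi> = complex_of_real (sqrt (cmod (D \<xi>)))" for \<xi>
    define g where "g \<xi> = f \<xi> * (indicator A \<xi> - p \<xi>)" for \<xi>
    have fm [measurable]: "f \<in> borel_measurable \<nu>h" unfolding f_def by measurable
    have gm [measurable]: "g \<in> borel_measurable \<nu>h" unfolding g_def using A by measurable
    have f2: "(cmod (f \<xi>))\<^sup>2 = cmod (D \<xi>)" and g2: "(cmod (g \<xi>))\<^sup>2 = cmod (D \<xi>) * (cmod (indicator A \<xi> - p \<xi>))\<^sup>2"
      and fg: "cmod (f \<xi>) * cmod (g \<xi>) = cmod (D \<xi> * (indicator A \<xi> - p \<xi>))" for \<xi>
      by (auto simp: f_def g_def norm_mult power_mult_distrib)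
    have fL: "f \<in> L2 \<nu>h" and gL: "g \<in> L2 \<nu>h" using D i by (auto simp: L2_def f2 g2)
    have "?I = (\<integral>\<xi>. D \<xi> * (indicator A \<xi> - p \<xi>) \<partial>\<nu>h)"
      using trig0[OF p(1)] trig_mult_integrable[OF D p(1)] intA by (simp add: right_diff_distrib)
    then have "cmod ?I \<le> (\<integral>\<xi>. cmod (f \<xi>) * cmod (g \<xi>) \<partial>\<nu>h)"
      by (simp only: fg integral_norm_bound)
    also have "\<dots> \<le> l2norm \<nu>h f * l2norm \<nu>h g" by (rule Cauchy_Schwarz_L2[OF fL gL])
    finally have "(cmod ?I)\<^sup>2 \<le> (l2norm \<nu>h f * l2norm \<nu>h g)\<^sup>2" by (intro power_mono) auto
    also have "\<dots> = (\<integral>\<xi>. cmod (D \<xi>) \<partial>\<nu>h) * (\<integral>\<xi>. cmod (D \<xi>) * (cmod (indicator A \<xi> - p \<xi>))\<^sup>2 \<partial>\<nu>h)"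
      by (simp add: power_mult_distrib l2norm_square f2 g2)
    also have "\<dots> \<le> (\<integral>\<xi>. cmod (D \<xi>) \<partial>\<nu>h) * e" using p(2) by (intro mult_left_mono) auto
    finally show ?thesis .
  qed
  note bound = this
  have "(cmod ?I)\<^sup>2 \<le> 0"
  proof (rule field_le_epsilon)
    fix e :: real assume "e > 0"
    define c where "c = (\<integral>\<xi>. cmod (D \<xi>) \<partial>\<nu>h)"
    have "c \<ge> 0" unfolding c_def by simp
    have "(cmod ?I)\<^sup>2 \<le> c * (e / (c + 1))"
      using bound[of "e / (c + 1)"] \<open>e > 0\<close> \<open>c \<ge> 0\<close> unfolding c_def by simp
    also have "\<dots> \<le> e" using \<open>e > 0\<close> \<open>c \<ge> 0\<close> by (simp add: field_simps)
    finally show "(cmod ?I)\<^sup>2 \<le> 0 + e" by simp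
  qed
  then have "?I = 0" by simp
  moreover have "indicator A \<xi> *\<^sub>R D \<xi> = D \<xi> * indicator A \<xi>" for \<xi> by (simp add: indicator_def)
  ultimately show "set_lebesgue_integral \<nu>h A D = 0" by (simp add: set_lebesgue_integral_def)
qed

end

section \<open>The partial Fourier transform\<close>

lemma (in sigma_finite_measure) AE_pair_snd:
  assumes "AE v in M. Q v"
  shows "AE p in N \<Otimes>\<^sub>M M. Q (snd p)"
proof -
  obtain Z where Z: "Z \<in> null_sets M" "{v \<in> space M. \<not> Q v} \<subseteq> Z"
    using assms by (auto simp: eventually_ae_filter)
  have "space N \<times> Z \<in> null_sets (N \<Otimes>\<^sub>M M)"
    using Z(1) by (auto simp: null_sets_def emeasure_pair_measure_Times)
  moreover have "{p \<in> space (N \<Otimes>\<^sub>M M). \<not> Q (snd p)} \<subseteq> space N \<times> Z"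
    using Z(2) by (auto simp: space_pair_measure)
  ultimately show ?thesis by (auto simp: eventually_ae_filter)
qed

section \<open>Square integrable functions on a product\<close>

context pair_sigma_finite
begin

lemma L2_tensor:
  assumes k: "k \<in> L2 M1" and m: "m \<in> L2 M2"
  shows "(\<lambda>p. k (fst p) * m (snd p)) \<in> L2 (M1 \<Otimes>\<^sub>M M2)"
    and "l2norm (M1 \<Otimes>\<^sub>M M2) (\<lambda>p. k (fst p) * m (snd p)) = l2norm M1 k * l2norm M2 m"
proof -
  have km [measurable]: "k \<in> borel_measurable M1" "m \<in> borel_measurable M2"
    using k m by (auto simp: L2_def)
  have tm: "(\<lambda>p. k (fst p) * m (snd p)) \<in> borel_measurable (M1 \<Otimes>\<^sub>M M2)" by measurable
  have "(\<integral>\<^sup>+p. ennreal ((cmod (k (fst p) * m (snd p)))\<^sup>2) \<partial>(M1 \<Otimes>\<^sub>M M2)) =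
      (\<integral>\<^sup>+x. \<integral>\<^sup>+y. ennreal ((cmod (k x))\<^sup>2) * ennreal ((cmod (m y))\<^sup>2) \<partial>M2 \<partial>M1)"
    by (subst M2.nn_integral_fst[symmetric]) (auto simp: norm_mult power_mult_distrib ennreal_mult)
  also have "\<dots> = ennreal ((l2norm M1 k)\<^sup>2) * ennreal ((l2norm M2 m)\<^sup>2)"
    by (simp add: nn_integral_cmult nn_integral_multc l2norm_square_nn_integral k m)
  finally have eq: "(\<integral>\<^sup>+p. ennreal ((cmod (k (fst p) * m (snd p)))\<^sup>2) \<partial>(M1 \<Otimes>\<^sub>M M2)) =
      ennreal ((l2norm M1 k * l2norm M2 m)\<^sup>2)"
    by (simp add: ennreal_mult power_mult_distrib)
  show L: "(\<lambda>p. k (fst p) * m (snd p)) \<in> L2 (M1 \<Otimes>\<^sub>M M2)"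
    unfolding L2_iff_nn_integral eq using tm by simp
  from eq show "l2norm (M1 \<Otimes>\<^sub>M M2) (\<lambda>p. k (fst p) * m (snd p)) = l2norm M1 k * l2norm M2 m"
    unfolding l2norm_square_nn_integral[OF L, symmetric]
    by (simp add: power2_eq_iff_nonneg)
qed

lemma L2_section_snd:
  assumes "f \<in> L2 (M1 \<Otimes>\<^sub>M M2)"
  shows "AE v in M2. (\<lambda>u. f (u, v)) \<in> L2 M1"
proof -
  have [measurable]: "f \<in> borel_measurable (M1 \<Otimes>\<^sub>M M2)" using assms by (simp add: L2_def)
  have "integrable (M1 \<Otimes>\<^sub>M M2) (\<lambda>(u, v). (cmod (f (u, v)))\<^sup>2)"
    using assms by (simp add: L2_def split_beta')
  from AE_integrable_snd[OF this] have "AE v in M2. integrable M1 (\<lambda>u. (cmod (f (u, v)))\<^sup>2)" .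
  moreover have "AE v in M2. (\<lambda>u. f (u, v)) \<in> borel_measurable M1"
    by (intro AE_I2 measurable_compose[OF measurable_Pair2']) (auto simp: \<open>f \<in> borel_measurable _\<close>)
  ultimately show ?thesis by eventually_elim (simp add: L2_def)
qed

lemma L2_section_fst:
  assumes "f \<in> L2 (M1 \<Otimes>\<^sub>M M2)"
  shows "AE u in M1. (\<lambda>v. f (u, v)) \<in> L2 M2"
proof -
  have [measurable]: "f \<in> borel_measurable (M1 \<Otimes>\<^sub>M M2)" using assms by (simp add: L2_def)
  have "integrable (M1 \<Otimes>\<^sub>M M2) (\<lambda>p. (cmod (f p))\<^sup>2)"
    using assms by (simp add: L2_def)
  from AE_integrable_fst'[OF this] have "AE u in M1. integrable M2 (\<lambda>v. (cmod (f (u, v)))\<^sup>2)" .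
  moreover have "AE u in M1. (\<lambda>v. f (u, v)) \<in> borel_measurable M2"
    by (intro AE_I2 measurable_compose[OF measurable_Pair1']) (auto simp: \<open>f \<in> borel_measurable _\<close>)
  ultimately show ?thesis by eventually_elim (simp add: L2_def)
qed

text \<open>Rectangles are an intersection-stable generator of the product sigma-algebra, so
  Dynkin's argument carries vanishing integrals from rectangles to all measurable sets.\<close>

lemma AE_zero_if_orthogonal_rectangles:
  fixes d :: "'a \<times> 'b \<Rightarrow> complex"
  assumes d: "d \<in> L2 (M1 \<Otimes>\<^sub>M M2)"
    and rect: "\<And>A B. A \<in> sets M1 \<Longrightarrow> B \<in> sets M2 \<Longrightarrow> emeasure M1 A < \<infinity> \<Longrightarrow> emeasure M2 B < \<infinity> \<Longrightarrow>
       (\<integral>p. d p * indicator (A \<times> B) p \<partial>(M1 \<Otimes>\<^sub>M M2)) = 0"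
  shows "AE p in M1 \<Otimes>\<^sub>M M2. d p = 0"
proof -
  let ?P = "M1 \<Otimes>\<^sub>M M2"
  have dm [measurable]: "d \<in> borel_measurable ?P" using d by (simp add: L2_def)
  obtain A1 :: "nat \<Rightarrow> 'a set" where A1: "range A1 \<subseteq> sets M1" "(\<Union>i. A1 i) = space M1"
      "\<And>i. emeasure M1 (A1 i) \<noteq> \<infinity>" "incseq A1"
    using M1.sigma_finite_incseq by metis
  obtain A2 :: "nat \<Rightarrow> 'b set" where A2: "range A2 \<subseteq> sets M2" "(\<Union>i. A2 i) = space M2"
      "\<And>i. emeasure M2 (A2 i) \<noteq> \<infinity>" "incseq A2"
    using M2.sigma_finite_incseq by metis
  have main: "AE p in ?P. d p * indicator (A1 n \<times> A2 n) p = 0" for n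
  proof -
    \<comment> \<open>The function d is only square integrable. Cutting it off to a rectangle of
      finite measure makes it integrable, as the complement and union cases of the induction
      require.\<close>
    define D where "D p = d p * indicator (A1 n \<times> A2 n) p" for p
    have rn [measurable]: "A1 n \<in> sets M1" "A2 n \<in> sets M2" using A1 A2 by auto
    have fin: "emeasure ?P (A1 n \<times> A2 n) < \<infinity>"
      using A1(3)[of n] A2(3)[of n] by (auto simp: M2.emeasure_pair_measure_Times ennreal_mult_less_top less_top)
    have "(indicator (A1 n \<times> A2 n) :: _ \<Rightarrow> complex) \<in> L2 ?P"
      using fin by (intro indicator_L2) auto
    from L2_mult_integrable[OF d this] have Di: "integrable ?P D" by (simp add: D_def[abs_def])
    have Dm [measurable]: "D \<in> borel_measurable ?P" using Di by (rule borel_measurable_integrable)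
    have ind: "integrable ?P (\<lambda>p. D p * indicator E p)" if "E \<in> sets ?P" for E
      using integrable_mult_indicator[OF that Di] by (simp add: scaleR_conv_of_real mult.commute of_real_indicator)
    have gen: "(\<integral>p. D p * indicator (A \<times> B) p \<partial>?P) = 0" if "A \<in> sets M1" "B \<in> sets M2" for A B
    proof -
      have "(\<lambda>p. D p * indicator (A \<times> B) p) = (\<lambda>p. d p * indicator ((A1 n \<inter> A) \<times> (A2 n \<inter> B)) p)"
        by (auto simp: D_def indicator_def)
      moreover have "emeasure M1 (A1 n \<inter> A) < \<infinity>"
        using A1(3)[of n] emeasure_mono[of "A1 n \<inter> A" "A1 n" M1] by (auto simp: less_top intro: le_less_trans)
      moreover have "emeasure M2 (A2 n \<inter> B) < \<infinity>"
        using A2(3)[of n] emeasure_mono[of "A2 n \<inter> B" "A2 n" M2] by (auto simp: less_top intro: le_less_trans)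
      ultimately show ?thesis using rect[of "A1 n \<inter> A" "A2 n \<inter> B"] that by simp
    qed
    have full: "(\<integral>p. D p \<partial>?P) = 0"
    proof -
      have "(\<integral>p. D p \<partial>?P) = (\<integral>p. D p * indicator (space M1 \<times> space M2) p \<partial>?P)"
        by (intro Bochner_Integration.integral_cong) (auto simp: space_pair_measure indicator_def)
      then show ?thesis using gen[of "space M1" "space M2"] by simp
    qed
    have all: "(\<integral>p. D p * indicator E p \<partial>?P) = 0" if "E \<in> sets ?P" for E
      using Int_stable_pair_measure_generator pair_measure_closed that unfolding sets_pair_measure
    proof (induct rule: sigma_sets_induct_disjoint)
      case (basic E)
      then show ?case using gen by auto
    next
      case empty
      show ?case by simp
    next
      case (compl E)
      then have E: "E \<in> sets ?P" by (simp add: sets_pair_measure)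
      have "(\<integral>p. D p * indicator (space M1 \<times> space M2 - E) p \<partial>?P) = (\<integral>p. D p - D p * indicator E p \<partial>?P)"
        by (intro Bochner_Integration.integral_cong) (auto simp: space_pair_measure indicator_def)
      also have "\<dots> = 0" using full compl ind[OF E] Di by simp
      finally show ?case .
    next
      case (union A)
      then have E: "\<And>i. A i \<in> sets ?P" by (auto simp: sets_pair_measure)
      have L: "(\<lambda>n. \<integral>p. D p * indicator (\<Union>i<n. A i) p \<partial>?P) \<longlonglongrightarrow> (\<integral>p. D p * indicator (\<Union>i. A i) p \<partial>?P)"
      proof (rule integral_dominated_convergence[where w="\<lambda>p. cmod (D p)"])
        show "AE p in ?P. (\<lambda>n. D p * indicator (\<Union>i<n. A i) p) \<longlonglongrightarrow> D p * indicator (\<Union>i. A i) p"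
          by (intro AE_I2 tendsto_mult_left LIMSEQ_indicator_UN)
      qed (use E Di in \<open>auto simp: indicator_def\<close>)
      have z: "(\<integral>p. D p * indicator (\<Union>i<n. A i) p \<partial>?P) = 0" for n :: nat
      proof -
        have "(indicator (\<Union>i<n. A i) p :: complex) = (\<Sum>i<n. indicator (A i) p)" for p
          using union(1) by (subst indicator_UN_disjoint) (auto simp: disjoint_family_on_def)
        then have "(\<integral>p. D p * indicator (\<Union>i<n. A i) p \<partial>?P) = (\<Sum>i<n. \<integral>p. D p * indicator (A i) p \<partial>?P)"
          by (simp only: sum_distrib_left) (rule Bochner_Integration.integral_sum, rule ind[OF E])
        then show ?thesis using union by simp
      qed
      from L[unfolded z] show ?case by (simp add: LIMSEQ_const_iff)
    qed
    have "AE p in ?P. D p = 0"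
    proof (rule density_zero[OF Di])
      fix E assume "E \<in> sets ?P"
      moreover have "indicator E p *\<^sub>R D p = D p * indicator E p" for p by (simp add: indicator_def)
      ultimately show "set_lebesgue_integral ?P E D = 0"
        using all by (simp add: set_lebesgue_integral_def)
    qed
    then show ?thesis by (simp add: D_def)
  qed
  then have "AE p in ?P. \<forall>n. d p * indicator (A1 n \<times> A2 n) p = 0" unfolding AE_all_countable by (rule allI)
  then show ?thesis
  proof (rule AE_mp, intro AE_I2 impI)
    fix p assume "p \<in> space ?P" and z: "\<forall>n. d p * indicator (A1 n \<times> A2 n) p = 0"
    then have "fst p \<in> (\<Union>i. A1 i)" "snd p \<in> (\<Union>i. A2 i)"
      unfolding A1(2) A2(2) by (auto simp: space_pair_measure)
    then obtain i j where "fst p \<in> A1 i" "snd p \<in> A2 j" by blast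
    \<comment> \<open>Both exhausting sequences increase, so one common index covers both
      coordinates and the diagonal family of rectangles is enough.\<close>
    then have "fst p \<in> A1 (max i j)" "snd p \<in> A2 (max i j)"
      using incseqD[OF A1(4), of i "max i j"] incseqD[OF A2(4), of j "max i j"] by auto
    then have "p \<in> A1 (max i j) \<times> A2 (max i j)" by (simp add: mem_Times_iff)
    then show "d p = 0" using z[rule_format, of "max i j"] by simp
  qed
qed

end

section \<open>The partial transform: explicit formula, uniqueness, existence\<close>

locale fourier_pair = plancherel_pair \<nu> \<nu>h + mu: sigma_finite_measure \<mu>
  for \<nu> :: "'g::{ab_group_add,metric_space} measure" and \<nu>h :: "('g \<Rightarrow> complex) measure"
    and \<mu> :: "'y measure"
begin

sublocale pM: pair_sigma_finite \<nu> \<mu> ..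
sublocale pH: pair_sigma_finite \<nu>h \<mu> ..
sublocale pD: pair_sigma_finite \<nu>h \<nu> ..

abbreviation "M \<equiv> \<nu> \<Otimes>\<^sub>M \<mu>"
abbreviation "Mh \<equiv> \<nu>h \<Otimes>\<^sub>M \<mu>"

text \<open>On functions with integrable sections, \<open>FT\<close> is an explicit version of the choice-defined \<open>FI\<close>.\<close>

definition FT :: "('g \<times> 'y \<Rightarrow> complex) \<Rightarrow> ('g \<Rightarrow> complex) \<times> 'y \<Rightarrow> complex" where
  "FT f p = fourier \<nu> (\<lambda>u. f (u, snd p)) (fst p)"

text \<open>The Fourier integral represents the transform only on integrable sections; elsewhere the
  Bochner integral takes the default value 0. Additivity and isometry of \<open>FT\<close> are
  therefore claimed on this class, which contains all kernels K_{x,y}.\<close>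

definition L1_sections :: "('g \<times> 'y \<Rightarrow> complex) \<Rightarrow> bool" where
  "L1_sections f \<longleftrightarrow> (AE v in \<mu>. integrable \<nu> (\<lambda>u. f (u, v)))"

lemma FT_measurable [measurable]:
  assumes [measurable]: "f \<in> borel_measurable M"
  shows "FT f \<in> borel_measurable Mh"
proof -
  have 1: "(\<lambda>q. f (snd q, snd (fst q))) \<in> borel_measurable (Mh \<Otimes>\<^sub>M \<nu>)" by measurable
  have "(\<lambda>q. (fst (fst q), snd q)) \<in> measurable (Mh \<Otimes>\<^sub>M \<nu>) (\<nu>h \<Otimes>\<^sub>M \<nu>)" by measurable
  from measurable_compose[OF this joint_ev_measurable]
  have 2: "(\<lambda>q. fst (fst q) (snd q)) \<in> borel_measurable (Mh \<Otimes>\<^sub>M \<nu>)" by simp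
  have "(\<lambda>q. f (snd q, snd (fst q)) * cnj (fst (fst q) (snd q))) \<in> borel_measurable (Mh \<Otimes>\<^sub>M \<nu>)"
    by (intro borel_measurable_times borel_measurable_cnj 1 2)
  then have "(\<lambda>p. \<integral>u. f (u, snd p) * cnj (fst p u) \<partial>\<nu>) \<in> borel_measurable Mh"
    by (intro nu.borel_measurable_lebesgue_integral) (simp add: split_beta')
  then show ?thesis by (simp add: FT_def[abs_def] fourier_def)
qed

lemma FT_isometry:
  assumes f: "f \<in> L2 M" "L1_sections f"
  shows "FT f \<in> L2 Mh" "l2norm Mh (FT f) = l2norm M f"
proof -
  have fm [measurable]: "f \<in> borel_measurable M" using f by (simp add: L2_def)
  have "(\<integral>\<^sup>+p. ennreal ((cmod (FT f p))\<^sup>2) \<partial>Mh) = (\<integral>\<^sup>+v. \<integral>\<^sup>+\<xi>. ennreal ((cmod (FT f (\<xi>, v)))\<^sup>2) \<partial>\<nu>h \<partial>\<mu>)"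
    by (rule pH.nn_integral_snd[symmetric]) measurable
  also have "\<dots> = (\<integral>\<^sup>+v. \<integral>\<^sup>+u. ennreal ((cmod (f (u, v)))\<^sup>2) \<partial>\<nu> \<partial>\<mu>)"
  proof (rule nn_integral_cong_AE)
    show "AE v in \<mu>. (\<integral>\<^sup>+\<xi>. ennreal ((cmod (FT f (\<xi>, v)))\<^sup>2) \<partial>\<nu>h) = (\<integral>\<^sup>+u. ennreal ((cmod (f (u, v)))\<^sup>2) \<partial>\<nu>)"
      using f(2)[unfolded L1_sections_def] pM.L2_section_snd[OF f(1)]
    proof eventually_elim
      case (elim v)
      note pl = plancherel[OF elim(2,1)]
      have "(\<lambda>\<xi>. FT f (\<xi>, v)) = fourier \<nu> (\<lambda>u. f (u, v))" by (simp add: FT_def)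
      then show ?case
        using l2norm_square_nn_integral[OF pl(1)] l2norm_square_nn_integral[OF elim(2)] pl(2) by (simp add: fun_eq_iff)
    qed
  qed
  also have "\<dots> = (\<integral>\<^sup>+p. ennreal ((cmod (f p))\<^sup>2) \<partial>M)"
    by (rule pM.nn_integral_snd) measurable
  finally have eq: "(\<integral>\<^sup>+p. ennreal ((cmod (FT f p))\<^sup>2) \<partial>Mh) = (\<integral>\<^sup>+p. ennreal ((cmod (f p))\<^sup>2) \<partial>M)" .
  show L: "FT f \<in> L2 Mh" using f(1) by (simp add: L2_iff_nn_integral eq)
  show "l2norm Mh (FT f) = l2norm M f"
    using eq unfolding l2norm_square_nn_integral[OF L, symmetric] l2norm_square_nn_integral[OF f(1), symmetric]
    by (simp add: power2_eq_iff_nonneg)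
qed

lemma FT_add_scale:
  assumes "L1_sections f" "L1_sections g"
  shows "AE p in Mh. FT (\<lambda>p. f p + c * g p) p = FT f p + c * FT g p"
proof -
  have "AE v in \<mu>. \<forall>\<xi>\<in>characters. FT (\<lambda>p. f p + c * g p) (\<xi>, v) = FT f (\<xi>, v) + c * FT g (\<xi>, v)"
    using assms unfolding L1_sections_def
    by eventually_elim (simp add: FT_def fourier_add_scale)
  from mu.AE_pair_snd[OF this, of \<nu>h] show ?thesis
    by (rule AE_mp) (auto intro!: AE_I2 simp: space_pair_measure space_dual)
qed

lemma L1_sections_add_scale:
  assumes "L1_sections f" "L1_sections g"
  shows "L1_sections (\<lambda>p. f p + c * g p)"
  using assms unfolding L1_sections_def by eventually_elim simp

lemma FT_ip:
  assumes f: "f \<in> L2 M" "L1_sections f" and g: "g \<in> L2 M" "L1_sections g"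
  shows "ip Mh (FT f) (FT g) = ip M f g"
proof (rule ip_eq_if_l2norm_eq)
  fix c
  have [measurable]: "f \<in> borel_measurable M" "g \<in> borel_measurable M" using f g by (auto simp: L2_def)
  have "l2norm Mh (\<lambda>p. FT f p + c * FT g p) = l2norm Mh (FT (\<lambda>p. f p + c * g p))"
    by (intro l2norm_cong_AE) (auto intro: AE_symmetric[OF FT_add_scale[OF f(2) g(2)]])
  also have "\<dots> = l2norm M (\<lambda>p. f p + c * g p)"
    using f g by (intro FT_isometry L2_add_scale L1_sections_add_scale)
  finally show "l2norm Mh (\<lambda>p. FT f p + c * FT g p) = l2norm M (\<lambda>p. f p + c * g p)" .
qed (use f g FT_isometry in auto)

lemma FT_tensor: "FT (\<lambda>p. k (fst p) * m (snd p)) p = fourier \<nu> k (fst p) * m (snd p)"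
proof -
  have "(\<lambda>u. k u * m (snd p) * cnj (fst p u)) = (\<lambda>u. k u * cnj (fst p u) * m (snd p))" by (simp add: mult_ac)
  then show ?thesis by (simp add: FT_def fourier_def)
qed

text \<open>The test functions are total: the indicator of a set of finite measure in the dual is an
  L2 limit of Fourier transforms, so d is orthogonal to every rectangle with sides of finite
  measure.\<close>

lemma FI_unique:
  assumes d: "d \<in> L2 Mh"
    and zero: "\<And>k m. k \<in> L2 \<nu> \<Longrightarrow> integrable \<nu> k \<Longrightarrow> m \<in> L2 \<mu> \<Longrightarrow>
        ip Mh d (\<lambda>p. fourier \<nu> k (fst p) * m (snd p)) = 0"
  shows "AE p in Mh. d p = 0"
proof (rule pH.AE_zero_if_orthogonal_rectangles[OF d])
  fix A B assume A: "A \<in> sets \<nu>h" "emeasure \<nu>h A < \<infinity>" and B: "B \<in> sets \<mu>" "emeasure \<mu> B < \<infinity>"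
  let ?a = "indicator A :: _ \<Rightarrow> complex" and ?b = "indicator B :: _ \<Rightarrow> complex"
  have aL: "?a \<in> L2 \<nu>h" and bL: "?b \<in> L2 \<mu>" using indicator_L2[OF A] indicator_L2[OF B] .
  have "cmod (ip Mh d (\<lambda>p. ?a (fst p) * ?b (snd p))) \<le> l2norm Mh d * (e * l2norm \<mu> ?b)" if "e > 0" for e
  proof -
    obtain k where k: "k \<in> L2 \<nu>" "integrable \<nu> k" "l2norm \<nu>h (\<lambda>\<xi>. ?a \<xi> - fourier \<nu> k \<xi>) < e"
      using fourier_dense[OF aL \<open>e > 0\<close>] by blast
    have fk: "fourier \<nu> k \<in> L2 \<nu>h" by (rule plancherel[OF k(1,2)])
    note d1 = L2_diff[OF aL fk]
    have "ip Mh d (\<lambda>p. ?a (fst p) * ?b (snd p)) =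
       ip Mh d (\<lambda>p. ?a (fst p) * ?b (snd p)) - ip Mh d (\<lambda>p. fourier \<nu> k (fst p) * ?b (snd p))"
      using zero[OF k(1,2) bL] by simp
    also have "\<dots> = ip Mh d (\<lambda>p. ?a (fst p) * ?b (snd p) - fourier \<nu> k (fst p) * ?b (snd p))"
      by (intro ip_diff_right[symmetric] pH.L2_tensor d aL bL fk)
    also have "\<dots> = ip Mh d (\<lambda>p. (?a (fst p) - fourier \<nu> k (fst p)) * ?b (snd p))"
      by (simp only: left_diff_distrib)
    finally have "cmod (ip Mh d (\<lambda>p. ?a (fst p) * ?b (snd p))) \<le> l2norm Mh d * l2norm Mh (\<lambda>p. (?a (fst p) - fourier \<nu> k (fst p)) * ?b (snd p))"
      using ip_Cauchy_Schwarz[OF d pH.L2_tensor(1)[OF d1 bL]] by simp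
    also have "\<dots> = l2norm Mh d * (l2norm \<nu>h (\<lambda>\<xi>. ?a \<xi> - fourier \<nu> k \<xi>) * l2norm \<mu> ?b)"
      using pH.L2_tensor(2)[OF d1 bL] by simp
    also have "\<dots> \<le> l2norm Mh d * (e * l2norm \<mu> ?b)"
      using k(3) by (intro mult_left_mono mult_right_mono) auto
    finally show ?thesis .
  qed
  note bound = this
  have "cmod (ip Mh d (\<lambda>p. ?a (fst p) * ?b (snd p))) \<le> 0"
  proof (rule field_le_epsilon)
    fix e :: real assume "e > 0"
    define c where "c = l2norm Mh d * l2norm \<mu> ?b"
    have "c \<ge> 0" by (simp add: c_def)
    have "cmod (ip Mh d (\<lambda>p. ?a (fst p) * ?b (snd p))) \<le> c * (e / (c + 1))"
      using bound[OF divide_pos_pos[OF \<open>e > 0\<close>, of "c + 1"]] \<open>c \<ge> 0\<close>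
      by (simp add: mult.left_commute mult.commute flip: c_def) (simp add: c_def mult_ac)
    also have "\<dots> \<le> e" using \<open>e > 0\<close> \<open>c \<ge> 0\<close> by (simp add: field_simps)
    finally show "cmod (ip Mh d (\<lambda>p. ?a (fst p) * ?b (snd p))) \<le> 0 + e" by simp
  qed
  moreover have "ip Mh d (\<lambda>p. ?a (fst p) * ?b (snd p)) = (\<integral>p. d p * indicator (A \<times> B) p \<partial>Mh)"
    unfolding ip_def by (intro Bochner_Integration.integral_cong) (auto simp: indicator_def)
  ultimately show "(\<integral>p. d p * indicator (A \<times> B) p \<partial>Mh) = 0" by simp
qed

text \<open>Restricting f to a set of finite Haar measure in the group variable makes almost every
  section integrable, being a product of two L2 functions. The truncations converge to f, and their
  explicit transforms are Cauchy by isometry. The limit obeys Parseval against every h with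
  integrable sections, not only against products.\<close>

lemma FI_exists:
  assumes f: "f \<in> L2 M"
  obtains g where "g \<in> L2 Mh" "\<And>h. h \<in> L2 M \<Longrightarrow> L1_sections h \<Longrightarrow> ip Mh g (FT h) = ip M f h"
proof -
  have fm [measurable]: "f \<in> borel_measurable M" using f by (simp add: L2_def)
  obtain A :: "nat \<Rightarrow> 'g set" where A: "range A \<subseteq> sets \<nu>" "(\<Union>i. A i) = space \<nu>"
      "\<And>i. emeasure \<nu> (A i) \<noteq> \<infinity>" "incseq A"
    using nu.sigma_finite_incseq by metis
  have Am [measurable]: "A n \<in> sets \<nu>" for n using A by auto
  define s where "s n p = f p * indicator (A n) (fst p)" for n p
  have sm [measurable]: "s n \<in> borel_measurable M" for n unfolding s_def[abs_def] by measurable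
  have sL: "s n \<in> L2 M" for n
    by (rule L2_bound[OF f sm, where C=1]) (auto simp: s_def indicator_def)
  have s1: "L1_sections (s n)" for n
    unfolding L1_sections_def using pM.L2_section_snd[OF f]
  proof eventually_elim
    case (elim v)
    have "(indicator (A n) :: _ \<Rightarrow> complex) \<in> L2 \<nu>"
      using A(3)[of n] by (intro indicator_L2) (auto simp: less_top)
    from L2_mult_integrable[OF elim this] show ?case by (simp add: s_def)
  qed
  have lim: "(\<lambda>n. l2norm M (\<lambda>p. s n p - f p)) \<longlonglongrightarrow> 0"
  proof (rule L2_dominated_convergence[OF sm fm f])
    show "AE p in M. cmod (s n p - f p) \<le> 1 * cmod (f p)" for n by (auto simp: s_def indicator_def)
    show "AE p in M. (\<lambda>n. s n p) \<longlonglongrightarrow> f p"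
    proof (intro AE_I2)
      fix p assume "p \<in> space M"
      then have "fst p \<in> (\<Union>i. A i)" using A(2) by (auto simp: space_pair_measure)
      then have "(\<lambda>n. f p * indicator (A n) (fst p)) \<longlonglongrightarrow> f p * indicator (\<Union>i. A i) (fst p)"
        by (intro tendsto_mult_left LIMSEQ_indicator_incseq A)
      then show "(\<lambda>n. s n p) \<longlonglongrightarrow> f p" using \<open>fst p \<in> _\<close> by (simp add: s_def)
    qed
  qed
  have dist: "l2norm Mh (\<lambda>p. FT (s m) p - FT (s n) p) = l2norm M (\<lambda>p. s m p - s n p)" for m n
  proof -
    have "AE p in Mh. FT (s m) p - FT (s n) p = FT (\<lambda>p. s m p - s n p) p"
      using FT_add_scale[OF s1[of m] s1[of n], of "-1"] by eventually_elim simp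
    then have "l2norm Mh (\<lambda>p. FT (s m) p - FT (s n) p) = l2norm Mh (FT (\<lambda>p. s m p - s n p))"
      by (intro l2norm_cong_AE) auto
    also have "\<dots> = l2norm M (\<lambda>p. s m p - s n p)"
      using L1_sections_add_scale[OF s1[of m] s1[of n], of "-1"] by (intro FT_isometry L2_diff sL) simp
    finally show ?thesis .
  qed
  have FTL: "FT (s n) \<in> L2 Mh" for n by (rule FT_isometry[OF sL s1])
  have cauchy: "\<exists>N. \<forall>m\<ge>N. \<forall>n\<ge>N. l2norm Mh (\<lambda>p. FT (s m) p - FT (s n) p) < e" if "e > 0" for e
  proof -
    obtain N where N: "\<And>n. n \<ge> N \<Longrightarrow> l2norm M (\<lambda>p. s n p - f p) < e/2"
      using LIMSEQ_D[OF lim, of "e/2"] \<open>e > 0\<close> by auto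
    have "l2norm M (\<lambda>p. s m p - s n p) < e" if "m \<ge> N" "n \<ge> N" for m n
      using l2norm_triangle_diff[OF sL f sL, of m n] N[OF that(1)] N[OF that(2)]
        l2norm_minus_commute[of M "s n" f] by simp
    then show ?thesis unfolding dist by blast
  qed
  obtain g where g: "g \<in> L2 Mh" "(\<lambda>n. l2norm Mh (\<lambda>p. FT (s n) p - g p)) \<longlonglongrightarrow> 0"
    using L2_complete[OF FTL cauchy] by blast
  show ?thesis
  proof (rule that[OF g(1)])
    fix h assume h: "h \<in> L2 M" "L1_sections h"
    have "(\<lambda>n. ip Mh (FT (s n)) (FT h)) \<longlonglongrightarrow> ip Mh g (FT h)"
      by (intro ip_tendsto_left FTL g FT_isometry h)
    moreover have "(\<lambda>n. ip M (s n) h) \<longlonglongrightarrow> ip M f h"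
      by (intro ip_tendsto_left sL f h lim)
    ultimately show "ip Mh g (FT h) = ip M f h"
      using LIMSEQ_unique by (simp add: FT_ip[OF sL s1 h])
  qed
qed

lemma tensor_L1_sections: "integrable \<nu> k \<Longrightarrow> L1_sections (\<lambda>p. k (fst p) * m (snd p))"
  by (simp add: L1_sections_def)

text \<open>The choice behind \<open>FI\<close> fixes a function through its inner products with
  tensor products alone. \<open>FI_unique\<close> identifies it almost everywhere with the limit
  from \<open>FI_exists\<close>, so Parseval becomes available against the kernels, which are not
  products.\<close>

lemma FI_props:
  assumes f: "f \<in> L2 M"
  shows "FI \<nu> \<nu>h \<mu> f \<in> L2 Mh"
    and "\<And>h. h \<in> L2 M \<Longrightarrow> L1_sections h \<Longrightarrow> ip Mh (FI \<nu> \<nu>h \<mu> f) (FT h) = ip M f h"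
proof -
  obtain g where g: "g \<in> L2 Mh" "\<And>h. h \<in> L2 M \<Longrightarrow> L1_sections h \<Longrightarrow> ip Mh g (FT h) = ip M f h"
    using FI_exists[OF f] by blast
  have gt: "ip Mh g (\<lambda>p. fourier \<nu> k (fst p) * m (snd p)) = ip M f (\<lambda>p. k (fst p) * m (snd p))"
    if "k \<in> L2 \<nu>" "integrable \<nu> k" "m \<in> L2 \<mu>" for k m
    using g(2)[OF pM.L2_tensor(1)[OF that(1,3)] tensor_L1_sections[OF that(2)]]
    by (simp add: FT_tensor[abs_def])
  let ?Q = "\<lambda>g. g \<in> L2 Mh \<and>
     (\<forall>k m. k \<in> L2 \<nu> \<and> integrable \<nu> k \<and> m \<in> L2 \<mu> \<longrightarrow>
        (\<integral>p. g p * cnj (fourier \<nu> k (fst p) * m (snd p)) \<partial>Mh) =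
        (\<integral>p. f p * cnj (k (fst p) * m (snd p)) \<partial>M))"
  have "?Q g" using g(1) gt unfolding ip_def by blast
  then have FIQ: "?Q (FI \<nu> \<nu>h \<mu> f)" unfolding FI_def by (rule someI[of ?Q g])
  then show FIL: "FI \<nu> \<nu>h \<mu> f \<in> L2 Mh" by blast
  have "AE p in Mh. FI \<nu> \<nu>h \<mu> f p - g p = 0"
  proof (rule FI_unique[OF L2_diff[OF FIL g(1)]])
    fix k m assume km: "k \<in> L2 \<nu>" "integrable \<nu> k" "m \<in> L2 \<mu>"
    have "ip Mh (FI \<nu> \<nu>h \<mu> f) (\<lambda>p. fourier \<nu> k (fst p) * m (snd p)) = ip M f (\<lambda>p. k (fst p) * m (snd p))"
      using FIQ km unfolding ip_def by blast
    moreover have "(\<lambda>p. fourier \<nu> k (fst p) * m (snd p)) \<in> L2 Mh"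
      by (intro pH.L2_tensor plancherel km)
    ultimately show "ip Mh (\<lambda>p. FI \<nu> \<nu>h \<mu> f p - g p) (\<lambda>p. fourier \<nu> k (fst p) * m (snd p)) = 0"
      using gt[OF km] FIL g(1) by (simp add: ip_diff_left)
  qed
  then have ae: "AE p in Mh. FI \<nu> \<nu>h \<mu> f p = g p" by simp
  fix h assume h: "h \<in> L2 M" "L1_sections h"
  have "ip Mh (FI \<nu> \<nu>h \<mu> f) (FT h) = ip Mh g (FT h)"
    using FIL g(1) FT_isometry(1)[OF h] ae by (intro ip_cong_AE) (auto simp: L2_def)
  then show "ip Mh (FI \<nu> \<nu>h \<mu> f) (FT h) = ip M f h" using g(2)[OF h] by simp
qed

end

section \<open>The Fourier transform of the kernel\<close>

text \<open>Every integrable function is a product of two square integrable ones, so products of elements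
  of a dense subset of L2 are dense in L1.\<close>

lemma L1_approx_by_L2_products:
  assumes D: "D \<subseteq> L2 M" "\<And>f e. f \<in> L2 M \<Longrightarrow> e > 0 \<Longrightarrow> \<exists>d\<in>D. l2norm M (\<lambda>x. f x - d x) < e"
    and k: "integrable M k" and "e > 0"
  obtains d1 d2 where "d1 \<in> D" "d2 \<in> D" "(\<integral>x. cmod (k x - d1 x * d2 x) \<partial>M) < e"
proof -
  have [measurable]: "k \<in> borel_measurable M" using k by simp
  define f where "f x = complex_of_real (sqrt (cmod (k x)))" for x
  \<comment> \<open>Where k vanishes, the quotient is 0 by convention, so k = f * g holds at every
    point.\<close>
  define g where "g x = k x / f x" for x
  have kfg: "k x = f x * g x" for x by (auto simp: g_def f_def)
  have [measurable]: "f \<in> borel_measurable M" "g \<in> borel_measurable M"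
    unfolding g_def f_def by measurable
  have f2: "(cmod (f x))\<^sup>2 = cmod (k x)" for x by (simp add: f_def)
  have g2: "(cmod (g x))\<^sup>2 = cmod (k x)" for x
    by (cases "k x = 0") (auto simp: g_def f_def norm_divide power_divide power2_eq_square)
  have fL: "f \<in> L2 M" and gL: "g \<in> L2 M" using k by (auto simp: L2_def f2 g2)
  have "e / (2 * (l2norm M g + 1)) > 0" using \<open>e > 0\<close> by (simp add: add_nonneg_pos)
  then obtain d1 where d1: "d1 \<in> D" "l2norm M (\<lambda>x. f x - d1 x) < e / (2 * (l2norm M g + 1))"
    using D(2)[OF fL] by blast
  \<comment> \<open>The error splits as (f - d1) * g + d1 * (g - d2), so the tolerance for d2 can
    only be set once d1 is known. Adding 1 keeps the denominators positive.\<close>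
  have "e / (2 * (l2norm M d1 + 1)) > 0" using \<open>e > 0\<close> by (simp add: add_nonneg_pos)
  then obtain d2 where d2: "d2 \<in> D" "l2norm M (\<lambda>x. g x - d2 x) < e / (2 * (l2norm M d1 + 1))"
    using D(2)[OF gL] by blast
  have dL: "d1 \<in> L2 M" "d2 \<in> L2 M" using D d1 d2 by auto
  have i1: "integrable M (\<lambda>x. cmod (f x - d1 x) * cmod (g x))"
    using integrable_norm[OF L2_mult_integrable[OF L2_diff[OF fL dL(1)] gL]] by (simp add: norm_mult)
  have i2: "integrable M (\<lambda>x. cmod (d1 x) * cmod (g x - d2 x))"
    using integrable_norm[OF L2_mult_integrable[OF dL(1) L2_diff[OF gL dL(2)]]] by (simp add: norm_mult)
  have bound: "a * b \<le> e / 2" if "a < e / (2 * (b + 1))" "b \<ge> 0" for a b :: real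
  proof -
    have "a * b \<le> (e / (2 * (b + 1))) * b" using that by (intro mult_right_mono) auto
    also have "\<dots> \<le> e / 2" using that \<open>e > 0\<close> by (simp add: field_simps)
    finally show ?thesis .
  qed
  have strict: "b * a < e / 2" if "a < e / (2 * (b + 1))" "b \<ge> 0" "a \<ge> 0" for a b :: real
  proof -
    have "b * a \<le> (b + 1) * a" using that by (intro mult_right_mono) auto
    also have "\<dots> < e / 2" using that by (simp add: field_simps)
    finally show ?thesis .
  qed
  have "(\<integral>x. cmod (k x - d1 x * d2 x) \<partial>M) \<le>
      (\<integral>x. cmod (f x - d1 x) * cmod (g x) + cmod (d1 x) * cmod (g x - d2 x) \<partial>M)"
  proof (rule integral_mono)
    show "integrable M (\<lambda>x. cmod (k x - d1 x * d2 x))"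
      using k L2_mult_integrable[OF dL] by (intro integrable_norm Bochner_Integration.integrable_diff)
    show "integrable M (\<lambda>x. cmod (f x - d1 x) * cmod (g x) + cmod (d1 x) * cmod (g x - d2 x))"
      using i1 i2 by simp
    fix x
    have "k x - d1 x * d2 x = (f x - d1 x) * g x + d1 x * (g x - d2 x)"
      by (simp add: kfg algebra_simps)
    then show "cmod (k x - d1 x * d2 x) \<le> cmod (f x - d1 x) * cmod (g x) + cmod (d1 x) * cmod (g x - d2 x)"
      by (metis norm_mult norm_triangle_ineq)
  qed
  also have "\<dots> = (\<integral>x. cmod (f x - d1 x) * cmod (g x) \<partial>M) + (\<integral>x. cmod (d1 x) * cmod (g x - d2 x) \<partial>M)"
    using i1 i2 by simp
  also have "\<dots> \<le> l2norm M (\<lambda>x. f x - d1 x) * l2norm M g + l2norm M d1 * l2norm M (\<lambda>x. g x - d2 x)"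
    by (intro add_mono Cauchy_Schwarz_L2 L2_diff fL gL dL)
  also have "\<dots> < e / 2 + e / 2"
    using bound[OF d1(2)] strict[OF d2(2)] by (intro add_le_less_mono) auto
  finally show ?thesis using that d1(1) d2(1) by simp
qed

locale rkhs_setting = fourier_pair \<nu> \<nu>h \<mu>
  for \<nu> :: "'g::{ab_group_add,metric_space} measure" and \<nu>h :: "('g \<Rightarrow> complex) measure"
    and \<mu> :: "'y measure" +
  fixes H :: "('g \<times> 'y \<Rightarrow> complex) set" and K :: "'g \<Rightarrow> 'y \<Rightarrow> ('g \<times> 'y \<Rightarrow> complex)"
    and q :: "('g \<Rightarrow> complex) \<Rightarrow> 'y \<Rightarrow> complex"
  assumes space_mu [simp]: "space \<mu> = UNIV"
    and sep: "separable_L2 \<nu>"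
    and rkhs: "rkhs_L2 (\<nu> \<Otimes>\<^sub>M \<mu>) H (\<lambda>(x, y). K x y)"
    and Ktrans: "\<And>u x v y. K x y (u, v) = K 0 y (u - x, v)"
    and Kint: "\<And>y. \<exists>C::real. \<forall>v. (\<integral>\<^sup>+u. ennreal (cmod (K 0 y (u, v))) \<partial>\<nu>) \<le> ennreal C"
    and Omega_sets: "Omega \<nu> K \<in> sets \<nu>h"
    and qmeas: "(\<lambda>p. q (fst p) (snd p)) \<in> borel_measurable (restrict_space \<nu>h (Omega \<nu> K) \<Otimes>\<^sub>M \<mu>)"
    and qfac: "\<And>\<xi> y v. \<xi> \<in> Omega \<nu> K \<Longrightarrow> LK \<nu> K \<xi> y v = cnj (q \<xi> y) * q \<xi> v"
begin

abbreviation "\<Omega> \<equiv> Omega \<nu> K"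
abbreviation "N \<equiv> restrict_space \<nu>h \<Omega>"

lemma space_M [simp]: "space M = UNIV"
  by (simp add: space_pair_measure)

lemma H_L2: "f \<in> H \<Longrightarrow> f \<in> L2 M"
  using rkhs unfolding rkhs_L2_def by auto

lemma H_lin: "f \<in> H \<Longrightarrow> g \<in> H \<Longrightarrow> (\<lambda>p. c * f p + g p) \<in> H"
  using rkhs unfolding rkhs_L2_def by auto

lemma H_zero: "(\<lambda>_. 0) \<in> H"
  using rkhs unfolding rkhs_L2_def by (elim conjE)

lemma H_scale: "f \<in> H \<Longrightarrow> (\<lambda>p. c * f p) \<in> H"
  using H_lin[OF _ H_zero, of f c] by simp

lemma H_add: "f \<in> H \<Longrightarrow> g \<in> H \<Longrightarrow> (\<lambda>p. f p + g p) \<in> H"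
  using H_lin[of f g 1] by simp

lemma K_H: "K x y \<in> H"
proof -
  have "\<forall>p. (case p of (x, y) \<Rightarrow> K x y) \<in> H" using rkhs unfolding rkhs_L2_def by (elim conjE)
  from spec[OF this, of "(x, y)"] show ?thesis by simp
qed

lemma reproducing:
  assumes "f \<in> H"
  shows "f (x, y) = ip M f (K x y)"
proof -
  have "\<forall>f\<in>H. \<forall>p. f p = (\<integral>q. f q * cnj ((case p of (x, y) \<Rightarrow> K x y) q) \<partial>M)"
    using rkhs unfolding rkhs_L2_def by (elim conjE)
  from spec[OF bspec[OF this assms], of "(x, y)"] show ?thesis by (simp add: ip_def)
qed

lemma H_complete:
  assumes "\<And>n. s n \<in> H" "\<And>e. e > 0 \<Longrightarrow> \<exists>N. \<forall>m\<ge>N. \<forall>n\<ge>N. l2norm M (\<lambda>p. s m p - s n p) < e"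
  obtains f where "f \<in> H" "(\<lambda>n. l2norm M (\<lambda>p. s n p - f p)) \<longlonglongrightarrow> 0"
proof -
  have "\<forall>s. (\<forall>n. s n \<in> H) \<and> (\<forall>e>0. \<exists>N. \<forall>m\<ge>N. \<forall>n\<ge>N. l2norm M (\<lambda>p. s m p - s n p) < e) \<longrightarrow>
          (\<exists>f\<in>H. (\<lambda>n. l2norm M (\<lambda>p. s n p - f p)) \<longlonglongrightarrow> 0)"
    using rkhs unfolding rkhs_L2_def by (elim conjE)
  from spec[OF this, of s] have "\<exists>f\<in>H. (\<lambda>n. l2norm M (\<lambda>p. s n p - f p)) \<longlonglongrightarrow> 0"
    using assms by auto
  then show ?thesis using that by auto
qed

section \<open>Translations and integrability of the kernel sections\<close>

lemma rho_apply: "rho a f (x, y) = f (x - a, y)"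
  by (simp add: rho_def)

lemma translation_pair_measurable [measurable]: "(\<lambda>(u, v). (u - a, v)) \<in> measurable M M"
  by measurable

lemma distr_translation_pair: "distr M M (\<lambda>(u, v). (u - a, v)) = M"
proof -
  have "sigma_finite_measure (distr \<mu> \<mu> (\<lambda>v. v))" by (simp add: mu.sigma_finite_measure_axioms)
  from pair_measure_distr[OF translation_measurable[of a] measurable_ident_sets[OF refl, of \<mu>] this]
  show ?thesis by (simp add: distr_translation)
qed

lemma integral_rho:
  fixes f :: "'g \<times> 'y \<Rightarrow> complex"
  assumes "f \<in> borel_measurable M"
  shows "integral\<^sup>L M (rho a f) = integral\<^sup>L M f"
  using integral_distr[OF translation_pair_measurable assms, of a] unfolding distr_translation_pair
  by (simp add: rho_def split_beta')

lemma l2norm_rho: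
  assumes "f \<in> L2 M"
  shows "l2norm M (rho a f) = l2norm M f"
proof -
  have "f \<in> borel_measurable M" using assms by (rule L2_measurable)
  then have "(\<lambda>p. (cmod (f p))\<^sup>2) \<in> borel_measurable M" by measurable
  from integral_distr[OF translation_pair_measurable this, of a, unfolded distr_translation_pair] show ?thesis
    by (simp add: rho_def split_beta' l2norm_def)
qed

lemma K_rho: "K x y = rho x (K 0 y)"
proof (rule HOL.ext)
  fix p
  show "K x y p = rho x (K 0 y) p"
    by (cases p) (simp only: rho_def prod.case Ktrans[where x=x])
qed

lemma section_measurable: "f \<in> L2 M \<Longrightarrow> (\<lambda>u. f (u, v)) \<in> borel_measurable \<nu>"
  by (rule measurable_compose[OF measurable_Pair2']) (auto simp: L2_def)

lemma K_section_integrable: "integrable \<nu> (\<lambda>u. K 0 y (u, v))"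
proof -
  obtain C where "(\<integral>\<^sup>+u. ennreal (cmod (K 0 y (u, v))) \<partial>\<nu>) \<le> ennreal C" using Kint by blast
  then have "(\<integral>\<^sup>+u. ennreal (cmod (K 0 y (u, v))) \<partial>\<nu>) < \<infinity>"
    by (rule le_less_trans) simp
  then show ?thesis
    using section_measurable[OF H_L2[OF K_H]] by (simp add: integrable_iff_bounded)
qed

lemma K_L1_sections: "L1_sections (K x y)"
  unfolding L1_sections_def Ktrans[where x=x] by (intro AE_I2 integrable_translation K_section_integrable)

lemma LK_fourier: "LK \<nu> K \<xi> y v = fourier \<nu> (\<lambda>u. K 0 y (u, v)) \<xi>"
  by (simp add: LK_def fourier_def)

lemma FT_K:
  assumes "\<xi> \<in> characters"
  shows "FT (K x y) (\<xi>, v) = cnj (\<xi> x) * LK \<nu> K \<xi> y v"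
proof -
  have "FT (K x y) (\<xi>, v) = fourier \<nu> (\<lambda>u. K 0 y (u - x, v)) \<xi>"
    by (simp add: FT_def Ktrans[where x=x])
  also have "\<dots> = cnj (\<xi> x) * fourier \<nu> (\<lambda>u. K 0 y (u, v)) \<xi>"
    by (intro fourier_translation[where f="\<lambda>u. K 0 y (u, v)"] section_measurable H_L2 K_H assms)
  finally show ?thesis by (simp add: LK_fourier)
qed

lemma FT_K0: "\<xi> \<in> characters \<Longrightarrow> FT (K 0 y) (\<xi>, v) = LK \<nu> K \<xi> y v"
  by (simp add: FT_K character_zero)

text \<open>The value is <K_{0,y}, K_{x,v}>, and translates have equal norm, so Cauchy-Schwarz gives
  a bound that does not depend on x.\<close>

lemma K_section_bounded: "cmod (K 0 y (x, v)) \<le> l2norm M (K 0 y) * l2norm M (K 0 v)"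
proof -
  have "cmod (K 0 y (x, v)) \<le> l2norm M (K 0 y) * l2norm M (K x v)"
    unfolding reproducing[OF K_H, of 0 y] by (intro ip_Cauchy_Schwarz H_L2 K_H)
  then show ?thesis by (simp add: K_rho[of x v] l2norm_rho H_L2 K_H)
qed

text \<open>Fubini would give this for almost every v. A bounded integrable function is square
  integrable, which gives it for every v and so allows Plancherel at each fixed pair of
  points.\<close>

lemma K_section_L2: "(\<lambda>u. K 0 y (u, v)) \<in> L2 \<nu>"
proof -
  let ?B = "l2norm M (K 0 y) * l2norm M (K 0 v)"
  have m [measurable]: "(\<lambda>u. K 0 y (u, v)) \<in> borel_measurable \<nu>" by (intro section_measurable H_L2 K_H)
  have "integrable \<nu> (\<lambda>u. (cmod (K 0 y (u, v)))\<^sup>2)"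
  proof (rule Bochner_Integration.integrable_bound)
    show "integrable \<nu> (\<lambda>u. ?B * cmod (K 0 y (u, v)))"
      by (intro integrable_mult_right integrable_norm K_section_integrable)
    show "AE u in \<nu>. norm ((cmod (K 0 y (u, v)))\<^sup>2) \<le> norm (?B * cmod (K 0 y (u, v)))"
      using K_section_bounded[of y _ v]
      by (intro AE_I2) (simp add: power2_eq_square mult_right_mono del: mult_le_cancel_right)
  qed measurable
  then show ?thesis using m by (simp add: L2_def)
qed

text \<open>The kernel L_\<xi> composed with itself. That this composition reproduces L_\<xi> for
  almost every \<xi> is the content of \<open>Lg_eq_LK\<close>.\<close>

definition Lg :: "'y \<Rightarrow> 'y \<Rightarrow> ('g \<Rightarrow> complex) \<Rightarrow> complex" where
  "Lg y v \<xi> = (\<integral>w. LK \<nu> K \<xi> y w * cnj (LK \<nu> K \<xi> v w) \<partial>\<mu>)"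

lemma FT_K_L2: "FT (K x y) \<in> L2 Mh"
  by (intro FT_isometry H_L2 K_H K_L1_sections)

lemma FT_K_product_integrable: "integrable Mh (\<lambda>p. FT (K x y) p * cnj (FT (K x' v) p))"
  by (intro L2_ip_integrable FT_K_L2)

lemma Lg_integrable: "integrable \<nu>h (Lg y v)"
proof -
  have "integrable \<nu>h (\<lambda>\<xi>. \<integral>w. FT (K 0 y) (\<xi>, w) * cnj (FT (K 0 v) (\<xi>, w)) \<partial>\<mu>)"
    using pH.integrable_fst'[OF FT_K_product_integrable[of 0 y 0 v]] by simp
  then show ?thesis
    by (rule Bochner_Integration.integrable_cong[OF refl, THEN iffD1, rotated])
      (simp add: FT_K0 Lg_def space_dual)
qed

text \<open>Parseval is applied to <K_{0,y}, K_{x,v}>; translating the second kernel by x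
  contributes the factor \<xi>(x). This presents the section of the kernel as an inverse Fourier
  integral of an integrable function.\<close>

lemma K_Lg: "K 0 y (x, v) = (\<integral>\<xi>. Lg y v \<xi> * \<xi> x \<partial>\<nu>h)"
proof -
  have "K 0 y (x, v) = ip Mh (FT (K 0 y)) (FT (K x v))"
    unfolding reproducing[OF K_H, of 0 y] by (intro FT_ip[symmetric] H_L2 K_H K_L1_sections)
  also have "\<dots> = (\<integral>\<xi>. \<integral>w. FT (K 0 y) (\<xi>, w) * cnj (FT (K x v) (\<xi>, w)) \<partial>\<mu> \<partial>\<nu>h)"
    unfolding ip_def by (rule pH.integral_fst'[OF FT_K_product_integrable, symmetric])
  also have "\<dots> = (\<integral>\<xi>. Lg y v \<xi> * \<xi> x \<partial>\<nu>h)"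
  proof (rule Bochner_Integration.integral_cong[OF refl])
    fix \<xi> assume "\<xi> \<in> space \<nu>h"
    then have \<xi>: "\<xi> \<in> characters" by (simp add: space_dual)
    have "(\<integral>w. FT (K 0 y) (\<xi>, w) * cnj (FT (K x v) (\<xi>, w)) \<partial>\<mu>) =
       (\<integral>w. LK \<nu> K \<xi> y w * cnj (LK \<nu> K \<xi> v w) * \<xi> x \<partial>\<mu>)"
      by (simp add: FT_K[OF \<xi>] character_zero[OF \<xi>] mult_ac)
    then show "(\<integral>w. FT (K 0 y) (\<xi>, w) * cnj (FT (K x v) (\<xi>, w)) \<partial>\<mu>) = Lg y v \<xi> * \<xi> x"
      by (simp add: Lg_def)
  qed
  finally show ?thesis .
qed

text \<open>Let E be a piece of finite measure of {d \<noteq> 0}. Every admissible transform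
  vanishes almost everywhere on E, hence |1_E| \<le> |1_E - F h|. Since the transforms F h are
  dense, the norm of 1_E is smaller than any positive number.\<close>

lemma AE_zero_if_zero_against_fourier:
  assumes d: "d \<in> borel_measurable \<nu>h"
    and zero: "\<And>h. h \<in> L2 \<nu> \<Longrightarrow> integrable \<nu> h \<Longrightarrow> AE \<xi> in \<nu>h. d \<xi> * cnj (fourier \<nu> h \<xi>) = 0"
  shows "AE \<xi> in \<nu>h. d \<xi> = 0"
proof -
  obtain A :: "nat \<Rightarrow> _ set" where A: "range A \<subseteq> sets \<nu>h" "(\<Union>i. A i) = space \<nu>h"
      "\<And>i. emeasure \<nu>h (A i) \<noteq> \<infinity>"
    using nuh.sigma_finite by metis
  have "AE \<xi> in \<nu>h. \<xi> \<in> A n \<longrightarrow> d \<xi> = 0" for n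
  proof -
    define E where "E = {\<xi> \<in> space \<nu>h. d \<xi> \<noteq> 0} \<inter> A n"
    have Es: "E \<in> sets \<nu>h" unfolding E_def using A d by (intro sets.Int) auto
    have "emeasure \<nu>h E \<le> emeasure \<nu>h (A n)" using A by (intro emeasure_mono) (auto simp: E_def)
    then have Ef: "emeasure \<nu>h E < \<infinity>" using A(3)[of n] by (auto simp: less_top intro: le_less_trans)
    have EL: "(indicator E :: _ \<Rightarrow> complex) \<in> L2 \<nu>h" by (rule indicator_L2[OF Es Ef])
    have "l2norm \<nu>h (indicator E) \<le> 0"
    proof (rule field_le_epsilon)
      fix e :: real assume "e > 0"
      obtain h where h: "h \<in> L2 \<nu>" "integrable \<nu> h" "l2norm \<nu>h (\<lambda>\<xi>. indicator E \<xi> - fourier \<nu> h \<xi>) < e"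
        using fourier_dense[OF EL \<open>e > 0\<close>] by blast
      have "l2norm \<nu>h (indicator E) \<le> 1 * l2norm \<nu>h (\<lambda>\<xi>. indicator E \<xi> - fourier \<nu> h \<xi>)"
      proof (rule l2norm_mono[OF L2_diff[OF EL plancherel(1)[OF h(1,2)]] L2_measurable[OF EL]])
        show "AE \<xi> in \<nu>h. cmod (indicator E \<xi>) \<le> 1 * cmod (indicator E \<xi> - fourier \<nu> h \<xi>)"
          using zero[OF h(1,2)] by eventually_elim (auto simp: E_def indicator_def)
      qed simp
      then show "l2norm \<nu>h (indicator E) \<le> 0 + e" using h(3) by simp
    qed
    then have "l2norm \<nu>h (indicator E) = 0" using l2norm_nonneg[of \<nu>h "indicator E"] by linarith
    then have "AE \<xi> in \<nu>h. (indicator E \<xi> :: complex) = 0" using l2norm_eq_0_iff[OF EL] by simp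
    then show ?thesis
      by (rule AE_mp) (auto intro!: AE_I2 simp: E_def indicator_def split: if_splits)
  qed
  then have "AE \<xi> in \<nu>h. \<forall>n. \<xi> \<in> A n \<longrightarrow> d \<xi> = 0" unfolding AE_all_countable by (rule allI)
  then show ?thesis
  proof (rule AE_mp, intro AE_I2 impI)
    fix \<xi> assume "\<xi> \<in> space \<nu>h" "\<forall>n. \<xi> \<in> A n \<longrightarrow> d \<xi> = 0"
    then show "d \<xi> = 0" unfolding A(2)[symmetric] by blast
  qed
qed

text \<open>Fubini applied to \<open>K_Lg\<close>: the double integral converges absolutely because
  \<open>Lg y v\<close> is integrable on the dual and h on the group.\<close>

lemma ip_Lg_fourier:
  assumes h: "h \<in> L2 \<nu>" "integrable \<nu> h"
  shows "(\<integral>\<xi>. Lg y v \<xi> * cnj (fourier \<nu> h \<xi>) \<partial>\<nu>h) = ip \<nu> (\<lambda>u. K 0 y (u, v)) h"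
proof -
  define F where "F p = Lg y v (fst p) * (cnj (h (snd p)) * fst p (snd p))" for p
  have [measurable]: "Lg y v \<in> borel_measurable \<nu>h" "h \<in> borel_measurable \<nu>"
    using Lg_integrable h by (auto simp: L2_def)
  have [measurable]: "F \<in> borel_measurable (\<nu>h \<Otimes>\<^sub>M \<nu>)"
    unfolding F_def by (intro borel_measurable_times borel_measurable_cnj joint_ev_measurable) measurable
  have FI: "integrable (\<nu>h \<Otimes>\<^sub>M \<nu>) F"
  proof (rule pD.Fubini_integrable)
    have "integrable \<nu>h (\<lambda>\<xi>. cmod (Lg y v \<xi>) * (\<integral>u. cmod (h u) \<partial>\<nu>))"
      by (intro integrable_mult_left integrable_norm Lg_integrable)
    then show "integrable \<nu>h (\<lambda>\<xi>. \<integral>u. norm (F (\<xi>, u)) \<partial>\<nu>)"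
      by (rule Bochner_Integration.integrable_cong[OF refl, THEN iffD1, rotated])
        (simp add: F_def norm_mult character_norm space_dual)
    show "AE \<xi> in \<nu>h. integrable \<nu> (\<lambda>u. F (\<xi>, u))"
    proof (intro AE_I2)
      fix \<xi> assume "\<xi> \<in> space \<nu>h"
      then have "\<xi> \<in> characters" by (simp add: space_dual)
      from integrable_cnj[OF integrable_character_mult[OF h(2) this]]
      show "integrable \<nu> (\<lambda>u. F (\<xi>, u))" by (simp add: F_def)
    qed
  qed measurable
  have "(\<integral>\<xi>. Lg y v \<xi> * cnj (fourier \<nu> h \<xi>) \<partial>\<nu>h) = (\<integral>\<xi>. \<integral>u. F (\<xi>, u) \<partial>\<nu> \<partial>\<nu>h)"
    by (simp add: F_def fourier_def flip: Bochner_Integration.integral_cnj)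
  also have "\<dots> = (\<integral>u. \<integral>\<xi>. F (\<xi>, u) \<partial>\<nu>h \<partial>\<nu>)"
    using pD.Fubini_integral[of "\<lambda>\<xi> u. F (\<xi>, u)"] FI by (simp add: split_beta')
  also have "\<dots> = (\<integral>u. K 0 y (u, v) * cnj (h u) \<partial>\<nu>)"
    unfolding K_Lg by (simp add: F_def mult_ac flip: integral_mult_left_zero integral_mult_right_zero)
  finally show ?thesis by (simp add: ip_def)
qed

text \<open>The difference of the two sides need be neither integrable nor square integrable, but
  its product with cnj(F h) is integrable. Translating h by a multiplies that factor by \<xi>(a), so
  \<open>ip_Lg_fourier\<close> and Parseval make all the integrals required by
  \<open>L1_uniqueness\<close> vanish. The factor is then removed by
  \<open>AE_zero_if_zero_against_fourier\<close>.\<close>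

lemma Lg_eq_LK: "AE \<xi> in \<nu>h. Lg y v \<xi> = LK \<nu> K \<xi> y v"
proof -
  define k where "k = fourier \<nu> (\<lambda>u. K 0 y (u, v))"
  have kL: "k \<in> L2 \<nu>h" unfolding k_def by (rule plancherel[OF K_section_L2 K_section_integrable])
  have [measurable]: "Lg y v \<in> borel_measurable \<nu>h" "k \<in> borel_measurable \<nu>h"
    using Lg_integrable kL by (auto simp: L2_def)
  have split: "integrable \<nu>h (\<lambda>\<xi>. Lg y v \<xi> * cnj (fourier \<nu> h \<xi>))" "integrable \<nu>h (\<lambda>\<xi>. k \<xi> * cnj (fourier \<nu> h \<xi>))"
    "(\<integral>\<xi>. Lg y v \<xi> * cnj (fourier \<nu> h \<xi>) \<partial>\<nu>h) = (\<integral>\<xi>. k \<xi> * cnj (fourier \<nu> h \<xi>) \<partial>\<nu>h)"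
    if h: "h \<in> L2 \<nu>" "integrable \<nu> h" for h
  proof -
    have fL: "fourier \<nu> h \<in> L2 \<nu>h" by (rule plancherel[OF h])
    have [measurable]: "fourier \<nu> h \<in> borel_measurable \<nu>h" using fL by (rule L2_measurable)
    let ?C = "\<integral>u. cmod (h u) \<partial>\<nu>"
    show "integrable \<nu>h (\<lambda>\<xi>. Lg y v \<xi> * cnj (fourier \<nu> h \<xi>))"
    proof (rule Bochner_Integration.integrable_bound)
      show "integrable \<nu>h (\<lambda>\<xi>. ?C * cmod (Lg y v \<xi>))" by (intro integrable_mult_right integrable_norm Lg_integrable)
      show "AE \<xi> in \<nu>h. norm (Lg y v \<xi> * cnj (fourier \<nu> h \<xi>)) \<le> norm (?C * cmod (Lg y v \<xi>))"
        using fourier_bound[OF h(2)]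
        by (intro AE_I2) (simp add: space_dual norm_mult mult.commute[of ?C] mult_left_mono)
    qed measurable
    show "integrable \<nu>h (\<lambda>\<xi>. k \<xi> * cnj (fourier \<nu> h \<xi>))" by (intro L2_ip_integrable kL fL)
    show "(\<integral>\<xi>. Lg y v \<xi> * cnj (fourier \<nu> h \<xi>) \<partial>\<nu>h) = (\<integral>\<xi>. k \<xi> * cnj (fourier \<nu> h \<xi>) \<partial>\<nu>h)"
      using parseval[OF K_section_L2 K_section_integrable h] by (simp add: ip_Lg_fourier[OF h] k_def ip_def)
  qed
  have "AE \<xi> in \<nu>h. Lg y v \<xi> - k \<xi> = 0"
  proof (rule AE_zero_if_zero_against_fourier)
    fix h assume h: "h \<in> L2 \<nu>" "integrable \<nu> h"
    show "AE \<xi> in \<nu>h. (Lg y v \<xi> - k \<xi>) * cnj (fourier \<nu> h \<xi>) = 0"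
    proof (rule L1_uniqueness)
      show "integrable \<nu>h (\<lambda>\<xi>. (Lg y v \<xi> - k \<xi>) * cnj (fourier \<nu> h \<xi>))"
        using split(1,2)[OF h] by (simp add: left_diff_distrib)
      fix a
      have ha: "(\<lambda>u. h (u - a)) \<in> L2 \<nu>" "integrable \<nu> (\<lambda>u. h (u - a))"
        using L2_translation[OF h(1)] integrable_translation[OF h(2)] .
      have "(\<integral>\<xi>. (Lg y v \<xi> - k \<xi>) * cnj (fourier \<nu> h \<xi>) * \<xi> a \<partial>\<nu>h) =
          (\<integral>\<xi>. Lg y v \<xi> * cnj (fourier \<nu> (\<lambda>u. h (u - a)) \<xi>) - k \<xi> * cnj (fourier \<nu> (\<lambda>u. h (u - a)) \<xi>) \<partial>\<nu>h)"
        using h(1) by (intro Bochner_Integration.integral_cong)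
          (auto simp: space_dual fourier_translation L2_def algebra_simps)
      also have "\<dots> = 0" using split[OF ha] by simp
      finally show "(\<integral>\<xi>. (Lg y v \<xi> - k \<xi>) * cnj (fourier \<nu> h \<xi>) * \<xi> a \<partial>\<nu>h) = 0" .
    qed
  qed measurable
  then show ?thesis by (simp add: k_def LK_fourier)
qed

section \<open>The set \<Omega> and the unit vectors q\<close>

lemma Omega_characters: "\<xi> \<in> \<Omega> \<Longrightarrow> \<xi> \<in> characters"
  by (simp add: Omega_def)

text \<open>For almost every \<xi>, L_{\<xi>,y}(y) is the squared L2 norm of L_{\<xi>,y}, hence real
  and nonnegative. Off \<Omega> it is not positive, so the norm is 0.\<close>

lemma LK_zero_off_Omega: "AE \<xi> in \<nu>h. \<xi> \<notin> \<Omega> \<longrightarrow> (AE w in \<mu>. LK \<nu> K \<xi> y w = 0)"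
  using Lg_eq_LK[of y y] pH.L2_section_fst[OF FT_K_L2[of 0 y]] AE_space
proof eventually_elim
  case (elim \<xi>)
  then have \<xi>: "\<xi> \<in> characters" by (simp add: space_dual)
  have L: "LK \<nu> K \<xi> y \<in> L2 \<mu>" using elim(2) \<xi> by (simp add: FT_K0)
  show ?case
  proof
    assume "\<xi> \<notin> \<Omega>"
    have *: "Lg y y \<xi> = complex_of_real ((l2norm \<mu> (LK \<nu> K \<xi> y))\<^sup>2)"
      unfolding Lg_def l2norm_square_ip by (simp add: ip_def)
    have "\<not> (Lg y y \<xi> \<in> \<real> \<and> Re (Lg y y \<xi>) > 0)"
      using \<open>\<xi> \<notin> \<Omega>\<close> \<xi> unfolding elim(1) Omega_def by blast
    then have "l2norm \<mu> (LK \<nu> K \<xi> y) = 0" unfolding * by simp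
    then show "AE w in \<mu>. LK \<nu> K \<xi> y w = 0" using l2norm_eq_0_iff[OF L] by simp
  qed
qed

lemma LK_diag: "\<xi> \<in> \<Omega> \<Longrightarrow> LK \<nu> K \<xi> y y = complex_of_real ((cmod (q \<xi> y))\<^sup>2)"
  using qfac[of \<xi> y y] complex_norm_square[of "q \<xi> y"] by (simp add: mult.commute)

text \<open>The diagonal sections u \<mapsto> K_{0,y}(u, y) lie in L1, where products d1 * d2 from a
  countable set are dense. One point is chosen for each product and each tolerance. If q_\<xi>
  vanished at the chosen point y near y0, then |L_{\<xi>,y0}(y0)| would be at most the L1 distance
  of the two sections, which is below 2/(j+1).\<close>

lemma countable_nonvanishing:
  obtains ys :: "nat \<Rightarrow> 'y" where "\<And>\<xi>. \<xi> \<in> \<Omega> \<Longrightarrow> \<exists>n. q \<xi> (ys n) \<noteq> 0"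
proof -
  obtain D where D: "countable D" "D \<subseteq> L2 \<nu>" "\<And>f e. f \<in> L2 \<nu> \<Longrightarrow> e > 0 \<Longrightarrow> \<exists>d\<in>D. l2norm \<nu> (\<lambda>x. f x - d x) < e"
    using sep unfolding separable_L2_def by auto
  define k where "k y u = K 0 y (u, y)" for y u
  define close where "close y d1 d2 j \<longleftrightarrow> (\<integral>u. cmod (k y u - d1 u * d2 u) \<partial>\<nu>) < 1 / real (Suc j)" for y d1 d2 j
  \<comment> \<open>If no point is close to d1 * d2, the choice is arbitrary; the argument consults
    only triples for which some y0 is known to be close.\<close>
  define pick where "pick t = (case t of (d1, d2, j) \<Rightarrow> SOME y. close y d1 d2 j)" for t
  define S where "S = pick ` (D \<times> D \<times> (UNIV :: nat set))"
  have "countable S" unfolding S_def using D(1) by auto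
  have main: "\<exists>y\<in>S. q \<xi> y \<noteq> 0" if om: "\<xi> \<in> \<Omega>" for \<xi>
  proof -
    have \<xi>: "\<xi> \<in> characters" using that by (rule Omega_characters)
    obtain y0 where "LK \<nu> K \<xi> y0 y0 \<in> \<real>" "Re (LK \<nu> K \<xi> y0 y0) > 0"
      using om unfolding Omega_def by blast
    then have "cmod (LK \<nu> K \<xi> y0 y0) > 0" by auto
    then have "cmod (LK \<nu> K \<xi> y0 y0) / 2 > 0" by simp
    then obtain j where j: "1 / real (Suc j) < cmod (LK \<nu> K \<xi> y0 y0) / 2" by (rule nat_approx_posE)
    have ki: "integrable \<nu> (k y)" for y unfolding k_def by (rule K_section_integrable)
    have "1 / real (Suc j) > 0" by simp
    then obtain d1 d2 where d: "d1 \<in> D" "d2 \<in> D" "(\<integral>u. cmod (k y0 u - d1 u * d2 u) \<partial>\<nu>) < 1 / real (Suc j)"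
      using L1_approx_by_L2_products[OF D(2,3) ki] by metis
    define y where "y = pick (d1, d2, j)"
    have "close y0 d1 d2 j" using d(3) by (simp add: close_def)
    then have "close y d1 d2 j" unfolding y_def pick_def by (simp add: someI[of "\<lambda>y. close y d1 d2 j"])
    then have c: "(\<integral>u. cmod (k y u - d1 u * d2 u) \<partial>\<nu>) < 1 / real (Suc j)" by (simp add: close_def)
    have dd: "integrable \<nu> (\<lambda>u. d1 u * d2 u)" using D(2) d by (intro L2_mult_integrable) auto
    have i1: "integrable \<nu> (\<lambda>u. cmod (k y' u - d1 u * d2 u))" for y'
      using ki dd by (intro integrable_norm Bochner_Integration.integrable_diff)
    have "q \<xi> y \<noteq> 0"
    proof
      assume "q \<xi> y = 0"
      then have "LK \<nu> K \<xi> y y = 0" using LK_diag[OF that] by simp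
      then have "LK \<nu> K \<xi> y0 y0 = LK \<nu> K \<xi> y0 y0 - LK \<nu> K \<xi> y y" by simp
      also have "\<dots> = fourier \<nu> (\<lambda>u. k y0 u + (-1) * k y u) \<xi>"
        unfolding fourier_add_scale[OF ki ki \<xi>] by (simp add: LK_fourier k_def[abs_def])
      finally have "cmod (LK \<nu> K \<xi> y0 y0) \<le> (\<integral>u. cmod (k y0 u - k y u) \<partial>\<nu>)"
        using fourier_bound[OF _ \<xi>, of "\<lambda>u. k y0 u + (-1) * k y u"] ki by simp
      also have "\<dots> \<le> (\<integral>u. cmod (k y0 u - d1 u * d2 u) + cmod (k y u - d1 u * d2 u) \<partial>\<nu>)"
      proof (rule integral_mono)
        show "integrable \<nu> (\<lambda>u. cmod (k y0 u - k y u))"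
          using ki by (intro integrable_norm Bochner_Integration.integrable_diff)
        show "cmod (k y0 u - k y u) \<le> cmod (k y0 u - d1 u * d2 u) + cmod (k y u - d1 u * d2 u)" for u
          using norm_triangle_ineq4[of "k y0 u - d1 u * d2 u" "k y u - d1 u * d2 u"] by simp
      qed (use i1 in simp)
      also have "\<dots> < cmod (LK \<nu> K \<xi> y0 y0)" using c d(3) j i1 by simp
      finally show False by simp
    qed
    moreover have "y \<in> S" unfolding S_def y_def using d by blast
    ultimately show ?thesis by blast
  qed
  show ?thesis
  proof (rule that[of "from_nat_into S"])
    fix \<xi> assume "\<xi> \<in> \<Omega>"
    then obtain y where "y \<in> S" "q \<xi> y \<noteq> 0" using main by blast
    then show "\<exists>n. q \<xi> (from_nat_into S n) \<noteq> 0"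
      using from_nat_into_surj[OF \<open>countable S\<close>] by metis
  qed
qed

lemma space_N: "space N = \<Omega>"
  using Omega_sets[THEN sets.sets_into_space] by (auto simp: space_restrict_space)

lemma q_section_measurable: "\<xi> \<in> \<Omega> \<Longrightarrow> q \<xi> \<in> borel_measurable \<mu>"
  using measurable_compose[OF measurable_Pair1' qmeas, of \<xi>] by (simp add: space_N)

lemma q_measurable: "(\<lambda>\<xi>. q \<xi> y) \<in> borel_measurable N"
  using measurable_compose[OF measurable_Pair2' qmeas, of y] by simp

lemma AE_N_iff: "(AE \<xi> in N. P \<xi>) \<longleftrightarrow> (AE \<xi> in \<nu>h. \<xi> \<in> \<Omega> \<longrightarrow> P \<xi>)"
  using Omega_sets sets.sets_into_space[OF Omega_sets] by (intro AE_restrict_space_iff) (simp add: Int_absorb2)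

text \<open>Inserting L_{\<xi>,y}(w) = cnj(q_\<xi>(y)) q_\<xi>(w) into the idempotence at (y,y)
  yields |q_\<xi>(y)|^2 * \<integral> |q_\<xi>|^2 = |q_\<xi>(y)|^2, and some y among the countably
  many allows cancellation.\<close>

lemma q_normalized: "AE \<xi> in N. q \<xi> \<in> L2 \<mu> \<and> l2norm \<mu> (q \<xi>) = 1"
proof -
  obtain ys :: "nat \<Rightarrow> 'y" where ys: "\<And>\<xi>. \<xi> \<in> \<Omega> \<Longrightarrow> \<exists>n. q \<xi> (ys n) \<noteq> 0" using countable_nonvanishing by blast
  have "AE \<xi> in \<nu>h. \<forall>n. Lg (ys n) (ys n) \<xi> = LK \<nu> K \<xi> (ys n) (ys n)"
    unfolding AE_all_countable using Lg_eq_LK by blast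
  then show ?thesis unfolding AE_N_iff
  proof (rule AE_mp, intro AE_I2 impI)
    fix \<xi> assume eq: "\<forall>n. Lg (ys n) (ys n) \<xi> = LK \<nu> K \<xi> (ys n) (ys n)" and \<xi>: "\<xi> \<in> \<Omega>"
    obtain n where n: "q \<xi> (ys n) \<noteq> 0" using ys[OF \<xi>] by blast
    let ?c = "complex_of_real ((cmod (q \<xi> (ys n)))\<^sup>2)"
    have "Lg (ys n) (ys n) \<xi> = (\<integral>w. ?c * complex_of_real ((cmod (q \<xi> w))\<^sup>2) \<partial>\<mu>)"
      unfolding Lg_def using \<xi>
      by (intro Bochner_Integration.integral_cong) (auto simp: qfac complex_norm_square simp del: of_real_power)
    also have "\<dots> = ?c * complex_of_real (\<integral>w. (cmod (q \<xi> w))\<^sup>2 \<partial>\<mu>)"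
      by (simp only: integral_mult_right_zero integral_complex_of_real)
    finally have "?c * complex_of_real (\<integral>w. (cmod (q \<xi> w))\<^sup>2 \<partial>\<mu>) = ?c"
      using eq LK_diag[OF \<xi>] by simp
    then have one: "(\<integral>w. (cmod (q \<xi> w))\<^sup>2 \<partial>\<mu>) = 1" using n by simp
    \<comment> \<open>A function that is not integrable has integral 0 by convention, so the value 1
      already proves integrability.\<close>
    then have "integrable \<mu> (\<lambda>w. (cmod (q \<xi> w))\<^sup>2)"
      using not_integrable_integral_eq by fastforce
    then show "q \<xi> \<in> L2 \<mu> \<and> l2norm \<mu> (q \<xi>) = 1"
      using one q_section_measurable[OF \<xi>] by (simp add: L2_def l2norm_def)
  qed
qed

lemma integral_N: "(\<integral>\<xi>. f \<xi> \<partial>N) = (\<integral>\<xi>. indicator \<Omega> \<xi> * f \<xi> \<partial>\<nu>h)" for f :: "_ \<Rightarrow> complex"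
  using Omega_sets sets.sets_into_space[OF Omega_sets]
  by (subst integral_restrict_space) (auto simp: Int_absorb2 scaleR_conv_of_real of_real_indicator)

lemma integrable_N: "integrable N f \<longleftrightarrow> integrable \<nu>h (\<lambda>\<xi>. indicator \<Omega> \<xi> * f \<xi>)" for f :: "_ \<Rightarrow> complex"
  using Omega_sets sets.sets_into_space[OF Omega_sets]
  by (subst integrable_restrict_space) (auto simp: Int_absorb2 scaleR_conv_of_real of_real_indicator)

text \<open>The factorization through q is given on \<Omega> only; off \<Omega> the composition
  vanishes because L_{\<xi>,y} does.\<close>

lemma Lg_indicator: "AE \<xi> in \<nu>h. Lg y v \<xi> = indicator \<Omega> \<xi> * (cnj (q \<xi> y) * q \<xi> v)"
  using Lg_eq_LK[of y v] LK_zero_off_Omega[of y]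
proof eventually_elim
  case (elim \<xi>)
  show ?case
  proof (cases "\<xi> \<in> \<Omega>")
    case True
    then show ?thesis using elim(1) qfac by simp
  next
    case False
    then have "AE w in \<mu>. LK \<nu> K \<xi> y w * cnj (LK \<nu> K \<xi> v w) = 0" using elim(2) by auto
    then have "Lg y v \<xi> = 0" unfolding Lg_def by (rule integral_eq_zero_AE)
    then show ?thesis using False by simp
  qed
qed

lemma evN_measurable [measurable]: "(\<lambda>\<xi>. \<xi> a) \<in> borel_measurable N"
  by (intro measurable_restrict_space1 ev_measurable)

lemma restrict_measurable:
  fixes f :: "_ \<Rightarrow> complex"
  assumes "f \<in> borel_measurable N"
  shows "(\<lambda>\<xi>. indicator \<Omega> \<xi> * f \<xi>) \<in> borel_measurable \<nu>h"
  using assms Omega_sets sets.sets_into_space[OF Omega_sets]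
  by (subst (asm) borel_measurable_restrict_space_iff) (auto simp: Int_absorb2 scaleR_conv_of_real of_real_indicator)

lemma K_integral_q:
  shows "integrable N (\<lambda>\<xi>. cnj (q \<xi> y) * q \<xi> v)"
    and "K 0 y (x, v) = (\<integral>\<xi>. cnj (q \<xi> y) * q \<xi> v * \<xi> x \<partial>N)"
proof -
  have qm [measurable]: "(\<lambda>\<xi>. q \<xi> y) \<in> borel_measurable N" for y by (rule q_measurable)
  have m [measurable]: "(\<lambda>\<xi>. indicator \<Omega> \<xi> * (cnj (q \<xi> y) * q \<xi> v)) \<in> borel_measurable \<nu>h"
    by (rule restrict_measurable) measurable
  have [measurable]: "Lg y v \<in> borel_measurable \<nu>h" using Lg_integrable by (rule borel_measurable_integrable)
  show "integrable N (\<lambda>\<xi>. cnj (q \<xi> y) * q \<xi> v)"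
    unfolding integrable_N using integrable_cong_AE_imp[OF Lg_integrable m Lg_indicator] .
  have "K 0 y (x, v) = (\<integral>\<xi>. Lg y v \<xi> * \<xi> x \<partial>\<nu>h)" by (rule K_Lg)
  also have "\<dots> = (\<integral>\<xi>. indicator \<Omega> \<xi> * (cnj (q \<xi> y) * q \<xi> v) * \<xi> x \<partial>\<nu>h)"
    using Lg_indicator[of y v] by (intro integral_cong_AE) auto
  finally show "K 0 y (x, v) = (\<integral>\<xi>. cnj (q \<xi> y) * q \<xi> v * \<xi> x \<partial>N)"
    by (simp add: integral_N mult.assoc)
qed

end

section \<open>The unitary operator \<open>R\<close> and its inverse\<close>

context rkhs_setting
begin

text \<open>This is R K_{x,y} computed formally: K_{x,y} has the transform cnj(\<xi> x) *
  cnj(q_\<xi>(y)) * q_\<xi>, and pairing with the unit vector q_\<xi> leaves the other two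
  factors.\<close>

definition e :: "'g \<Rightarrow> 'y \<Rightarrow> ('g \<Rightarrow> complex) \<Rightarrow> complex" where
  "e x y \<xi> = \<xi> (- x) * cnj (q \<xi> y)"

definition J :: "(('g \<Rightarrow> complex) \<Rightarrow> complex) \<Rightarrow> 'g \<times> 'y \<Rightarrow> complex" where
  "J g = (\<lambda>(x, y). \<integral>\<xi>. g \<xi> * (\<xi> x * q \<xi> y) \<partial>N)"

abbreviation R :: "('g \<times> 'y \<Rightarrow> complex) \<Rightarrow> ('g \<Rightarrow> complex) \<Rightarrow> complex" where
  "R \<equiv> Rop \<nu> \<nu>h \<mu> q"

declare q_measurable [measurable]

lemma space_N_character: "\<xi> \<in> space N \<Longrightarrow> \<xi> \<in> characters"
  by (simp add: space_N Omega_characters)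

lemma e_L2: "e x y \<in> L2 N"
proof -
  have "e x y \<in> borel_measurable N" unfolding e_def[abs_def] by measurable
  moreover have "integrable N (\<lambda>\<xi>. complex_of_real ((cmod (q \<xi> y))\<^sup>2))"
    using K_integral_q(1)[of y y] by (simp only: complex_norm_square mult.commute)
  then have "integrable N (\<lambda>\<xi>. (cmod (q \<xi> y))\<^sup>2)"
    by (simp only: complex_of_real_integrable_eq)
  then have "integrable N (\<lambda>\<xi>. (cmod (e x y \<xi>))\<^sup>2)"
    by (rule Bochner_Integration.integrable_cong[OF refl, THEN iffD1, rotated])
      (simp add: e_def norm_mult character_norm space_N_character)
  ultimately show ?thesis by (simp add: L2_def)
qed

lemma J_ip: "J g (x, y) = ip N g (e x y)"
  unfolding J_def ip_def prod.case
  by (intro Bochner_Integration.integral_cong[OF refl])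
    (simp add: e_def character_minus space_N_character)

lemma J_e: "J (e x y) = K x y"
proof (rule HOL.ext)
  fix p :: "'g \<times> 'y"
  obtain x' y' where p: "p = (x', y')" by (cases p)
  have "J (e x y) p = (\<integral>\<xi>. cnj (q \<xi> y) * q \<xi> y' * \<xi> (x' - x) \<partial>N)"
    unfolding p J_def e_def prod.case
    by (intro Bochner_Integration.integral_cong[OF refl])
      (simp add: space_N_character character_minus character_diff)
  also have "\<dots> = K 0 y (x' - x, y')" by (rule K_integral_q(2)[symmetric])
  also have "\<dots> = K x y p" unfolding p by (rule Ktrans[symmetric])
  finally show "J (e x y) p = K x y p" .
qed

lemma J_cong: "(\<And>\<xi>. \<xi> \<in> \<Omega> \<Longrightarrow> g \<xi> = g' \<xi>) \<Longrightarrow> J g = J g'"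
  unfolding J_def by (intro HOL.ext) (auto intro!: Bochner_Integration.integral_cong simp: space_N)

lemma J_cong_AE:
  assumes "g \<in> borel_measurable N" "g' \<in> borel_measurable N" "AE \<xi> in N. g \<xi> = g' \<xi>"
  shows "J g = J g'"
proof (rule HOL.ext)
  fix p :: "'g \<times> 'y"
  obtain x y where p: "p = (x, y)" by (cases p)
  show "J g p = J g' p"
    unfolding p J_ip using assms L2_measurable[OF e_L2] by (intro ip_cong_AE) auto
qed

lemma J_add: "g \<in> L2 N \<Longrightarrow> g' \<in> L2 N \<Longrightarrow> J (\<lambda>\<xi>. g \<xi> + g' \<xi>) = (\<lambda>p. J g p + J g' p)"
  by (intro HOL.ext) (auto simp: J_ip ip_add_left e_L2)

lemma J_diff: "g \<in> L2 N \<Longrightarrow> g' \<in> L2 N \<Longrightarrow> J (\<lambda>\<xi>. g \<xi> - g' \<xi>) = (\<lambda>p. J g p - J g' p)"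
  by (intro HOL.ext) (auto simp: J_ip ip_diff_left e_L2)

lemma J_scale: "J (\<lambda>\<xi>. c * g \<xi>) = (\<lambda>p. c * J g p)"
  by (intro HOL.ext) (auto simp: J_ip ip_scale_left)

text \<open>The last rule identifies functions that agree on \<Omega>, the space of N. It
  corresponds to the rule \<open>ext\<close> of \<open>trig\<close>: relations such as \<xi>(0) = 1
  fail for arbitrary functions \<xi>.\<close>

inductive_set kernel_span :: "(('g \<Rightarrow> complex) \<Rightarrow> complex) set" where
  kernel_span_e: "e x y \<in> kernel_span"
| kernel_span_add: "g \<in> kernel_span \<Longrightarrow> g' \<in> kernel_span \<Longrightarrow> (\<lambda>\<xi>. g \<xi> + g' \<xi>) \<in> kernel_span"
| kernel_span_scale: "g \<in> kernel_span \<Longrightarrow> (\<lambda>\<xi>. c * g \<xi>) \<in> kernel_span"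
| kernel_span_ext: "g \<in> kernel_span \<Longrightarrow> (\<And>\<xi>. \<xi> \<in> \<Omega> \<Longrightarrow> g' \<xi> = g \<xi>) \<Longrightarrow> g' \<in> kernel_span"

lemma L2_N_cong:
  assumes "g \<in> L2 N" "\<And>\<xi>. \<xi> \<in> \<Omega> \<Longrightarrow> g' \<xi> = g \<xi>"
  shows "g' \<in> L2 N"
  using assms measurable_cong[of N g' g borel]
    Bochner_Integration.integrable_cong[of N N "\<lambda>\<xi>. (cmod (g' \<xi>))\<^sup>2" "\<lambda>\<xi>. (cmod (g \<xi>))\<^sup>2"]
  by (simp add: L2_def space_N)

lemma kernel_span_L2: "g \<in> kernel_span \<Longrightarrow> g \<in> L2 N"
proof (induction rule: kernel_span.induct)
  case (kernel_span_ext g g')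
  show ?case by (rule L2_N_cong[OF kernel_span_ext.IH kernel_span_ext.hyps(2)])
qed (auto intro: e_L2 L2_add L2_scale)

lemma kernel_span_subset: "kernel_span \<subseteq> L2 N"
  using kernel_span_L2 by blast

lemma kernel_span_H: "g \<in> kernel_span \<Longrightarrow> J g \<in> H"
proof (induction rule: kernel_span.induct)
  case (kernel_span_e x y)
  show ?case by (simp add: J_e K_H)
next
  case (kernel_span_add g g')
  then show ?case by (simp add: J_add kernel_span_L2 H_add)
next
  case (kernel_span_scale g c)
  then show ?case by (simp add: J_scale H_scale)
next
  case (kernel_span_ext g g')
  then show ?case using J_cong[of g' g] by simp
qed

lemma kernel_span_diff: "g \<in> kernel_span \<Longrightarrow> g' \<in> kernel_span \<Longrightarrow> (\<lambda>\<xi>. g \<xi> - g' \<xi>) \<in> kernel_span"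
  using kernel_span_add[OF _ kernel_span_scale[of g' "-1"], of g] by simp

text \<open>The reproducing property needs only J g \<in> H for the second function, which is not
  confined to the span. In \<open>J_isometry\<close> a limit in the first argument is then
  enough.\<close>

lemma kernel_span_ip:
  assumes "g' \<in> kernel_span" "g \<in> L2 N" "J g \<in> H"
  shows "ip M (J g') (J g) = ip N g' g"
  using assms(1)
proof (induction rule: kernel_span.induct)
  case (kernel_span_e x y)
  have "ip M (J (e x y)) (J g) = cnj (ip M (J g) (K x y))" by (simp add: J_e ip_cnj)
  also have "\<dots> = cnj (J g (x, y))" by (simp add: reproducing[OF assms(3)])
  also have "\<dots> = ip N (e x y) g" by (simp add: J_ip ip_cnj)
  finally show ?case .
next
  case (kernel_span_add g1 g2)
  then show ?case using assms by (simp add: J_add kernel_span_L2 ip_add_left H_L2 kernel_span_H)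
next
  case (kernel_span_scale g c)
  then show ?case by (simp add: J_scale ip_scale_left)
next
  case (kernel_span_ext g1 g2)
  have "ip N g2 g = ip N g1 g"
    unfolding ip_def using kernel_span_ext(2) by (intro Bochner_Integration.integral_cong) (auto simp: space_N)
  then show ?case using kernel_span_ext J_cong[of g2 g1] by simp
qed

lemma kernel_span_isometry: "g \<in> kernel_span \<Longrightarrow> l2norm M (J g) = l2norm N g"
  using kernel_span_ip[of g g] kernel_span_L2[of g] kernel_span_H[of g]
  by (metis l2norm_square_ip of_real_eq_iff power2_eq_iff_nonneg l2norm_nonneg)

lemma trig_mult_e_kernel_span: "p \<in> trig \<Longrightarrow> (\<lambda>\<xi>. p \<xi> * e 0 y \<xi>) \<in> kernel_span"
proof (induction rule: trig.induct)
  case (ev a)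
  show ?case
    by (rule kernel_span_ext[OF kernel_span_e[of "- a" y]]) (simp add: e_def Omega_characters character_zero)
next
  case (add p p')
  then show ?case using kernel_span_add by (fastforce simp: distrib_right)
next
  case (scale p c)
  then show ?case using kernel_span_scale[of "\<lambda>\<xi>. p \<xi> * e 0 y \<xi>" c] by (simp add: mult.assoc)
next
  case (ext p p')
  show ?case by (rule kernel_span_ext[OF ext.IH]) (simp add: ext.hyps Omega_characters)
qed

lemma span_closure_add:
  "g \<in> L2_closure N kernel_span \<Longrightarrow> g' \<in> L2_closure N kernel_span \<Longrightarrow> (\<lambda>\<xi>. g \<xi> + g' \<xi>) \<in> L2_closure N kernel_span"
  by (rule L2_closure_add[OF kernel_span_subset kernel_span_add])

lemma integrable_N_real: "integrable N f \<longleftrightarrow> integrable \<nu>h (\<lambda>\<xi>. indicator \<Omega> \<xi> * f \<xi>)" for f :: "_ \<Rightarrow> real"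
  using Omega_sets sets.sets_into_space[OF Omega_sets]
  by (subst integrable_restrict_space) (auto simp: Int_absorb2)

lemma integral_N_real: "(\<integral>\<xi>. f \<xi> \<partial>N) = (\<integral>\<xi>. indicator \<Omega> \<xi> * f \<xi> \<partial>\<nu>h)" for f :: "_ \<Rightarrow> real"
  using Omega_sets sets.sets_into_space[OF Omega_sets]
  by (subst integral_restrict_space) (auto simp: Int_absorb2)

text \<open>On B one may divide: 1_B * g = m * e 0 y with m = 1_B * g / cnj(q_\<xi>(y)). The weight
  |q_\<xi>(y)|^2 is integrable and turns |m|^2 into |1_B * g|^2, so approximating m by p in the
  weighted norm approximates 1_B * g by p * e 0 y.\<close>

lemma L2_closure_piece:
  assumes g: "g \<in> L2 N" and B: "B \<in> sets N" "\<And>\<xi>. \<xi> \<in> B \<Longrightarrow> q \<xi> y \<noteq> 0"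
  shows "(\<lambda>\<xi>. indicator B \<xi> * g \<xi>) \<in> L2_closure N kernel_span"
  unfolding L2_closure_def
proof (intro CollectI conjI allI impI)
  have [measurable]: "g \<in> borel_measurable N" using g by (rule L2_measurable)
  have BO: "B \<subseteq> \<Omega>" using sets.sets_into_space[OF B(1)] by (simp add: space_N)
  show gL: "(\<lambda>\<xi>. indicator B \<xi> * g \<xi>) \<in> L2 N"
    by (rule L2_bounded_mult[OF g, where C=1]) (use B in \<open>auto simp: indicator_def\<close>)
  fix \<epsilon> :: real assume "\<epsilon> > 0"
  then have "\<epsilon>\<^sup>2 > 0" by simp
  define w where "w \<xi> = indicator \<Omega> \<xi> * (cmod (q \<xi> y))\<^sup>2" for \<xi>
  define m where "m \<xi> = indicator \<Omega> \<xi> * (indicator B \<xi> * g \<xi> / cnj (q \<xi> y))" for \<xi>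
  have "integrable N (\<lambda>\<xi>. (cmod (e 0 y \<xi>))\<^sup>2)" using e_L2 by (rule L2_integrable_square)
  then have "integrable N (\<lambda>\<xi>. (cmod (q \<xi> y))\<^sup>2)"
    by (rule Bochner_Integration.integrable_cong[OF refl, THEN iffD1, rotated])
      (simp add: e_def norm_mult character_norm space_N_character)
  then have wi: "integrable \<nu>h w" unfolding integrable_N_real w_def[abs_def] .
  have wn: "0 \<le> w \<xi>" for \<xi> by (simp add: w_def)
  note [measurable] = B(1)
  have mm: "m \<in> borel_measurable \<nu>h" unfolding m_def[abs_def] by (rule restrict_measurable) measurable
  have "w \<xi> * (cmod (m \<xi>))\<^sup>2 = indicator \<Omega> \<xi> * (cmod (indicator B \<xi> * g \<xi>))\<^sup>2" for \<xi>
    using B(2)[of \<xi>] BO by (auto simp: w_def m_def indicator_def norm_divide power_divide)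
  then have wm: "integrable \<nu>h (\<lambda>\<xi>. w \<xi> * (cmod (m \<xi>))\<^sup>2)"
    using L2_integrable_square[OF gL] unfolding integrable_N_real by simp
  obtain p where p: "p \<in> trig" "(\<integral>\<xi>. w \<xi> * (cmod (m \<xi> - p \<xi>))\<^sup>2 \<partial>\<nu>h) < \<epsilon>\<^sup>2"
    using weighted_trig_dense[OF wi wn mm wm \<open>\<epsilon>\<^sup>2 > 0\<close>] by blast
  have "w \<xi> * (cmod (m \<xi> - p \<xi>))\<^sup>2 = indicator \<Omega> \<xi> * (cmod (indicator B \<xi> * g \<xi> - p \<xi> * e 0 y \<xi>))\<^sup>2" for \<xi>
  proof (cases "\<xi> \<in> \<Omega>")
    case True
    have "(m \<xi> - p \<xi>) * cnj (q \<xi> y) = indicator B \<xi> * g \<xi> - p \<xi> * e 0 y \<xi>"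
      using True B(2)[of \<xi>]
      by (auto simp: m_def e_def indicator_def character_zero Omega_characters left_diff_distrib)
    then have "(cmod (indicator B \<xi> * g \<xi> - p \<xi> * e 0 y \<xi>))\<^sup>2 = (cmod (m \<xi> - p \<xi>))\<^sup>2 * (cmod (q \<xi> y))\<^sup>2"
      by (metis complex_mod_cnj norm_mult power_mult_distrib)
    then show ?thesis using True by (simp add: w_def)
  qed (simp add: w_def)
  then have "(l2norm N (\<lambda>\<xi>. indicator B \<xi> * g \<xi> - p \<xi> * e 0 y \<xi>))\<^sup>2 < \<epsilon>\<^sup>2"
    using p(2) unfolding l2norm_square integral_N_real by simp
  then have "l2norm N (\<lambda>\<xi>. indicator B \<xi> * g \<xi> - p \<xi> * e 0 y \<xi>) < \<epsilon>"
    using \<open>\<epsilon> > 0\<close> by (simp add: power_less_imp_less_base)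
  then show "\<exists>g'\<in>kernel_span. l2norm N (\<lambda>\<xi>. indicator B \<xi> * g \<xi> - g' \<xi>) < \<epsilon>"
    using trig_mult_e_kernel_span[OF p(1)] by (intro bexI[of _ "\<lambda>\<xi>. p \<xi> * e 0 y \<xi>"])
qed

lemma kernel_span_dense:
  assumes g: "g \<in> L2 N" and "\<epsilon> > 0"
  obtains g' where "g' \<in> kernel_span" "l2norm N (\<lambda>\<xi>. g \<xi> - g' \<xi>) < \<epsilon>"
proof -
  have gm [measurable]: "g \<in> borel_measurable N" using g by (rule L2_measurable)
  obtain ys :: "nat \<Rightarrow> 'y" where ys: "\<And>\<xi>. \<xi> \<in> \<Omega> \<Longrightarrow> \<exists>n. q \<xi> (ys n) \<noteq> 0"
    using countable_nonvanishing by blast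
  \<comment> \<open>These sets increase to \<Omega>, and the increment from U n to U (n+1) lies
    where q_\<xi>(ys n) is nonzero, so a single e 0 (ys n) handles it.\<close>
  define U where "U n = {\<xi> \<in> space N. \<exists>k<n. q \<xi> (ys k) \<noteq> 0}" for n :: nat
  have U [measurable]: "U n \<in> sets N" for n unfolding U_def by measurable
  have closU: "(\<lambda>\<xi>. indicator (U n) \<xi> * g \<xi>) \<in> L2_closure N kernel_span" for n
  proof (induction n)
    case 0
    have "(\<lambda>\<xi>. indicator {} \<xi> * g \<xi>) \<in> L2_closure N kernel_span" by (rule L2_closure_piece[OF g]) auto
    then show ?case by (simp add: U_def)
  next
    case (Suc n)
    have "(\<lambda>\<xi>. indicator (U (Suc n) - U n) \<xi> * g \<xi>) \<in> L2_closure N kernel_span"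
      by (rule L2_closure_piece[OF g, where y="ys n"]) (auto simp: U less_Suc_eq, auto simp: U_def less_Suc_eq)
    from span_closure_add[OF Suc this] have "(\<lambda>\<xi>. indicator (U n) \<xi> * g \<xi> + indicator (U (Suc n) - U n) \<xi> * g \<xi>) \<in> L2_closure N kernel_span" .
    moreover have "(\<lambda>\<xi>. indicator (U n) \<xi> * g \<xi> + indicator (U (Suc n) - U n) \<xi> * g \<xi>) = (\<lambda>\<xi>. indicator (U (Suc n)) \<xi> * g \<xi>)"
      by (rule HOL.ext) (auto simp: indicator_def U_def less_Suc_eq)
    ultimately show ?case by simp
  qed
  have "(\<lambda>n. l2norm N (\<lambda>\<xi>. indicator (U n) \<xi> * g \<xi> - g \<xi>)) \<longlonglongrightarrow> 0"
  proof (rule L2_dominated_convergence[OF _ gm g])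
    show "AE \<xi> in N. cmod (indicator (U n) \<xi> * g \<xi> - g \<xi>) \<le> 1 * cmod (g \<xi>)" for n by (auto simp: indicator_def)
    show "AE \<xi> in N. (\<lambda>n. indicator (U n) \<xi> * g \<xi>) \<longlonglongrightarrow> g \<xi>"
    proof (intro AE_I2)
      fix \<xi> assume \<xi>: "\<xi> \<in> space N"
      then obtain k where "q \<xi> (ys k) \<noteq> 0" using ys space_N by auto
      then have "eventually (\<lambda>n. indicator (U n) \<xi> * g \<xi> = g \<xi>) sequentially"
        unfolding eventually_sequentially using \<xi> by (intro exI[of _ "Suc k"]) (auto simp: U_def indicator_def)
      then show "(\<lambda>n. indicator (U n) \<xi> * g \<xi>) \<longlonglongrightarrow> g \<xi>" by (rule tendsto_eventually)
    qed
  qed measurable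
  moreover have "\<epsilon> / 2 > 0" using \<open>\<epsilon> > 0\<close> by simp
  ultimately obtain n where "norm (l2norm N (\<lambda>\<xi>. indicator (U n) \<xi> * g \<xi> - g \<xi>) - 0) < \<epsilon> / 2"
    using LIMSEQ_D by blast
  then have n: "l2norm N (\<lambda>\<xi>. g \<xi> - indicator (U n) \<xi> * g \<xi>) < \<epsilon> / 2"
    by (simp add: l2norm_minus_commute[of N g])
  obtain g' where g': "g' \<in> kernel_span" "l2norm N (\<lambda>\<xi>. indicator (U n) \<xi> * g \<xi> - g' \<xi>) < \<epsilon> / 2"
    using closU[of n] \<open>\<epsilon> / 2 > 0\<close> unfolding L2_closure_def by blast
  have UL: "(\<lambda>\<xi>. indicator (U n) \<xi> * g \<xi>) \<in> L2 N" using closU[of n] by (simp add: L2_closure_def)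
  show ?thesis
    using l2norm_triangle_diff[OF g UL kernel_span_L2[OF g'(1)]] n g' by (intro that[OF g'(1)]) simp
qed

lemma kernel_span_sequence:
  assumes g: "g \<in> L2 N"
  obtains s where "\<And>n. s n \<in> kernel_span" "(\<lambda>n. l2norm N (\<lambda>\<xi>. s n \<xi> - g \<xi>)) \<longlonglongrightarrow> 0"
    "(\<lambda>n. l2norm M (\<lambda>p. J (s n) p - J g p)) \<longlonglongrightarrow> 0" "J g \<in> H"
proof -
  have "\<exists>g'. g' \<in> kernel_span \<and> l2norm N (\<lambda>\<xi>. g \<xi> - g' \<xi>) < 1 / real (Suc n)" for n
    using kernel_span_dense[OF g, of "1 / real (Suc n)"] by auto
  then obtain s where s: "\<And>n. s n \<in> kernel_span" "\<And>n. l2norm N (\<lambda>\<xi>. g \<xi> - s n \<xi>) < 1 / real (Suc n)" by metis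
  have sL: "s n \<in> L2 N" for n by (intro kernel_span_L2 s)
  have lim: "(\<lambda>n. l2norm N (\<lambda>\<xi>. s n \<xi> - g \<xi>)) \<longlonglongrightarrow> 0"
  proof (rule Lim_null_comparison)
    show "(\<lambda>n. 1 / real (Suc n)) \<longlonglongrightarrow> 0" using LIMSEQ_inverse_real_of_nat by (simp add: divide_inverse)
    show "\<forall>\<^sub>F n in sequentially. norm (l2norm N (\<lambda>\<xi>. s n \<xi> - g \<xi>)) \<le> 1 / real (Suc n)"
      using s(2) by (intro always_eventually allI) (simp add: l2norm_minus_commute[of N _ g] less_imp_le)
  qed
  have dist: "l2norm M (\<lambda>p. J (s m) p - J (s n) p) = l2norm N (\<lambda>\<xi>. s m \<xi> - s n \<xi>)" for m n
    using kernel_span_isometry[OF kernel_span_diff[OF s(1) s(1)], of m n] by (simp add: J_diff sL)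
  have cauchy: "\<exists>N'. \<forall>m\<ge>N'. \<forall>n\<ge>N'. l2norm M (\<lambda>p. J (s m) p - J (s n) p) < \<epsilon>" if "\<epsilon> > 0" for \<epsilon>
  proof -
    obtain N' where N': "\<And>n. n \<ge> N' \<Longrightarrow> l2norm N (\<lambda>\<xi>. s n \<xi> - g \<xi>) < \<epsilon> / 2"
      using LIMSEQ_D[OF lim, of "\<epsilon> / 2"] \<open>\<epsilon> > 0\<close> by auto
    have "l2norm N (\<lambda>\<xi>. s m \<xi> - s n \<xi>) < \<epsilon>" if "m \<ge> N'" "n \<ge> N'" for m n
      using l2norm_triangle_diff[OF sL g sL, of m n] N'[OF that(1)] N'[OF that(2)]
        l2norm_minus_commute[of N "s n" g] by simp
    then show ?thesis unfolding dist by blast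
  qed
  obtain f where f: "f \<in> H" "(\<lambda>n. l2norm M (\<lambda>p. J (s n) p - f p)) \<longlonglongrightarrow> 0"
    using H_complete[of "\<lambda>n. J (s n)", OF kernel_span_H[OF s(1)] cauchy] by blast
  \<comment> \<open>The limit in H is identified by its values: evaluation at (x,y) is continuous in
    f as inner product with K_{x,y}, and in g as inner product with \<open>e x y\<close>.\<close>
  have "f p = J g p" for p
  proof -
    obtain x y where p: "p = (x, y)" by (cases p)
    have "(\<lambda>n. ip M (J (s n)) (K x y)) \<longlonglongrightarrow> ip M f (K x y)"
      by (intro ip_tendsto_left H_L2 kernel_span_H s f K_H)
    then have "(\<lambda>n. J (s n) (x, y)) \<longlonglongrightarrow> f (x, y)"
      by (simp add: reproducing[OF f(1)] reproducing[OF kernel_span_H[OF s(1)]])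
    moreover have "(\<lambda>n. J (s n) (x, y)) \<longlonglongrightarrow> J g (x, y)"
      unfolding J_ip by (intro ip_tendsto_left sL g e_L2 lim)
    ultimately show ?thesis unfolding p by (rule LIMSEQ_unique)
  qed
  then have "f = J g" by blast
  then show ?thesis using that[of s] s(1) lim f by blast
qed

lemma J_H: "g \<in> L2 N \<Longrightarrow> J g \<in> H"
  using kernel_span_sequence by blast

lemma J_isometry:
  assumes g: "g \<in> L2 N" and g': "g' \<in> L2 N"
  shows "ip M (J g) (J g') = ip N g g'"
proof -
  obtain s where s: "\<And>n. s n \<in> kernel_span" "(\<lambda>n. l2norm N (\<lambda>\<xi>. s n \<xi> - g \<xi>)) \<longlonglongrightarrow> 0"
    "(\<lambda>n. l2norm M (\<lambda>p. J (s n) p - J g p)) \<longlonglongrightarrow> 0"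
    using kernel_span_sequence[OF g] by blast
  have "(\<lambda>n. ip M (J (s n)) (J g')) \<longlonglongrightarrow> ip M (J g) (J g')"
    by (intro ip_tendsto_left H_L2 J_H kernel_span_L2 s g g')
  moreover have "(\<lambda>n. ip N (s n) g') \<longlonglongrightarrow> ip N g g'"
    by (intro ip_tendsto_left kernel_span_L2 s g g')
  ultimately show ?thesis
    using LIMSEQ_unique by (simp add: kernel_span_ip[OF s(1) g' J_H[OF g']])
qed

lemma l2norm_J: "g \<in> L2 N \<Longrightarrow> l2norm M (J g) = l2norm N g"
  using J_isometry[of g g]
  by (metis l2norm_square_ip of_real_eq_iff power2_eq_iff_nonneg l2norm_nonneg)

lemma J_inj:
  assumes "g \<in> L2 N" "g' \<in> L2 N" "J g = J g'"
  shows "AE \<xi> in N. g \<xi> = g' \<xi>"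
proof -
  have "l2norm N (\<lambda>\<xi>. g \<xi> - g' \<xi>) = l2norm M (\<lambda>p. J g p - J g' p)"
    using l2norm_J[OF L2_diff[OF assms(1,2)]] by (simp add: J_diff assms(1,2))
  also have "\<dots> = 0" by (simp add: assms(3) l2norm_def)
  finally show ?thesis using l2norm_eq_0_iff[OF L2_diff[OF assms(1,2)]] by simp
qed

section \<open>The operator R as inverse of J\<close>

sublocale N: sigma_finite_measure N
  by (rule sigma_finite_measure_restrict_space[OF nuh.sigma_finite_measure_axioms Omega_sets])

text \<open>As almost every q_\<xi> is a unit vector, Cauchy-Schwarz in v bounds |R f \<xi>| by the
  norm of the section of the transform at \<xi>, whose square is integrable.\<close>

lemma R_L2:
  assumes f: "f \<in> H"
  shows "R f \<in> L2 N"
proof -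
  let ?F = "FI \<nu> \<nu>h \<mu> f"
  have FL: "?F \<in> L2 Mh" by (rule FI_props[OF H_L2[OF f]])
  have Fm: "?F \<in> borel_measurable Mh" using FL by (rule L2_measurable)
  have id: "(\<lambda>\<xi>. \<xi>) \<in> measurable N \<nu>h" by (rule measurable_restrict_space1) simp
  have "(\<lambda>p. (fst p, snd p)) \<in> measurable (N \<Otimes>\<^sub>M \<mu>) Mh"
    by (intro measurable_Pair measurable_compose[OF measurable_fst id] measurable_snd)
  from measurable_compose[OF this Fm] have 1: "(\<lambda>p. ?F (fst p, snd p)) \<in> borel_measurable (N \<Otimes>\<^sub>M \<mu>)" .
  have "(\<lambda>p. ?F (fst p, snd p) * cnj (q (fst p) (snd p))) \<in> borel_measurable (N \<Otimes>\<^sub>M \<mu>)"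
    by (intro borel_measurable_times borel_measurable_cnj 1 qmeas)
  then have Rm: "R f \<in> borel_measurable N"
    unfolding Rop_def[abs_def]
    by (intro mu.borel_measurable_lebesgue_integral) (simp add: split_beta')
  let ?G = "\<lambda>\<xi>. \<integral>v. (cmod (?F (\<xi>, v)))\<^sup>2 \<partial>\<mu>"
  have "integrable \<nu>h ?G" using pH.integrable_fst'[OF L2_integrable_square[OF FL]] .
  from integrable_mult_indicator[OF Omega_sets this] have G: "integrable N ?G"
    unfolding integrable_N_real by simp
  have sec: "AE \<xi> in N. (\<lambda>v. ?F (\<xi>, v)) \<in> L2 \<mu>"
    unfolding AE_N_iff using pH.L2_section_fst[OF FL] by eventually_elim simp
  have "integrable N (\<lambda>\<xi>. (cmod (R f \<xi>))\<^sup>2)"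
  proof (rule Bochner_Integration.integrable_bound[OF G])
    show "AE \<xi> in N. norm ((cmod (R f \<xi>))\<^sup>2) \<le> norm (?G \<xi>)"
      using sec q_normalized
    proof eventually_elim
      case (elim \<xi>)
      have "R f \<xi> = ip \<mu> (\<lambda>v. ?F (\<xi>, v)) (q \<xi>)" by (simp add: Rop_def ip_def)
      then have "cmod (R f \<xi>) \<le> l2norm \<mu> (\<lambda>v. ?F (\<xi>, v))"
        using ip_Cauchy_Schwarz[OF elim(1), of "q \<xi>"] elim(2) by simp
      then have "(cmod (R f \<xi>))\<^sup>2 \<le> (l2norm \<mu> (\<lambda>v. ?F (\<xi>, v)))\<^sup>2" by (intro power_mono) auto
      then show ?case by (simp add: l2norm_square)
    qed
  qed (use Rm in measurable)
  then show ?thesis using Rm by (simp add: L2_def)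
qed

text \<open>Parseval turns f(x,y) = <f, K_{x,y}> into a double integral. On \<Omega> the transformed
  kernel factors, and integrating over w leaves R f \<xi> * \<xi>(x) * q_\<xi>(y); off \<Omega> the
  transformed kernel vanishes for almost every w.\<close>

lemma J_R:
  assumes f: "f \<in> H"
  shows "J (R f) = f"
proof (rule HOL.ext)
  fix p :: "'g \<times> 'y"
  obtain x y where p: "p = (x, y)" by (cases p)
  let ?F = "FI \<nu> \<nu>h \<mu> f"
  have FL: "?F \<in> L2 Mh" by (rule FI_props[OF H_L2[OF f]])
  have prod: "integrable Mh (\<lambda>p. ?F p * cnj (FT (K x y) p))" by (intro L2_ip_integrable FL FT_K_L2)
  have Rm [measurable]: "R f \<in> borel_measurable N" using R_L2[OF f] by (rule L2_measurable)
  have "f (x, y) = ip M f (K x y)" by (rule reproducing[OF f])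
  also have "\<dots> = ip Mh ?F (FT (K x y))" by (intro FI_props(2)[symmetric] H_L2 f K_H K_L1_sections)
  also have "\<dots> = (\<integral>\<xi>. \<integral>w. ?F (\<xi>, w) * cnj (FT (K x y) (\<xi>, w)) \<partial>\<mu> \<partial>\<nu>h)"
    unfolding ip_def by (rule pH.integral_fst'[OF prod, symmetric])
  also have "\<dots> = (\<integral>\<xi>. indicator \<Omega> \<xi> * (R f \<xi> * (\<xi> x * q \<xi> y)) \<partial>\<nu>h)"
  proof (rule integral_cong_AE)
    show "(\<lambda>\<xi>. \<integral>w. ?F (\<xi>, w) * cnj (FT (K x y) (\<xi>, w)) \<partial>\<mu>) \<in> borel_measurable \<nu>h"
      using pH.integrable_fst'[OF prod] by (rule borel_measurable_integrable)
    show "(\<lambda>\<xi>. indicator \<Omega> \<xi> * (R f \<xi> * (\<xi> x * q \<xi> y))) \<in> borel_measurable \<nu>h"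
      by (rule restrict_measurable) measurable
    show "AE \<xi> in \<nu>h. (\<integral>w. ?F (\<xi>, w) * cnj (FT (K x y) (\<xi>, w)) \<partial>\<mu>) = indicator \<Omega> \<xi> * (R f \<xi> * (\<xi> x * q \<xi> y))"
      using LK_zero_off_Omega[of y] AE_space
    proof eventually_elim
      case (elim \<xi>)
      then have \<xi>: "\<xi> \<in> characters" by (simp add: space_dual)
      show ?case
      proof (cases "\<xi> \<in> \<Omega>")
        case True
        have "(\<integral>w. ?F (\<xi>, w) * cnj (FT (K x y) (\<xi>, w)) \<partial>\<mu>) = (\<integral>w. ?F (\<xi>, w) * cnj (q \<xi> w) * (\<xi> x * q \<xi> y) \<partial>\<mu>)"
          by (simp add: FT_K[OF \<xi>] qfac[OF True] mult_ac)
        then show ?thesis using True by (simp add: Rop_def)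
      next
        case False
        then have "AE w in \<mu>. ?F (\<xi>, w) * cnj (FT (K x y) (\<xi>, w)) = 0"
          using elim(1) by (auto simp: FT_K[OF \<xi>])
        then show ?thesis using False by (simp add: integral_eq_zero_AE)
      qed
    qed
  qed
  also have "\<dots> = J (R f) (x, y)" by (simp add: J_def integral_N)
  finally show "J (R f) p = f p" by (simp add: p)
qed

text \<open>R rests on the choice in \<open>FI\<close>, whereas J is an explicit integral. Linearity
  of R and its behaviour under translations are read off from J by this lemma.\<close>

lemma R_unique: "f \<in> H \<Longrightarrow> g \<in> L2 N \<Longrightarrow> J g = f \<Longrightarrow> AE \<xi> in N. R f \<xi> = g \<xi>"
  by (rule J_inj) (auto simp: R_L2 J_R)

lemma R_J: "g \<in> L2 N \<Longrightarrow> AE \<xi> in N. R (J g) \<xi> = g \<xi>"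
  by (intro R_unique J_H) auto

lemma R_lin:
  assumes "f \<in> H" "g \<in> H"
  shows "AE \<xi> in N. R (\<lambda>p. c * f p + g p) \<xi> = c * R f \<xi> + R g \<xi>"
  by (rule R_unique[OF H_lin[OF assms]])
    (auto intro!: L2_add L2_scale R_L2 assms simp: J_add J_scale L2_scale R_L2 assms J_R)

lemma l2norm_R: "f \<in> H \<Longrightarrow> l2norm N (R f) = l2norm M f"
  using l2norm_J[of "R f"] by (simp add: R_L2 J_R)

lemma cnj_ev_mult_L2: "g \<in> L2 N \<Longrightarrow> (\<lambda>\<xi>. cnj (\<xi> a) * g \<xi>) \<in> L2 N"
  by (rule L2_bounded_mult[where C=1]) (auto simp: space_N_character character_norm)

lemma rho_J:
  assumes "g \<in> L2 N"
  shows "rho a (J g) = J (\<lambda>\<xi>. cnj (\<xi> a) * g \<xi>)"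
proof (rule HOL.ext)
  fix p :: "'g \<times> 'y"
  obtain x y where p: "p = (x, y)" by (cases p)
  show "rho a (J g) p = J (\<lambda>\<xi>. cnj (\<xi> a) * g \<xi>) p"
    unfolding p rho_apply J_def prod.case
    by (intro Bochner_Integration.integral_cong[OF refl])
      (simp add: space_N_character character_diff)
qed

text \<open>Translation multiplies R f by a function of modulus 1, and J maps all of L2 N into
  H.\<close>

lemma rho_H: "f \<in> H \<Longrightarrow> rho a f \<in> H"
  using rho_J[of "R f" a] J_H[OF cnj_ev_mult_L2[of "R f" a]] by (simp add: R_L2 J_R)

lemma R_rho: "f \<in> H \<Longrightarrow> AE \<xi> in N. R (rho a f) \<xi> = cnj (\<xi> a) * R f \<xi>"
  using rho_J[of "R f" a] by (intro R_unique rho_H cnj_ev_mult_L2 R_L2) (simp_all add: R_L2 J_R)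

end

section \<open>Convolution operators and the commutant of the translations\<close>

context rkhs_setting
begin

text \<open>The operator R* M_b R with J in the place of the adjoint. It has a value at every point,
  and \<open>Vop_eq\<close> matches it with the definite description.\<close>

definition V :: "(('g \<Rightarrow> complex) \<Rightarrow> complex) \<Rightarrow> ('g \<times> 'y \<Rightarrow> complex) \<Rightarrow> 'g \<times> 'y \<Rightarrow> complex" where
  "V b f = J (\<lambda>\<xi>. b \<xi> * R f \<xi>)"

lemma Linf_mult_L2: "b \<in> Linf N \<Longrightarrow> g \<in> L2 N \<Longrightarrow> (\<lambda>\<xi>. b \<xi> * g \<xi>) \<in> L2 N"
  unfolding Linf_def using L2_bounded_mult[of g N b] by blast

lemma Linf_cnj: "b \<in> Linf N \<Longrightarrow> (\<lambda>\<xi>. cnj (b \<xi>)) \<in> Linf N"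
  unfolding Linf_def by auto

lemma V_H: "b \<in> Linf N \<Longrightarrow> f \<in> H \<Longrightarrow> V b f \<in> H"
  unfolding V_def by (intro J_H Linf_mult_L2 R_L2)

lemma Vop_eq:
  assumes b: "b \<in> Linf N" and f: "f \<in> H"
  shows "Vop \<nu> \<nu>h \<mu> H \<Omega> q b f = V b f"
  unfolding Vop_def
proof (rule the_equality)
  have L: "(\<lambda>\<xi>. b \<xi> * R f \<xi>) \<in> L2 N" by (intro Linf_mult_L2 R_L2 b f)
  show "V b f \<in> H \<and> (AE \<xi> in N. R (V b f) \<xi> = b \<xi> * R f \<xi>)"
    using V_H[OF b f] R_J[OF L] by (simp add: V_def)
  fix h assume h: "h \<in> H \<and> (AE \<xi> in N. R h \<xi> = b \<xi> * R f \<xi>)"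
  then have "h = J (R h)" by (simp add: J_R)
  also have "\<dots> = V b f"
    unfolding V_def using h by (intro J_cong_AE L2_measurable[OF L] L2_measurable[OF R_L2]) auto
  finally show "h = V b f" .
qed

lemma V_lin:
  assumes b: "b \<in> Linf N" and f: "f \<in> H" and g: "g \<in> H"
  shows "V b (\<lambda>p. c * f p + g p) = (\<lambda>p. c * V b f p + V b g p)"
proof -
  note L = Linf_mult_L2[OF b R_L2[OF f]] Linf_mult_L2[OF b R_L2[OF g]]
  have "V b (\<lambda>p. c * f p + g p) = J (\<lambda>\<xi>. c * (b \<xi> * R f \<xi>) + b \<xi> * R g \<xi>)"
    unfolding V_def
  proof (rule J_cong_AE)
    show "(\<lambda>\<xi>. b \<xi> * R (\<lambda>p. c * f p + g p) \<xi>) \<in> borel_measurable N"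
      by (intro L2_measurable Linf_mult_L2 b R_L2 H_lin f g)
    show "(\<lambda>\<xi>. c * (b \<xi> * R f \<xi>) + b \<xi> * R g \<xi>) \<in> borel_measurable N"
      by (intro L2_measurable L2_add L2_scale L)
    show "AE \<xi> in N. b \<xi> * R (\<lambda>p. c * f p + g p) \<xi> = c * (b \<xi> * R f \<xi>) + b \<xi> * R g \<xi>"
      using R_lin[OF f g, of c] by eventually_elim (simp add: algebra_simps)
  qed
  also have "\<dots> = (\<lambda>p. c * V b f p + V b g p)"
    by (simp add: V_def J_add J_scale L2_scale L)
  finally show ?thesis .
qed

lemma V_bounded:
  assumes b: "b \<in> Linf N"
  obtains C where "\<And>f. f \<in> H \<Longrightarrow> l2norm M (V b f) \<le> C * l2norm M f"
proof -
  obtain C where C: "AE \<xi> in N. cmod (b \<xi>) \<le> C" using b by (auto simp: Linf_def)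
  show ?thesis
  proof (rule that[of "\<bar>C\<bar>"])
    fix f assume f: "f \<in> H"
    have L: "(\<lambda>\<xi>. b \<xi> * R f \<xi>) \<in> L2 N" by (intro Linf_mult_L2 R_L2 b f)
    have "l2norm M (V b f) = l2norm N (\<lambda>\<xi>. b \<xi> * R f \<xi>)" unfolding V_def by (rule l2norm_J[OF L])
    also have "\<dots> \<le> \<bar>C\<bar> * l2norm N (R f)"
    proof (rule l2norm_mono[OF R_L2[OF f] L2_measurable[OF L]])
      show "AE \<xi> in N. cmod (b \<xi> * R f \<xi>) \<le> \<bar>C\<bar> * cmod (R f \<xi>)"
        using C by eventually_elim (auto simp: norm_mult intro!: mult_right_mono)
    qed simp
    finally show "l2norm M (V b f) \<le> \<bar>C\<bar> * l2norm M f" by (simp add: l2norm_R[OF f])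
  qed
qed

section \<open>Convolution with the functions phi\<close>

lemma phi_J: "phi \<nu> \<nu>h \<Omega> K b x y v = J (\<lambda>\<xi>. b \<xi> * e 0 v \<xi>) (x, y)"
  unfolding phi_def J_def prod.case
  by (intro Bochner_Integration.integral_cong[OF refl])
    (simp add: space_N qfac e_def character_zero Omega_characters mult_ac)

text \<open>The conjugated convolution kernel, as a function of (u,v), lies in the range of J.
  Convolution with phi thus becomes an inner product in H that \<open>J_isometry\<close> transports
  to L2 N.\<close>

lemma cnj_phi: "cnj (phi \<nu> \<nu>h \<Omega> K b (x - u) y v) = J (\<lambda>\<xi>. cnj (b \<xi>) * e x y \<xi>) (u, v)"
  unfolding phi_def J_def prod.case Bochner_Integration.integral_cnj[symmetric]
  by (intro Bochner_Integration.integral_cong[OF refl])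
    (simp add: space_N qfac e_def character_diff character_minus Omega_characters mult_ac)

lemma phi_A0:
  assumes b: "b \<in> Linf N"
  shows "phi \<nu> \<nu>h \<Omega> K b \<in> A0 H"
  unfolding A0_def
proof (intro CollectI conjI allI)
  fix v
  have "(\<lambda>(x, y). phi \<nu> \<nu>h \<Omega> K b x y v) = J (\<lambda>\<xi>. b \<xi> * e 0 v \<xi>)"
    by (rule HOL.ext) (auto simp: phi_J)
  then show "(\<lambda>(x, y). phi \<nu> \<nu>h \<Omega> K b x y v) \<in> H" by (simp add: J_H Linf_mult_L2 b e_L2)
next
  fix y
  have "(\<lambda>(u, v). cnj (phi \<nu> \<nu>h \<Omega> K b (- u) y v)) = J (\<lambda>\<xi>. cnj (b \<xi>) * e 0 y \<xi>)"
    using cnj_phi[of b 0] by (intro HOL.ext) auto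
  then show "(\<lambda>(u, v). cnj (phi \<nu> \<nu>h \<Omega> K b (- u) y v)) \<in> H" by (simp add: J_H Linf_mult_L2 Linf_cnj b e_L2)
qed

lemma Sop_phi:
  assumes b: "b \<in> Linf N" and f: "f \<in> H"
  shows "Sop M (phi \<nu> \<nu>h \<Omega> K b) f = V b f"
proof (rule HOL.ext)
  fix p :: "'g \<times> 'y"
  obtain x y where p: "p = (x, y)" by (cases p)
  have cL: "(\<lambda>\<xi>. cnj (b \<xi>) * e x y \<xi>) \<in> L2 N" by (intro Linf_mult_L2 Linf_cnj b e_L2)
  have "J (\<lambda>\<xi>. cnj (b \<xi>) * e x y \<xi>) r = cnj (phi \<nu> \<nu>h \<Omega> K b (x - fst r) y (snd r))" for r
    using cnj_phi[of b x "fst r" y "snd r"] by simp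
  then have "Sop M (phi \<nu> \<nu>h \<Omega> K b) f p = ip M f (J (\<lambda>\<xi>. cnj (b \<xi>) * e x y \<xi>))"
    by (simp add: Sop_def p ip_def)
  also have "\<dots> = ip M (J (R f)) (J (\<lambda>\<xi>. cnj (b \<xi>) * e x y \<xi>))" by (simp add: J_R f)
  also have "\<dots> = ip N (R f) (\<lambda>\<xi>. cnj (b \<xi>) * e x y \<xi>)" by (intro J_isometry R_L2 f cL)
  also have "\<dots> = ip N (\<lambda>\<xi>. b \<xi> * R f \<xi>) (e x y)" by (simp add: ip_def mult_ac)
  also have "\<dots> = V b f p" by (simp add: V_def p J_ip)
  finally show "Sop M (phi \<nu> \<nu>h \<Omega> K b) f p = V b f p" .
qed

lemma restrict_Sop_phi:
  "b \<in> Linf N \<Longrightarrow> restrict (Sop M (phi \<nu> \<nu>h \<Omega> K b)) H = restrict (V b) H"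
  by (auto simp: restrict_def Sop_phi)

lemma restrict_V_bop:
  assumes b: "b \<in> Linf N"
  shows "restrict (V b) H \<in> bop M H"
  unfolding bop_def
proof (intro CollectI conjI ballI allI)
  show "restrict (V b) H \<in> H \<rightarrow> H" by (auto simp: V_H b)
  obtain C where "\<And>f. f \<in> H \<Longrightarrow> l2norm M (V b f) \<le> C * l2norm M f" using V_bounded[OF b] by blast
  then show "\<exists>C. \<forall>f\<in>H. l2norm M (restrict (V b) H f) \<le> C * l2norm M f" by auto
qed (auto simp: H_lin V_lin[OF b])

lemma phi_Aset: "b \<in> Linf N \<Longrightarrow> phi \<nu> \<nu>h \<Omega> K b \<in> Aset M H"
  unfolding Aset_def by (simp add: phi_A0 restrict_Sop_phi restrict_V_bop)

lemma phi_eq_iff: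
  assumes b1: "b1 \<in> Linf N" and b2: "b2 \<in> Linf N"
  shows "phi \<nu> \<nu>h \<Omega> K b1 = phi \<nu> \<nu>h \<Omega> K b2 \<longleftrightarrow> (AE \<xi> in N. b1 \<xi> = b2 \<xi>)"
proof
  assume eq: "phi \<nu> \<nu>h \<Omega> K b1 = phi \<nu> \<nu>h \<Omega> K b2"
  have ae: "AE \<xi> in N. b1 \<xi> * e 0 v \<xi> = b2 \<xi> * e 0 v \<xi>" for v
  proof (rule J_inj)
    show "J (\<lambda>\<xi>. b1 \<xi> * e 0 v \<xi>) = J (\<lambda>\<xi>. b2 \<xi> * e 0 v \<xi>)"
    proof (rule HOL.ext)
      fix p :: "'g \<times> 'y"
      show "J (\<lambda>\<xi>. b1 \<xi> * e 0 v \<xi>) p = J (\<lambda>\<xi>. b2 \<xi> * e 0 v \<xi>) p"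
        using phi_J[of b1 "fst p" "snd p" v] phi_J[of b2 "fst p" "snd p" v] eq by simp
    qed
  qed (auto intro: Linf_mult_L2 b1 b2 e_L2)
  \<comment> \<open>The null set in \<open>ae\<close> depends on v. Countably many v keep the union
    of these sets null, and at each \<xi> \<in> \<Omega> one of them permits cancelling
    \<open>e 0 v \<xi>\<close>.\<close>
  obtain ys :: "nat \<Rightarrow> 'y" where ys: "\<And>\<xi>. \<xi> \<in> \<Omega> \<Longrightarrow> \<exists>n. q \<xi> (ys n) \<noteq> 0"
    using countable_nonvanishing by blast
  have "AE \<xi> in N. \<forall>n. b1 \<xi> * e 0 (ys n) \<xi> = b2 \<xi> * e 0 (ys n) \<xi>"
    unfolding AE_all_countable using ae by blast
  then show "AE \<xi> in N. b1 \<xi> = b2 \<xi>"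
  proof (rule AE_mp, intro AE_I2 impI)
    fix \<xi> assume "\<xi> \<in> space N" and a: "\<forall>n. b1 \<xi> * e 0 (ys n) \<xi> = b2 \<xi> * e 0 (ys n) \<xi>"
    then have \<xi>: "\<xi> \<in> \<Omega>" by (simp add: space_N)
    obtain n where "q \<xi> (ys n) \<noteq> 0" using ys[OF \<xi>] by blast
    then have "e 0 (ys n) \<xi> \<noteq> 0" by (simp add: e_def character_zero Omega_characters \<xi>)
    then show "b1 \<xi> = b2 \<xi>" using a by auto
  qed
next
  assume ae: "AE \<xi> in N. b1 \<xi> = b2 \<xi>"
  have "J (\<lambda>\<xi>. b1 \<xi> * e 0 v \<xi>) = J (\<lambda>\<xi>. b2 \<xi> * e 0 v \<xi>)" for v
    using ae by (intro J_cong_AE L2_measurable Linf_mult_L2 b1 b2 e_L2) auto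
  then show "phi \<nu> \<nu>h \<Omega> K b1 = phi \<nu> \<nu>h \<Omega> K b2" by (intro HOL.ext) (simp add: phi_J)
qed

lemma phi_lin:
  assumes b1: "b1 \<in> Linf N" and b2: "b2 \<in> Linf N"
  shows "phi \<nu> \<nu>h \<Omega> K (\<lambda>\<xi>. c * b1 \<xi> + b2 \<xi>) =
    (\<lambda>x y v. c * phi \<nu> \<nu>h \<Omega> K b1 x y v + phi \<nu> \<nu>h \<Omega> K b2 x y v)"
proof (intro HOL.ext)
  fix x y v
  note L = Linf_mult_L2[OF b1 e_L2[of 0 v]] Linf_mult_L2[OF b2 e_L2[of 0 v]]
  have "J (\<lambda>\<xi>. (c * b1 \<xi> + b2 \<xi>) * e 0 v \<xi>) = J (\<lambda>\<xi>. c * (b1 \<xi> * e 0 v \<xi>) + b2 \<xi> * e 0 v \<xi>)"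
    by (simp add: distrib_right mult.assoc)
  then show "phi \<nu> \<nu>h \<Omega> K (\<lambda>\<xi>. c * b1 \<xi> + b2 \<xi>) x y v = c * phi \<nu> \<nu>h \<Omega> K b1 x y v + phi \<nu> \<nu>h \<Omega> K b2 x y v"
    by (simp add: phi_J J_add J_scale L2_scale L)
qed

text \<open>The element of H representing evaluation of the convolution: S_\<psi> f (x,y) = <f, T
  \<psi> x y>. It is the translate by x of the second function in the definition of
  \<open>A0\<close>.\<close>

definition T :: "('g \<Rightarrow> 'y \<Rightarrow> 'y \<Rightarrow> complex) \<Rightarrow> 'g \<Rightarrow> 'y \<Rightarrow> 'g \<times> 'y \<Rightarrow> complex" where
  "T \<psi> x y = rho x (\<lambda>(u, v). cnj (\<psi> (- u) y v))"

lemma T_apply: "T \<psi> x y p = cnj (\<psi> (x - fst p) y (snd p))"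
  by (cases p) (simp add: T_def rho_def)

lemma T_H: "\<psi> \<in> A0 H \<Longrightarrow> T \<psi> x y \<in> H"
  unfolding T_def by (intro rho_H) (simp add: A0_def)

lemma Sop_T: "Sop M \<psi> f (x, y) = ip M f (T \<psi> x y)"
  by (simp add: Sop_def ip_def T_apply)

lemma Sop_rho:
  assumes \<psi>: "\<psi> \<in> A0 H" and f: "f \<in> H"
  shows "Sop M \<psi> (rho a f) = rho a (Sop M \<psi> f)"
proof (rule HOL.ext)
  fix p :: "'g \<times> 'y"
  obtain x y where p: "p = (x, y)" by (cases p)
  have "(\<lambda>r. f r * cnj (T \<psi> (x - a) y r)) \<in> borel_measurable M"
    using L2_measurable[OF H_L2[OF f]] L2_measurable[OF H_L2[OF T_H[OF \<psi>]]] by measurable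
  from integral_rho[OF this, of a]
  have "(\<integral>r. rho a f r * cnj (T \<psi> x y r) \<partial>M) = (\<integral>r. f r * cnj (T \<psi> (x - a) y r) \<partial>M)"
    by (simp add: rho_def split_beta' T_apply algebra_simps)
  then show "Sop M \<psi> (rho a f) p = rho a (Sop M \<psi> f) p"
    by (simp add: p rho_apply Sop_T ip_def)
qed

lemma Theta_Crho:
  assumes "\<psi> \<in> Aset M H"
  shows "restrict (Sop M \<psi>) H \<in> Crho M H"
  using assms unfolding Crho_def Aset_def by (auto simp: rho_H Sop_rho)

text \<open>The value of S_\<psi> K_{-x,v} at (0,y) is <K_{-x,v}, T \<psi> 0 y>, the conjugate of T
  \<psi> 0 y (-x,v), that is, \<psi>(x,y,v).\<close>

lemma Theta_inj:
  assumes \<psi>: "\<psi>1 \<in> A0 H" "\<psi>2 \<in> A0 H" and eq: "restrict (Sop M \<psi>1) H = restrict (Sop M \<psi>2) H"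
  shows "\<psi>1 = \<psi>2"
proof (intro HOL.ext)
  fix x y v
  have T: "T \<psi> 0 y (- x, v) = cnj (ip M (K (- x) v) (T \<psi> 0 y))" if "\<psi> \<in> A0 H" for \<psi>
    by (simp add: reproducing[OF T_H[OF that]] ip_cnj)
  have "Sop M \<psi>1 (K (- x) v) = Sop M \<psi>2 (K (- x) v)"
    using fun_cong[OF eq, of "K (- x) v"] by (simp add: K_H)
  then have "T \<psi>1 0 y (- x, v) = T \<psi>2 0 y (- x, v)" by (simp add: T \<psi> flip: Sop_T)
  then show "\<psi>1 x y v = \<psi>2 x y v" by (simp add: T_apply)
qed

lemma Theta_lin:
  assumes \<psi>: "\<psi>1 \<in> A0 H" "\<psi>2 \<in> A0 H" and f: "f \<in> H"
  shows "Sop M (\<lambda>x y v. c * \<psi>1 x y v + \<psi>2 x y v) f = (\<lambda>p. c * Sop M \<psi>1 f p + Sop M \<psi>2 f p)"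
proof (rule HOL.ext)
  fix p :: "'g \<times> 'y"
  obtain x y where p: "p = (x, y)" by (cases p)
  have i: "integrable M (\<lambda>r. f r * \<psi> (x - fst r) y (snd r))" if "\<psi> \<in> A0 H" for \<psi>
    using L2_ip_integrable[OF H_L2[OF f] H_L2[OF T_H[OF that]], of x y] by (simp add: T_apply)
  show "Sop M (\<lambda>x y v. c * \<psi>1 x y v + \<psi>2 x y v) f p = c * Sop M \<psi>1 f p + Sop M \<psi>2 f p"
    using i[OF \<psi>(1)] i[OF \<psi>(2)] by (simp add: p Sop_def distrib_left mult.left_commute)
qed

section \<open>The commutant consists of multipliers\<close>

lemma bop_lin: "S \<in> bop M H \<Longrightarrow> f \<in> H \<Longrightarrow> g \<in> H \<Longrightarrow> S (\<lambda>p. c * f p + g p) = (\<lambda>p. c * S f p + S g p)"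
  by (simp add: bop_def)

lemma bop_H: "S \<in> bop M H \<Longrightarrow> f \<in> H \<Longrightarrow> S f \<in> H"
  by (auto simp: bop_def)

lemma bop_scale:
  assumes "S \<in> bop M H" "f \<in> H"
  shows "S (\<lambda>p. c * f p) = (\<lambda>p. c * S f p)"
proof -
  have "S (\<lambda>_. 0) = (\<lambda>_. 0)" using bop_lin[OF assms(1) H_zero H_zero, of "-1"] by simp
  then show ?thesis using bop_lin[OF assms H_zero, of c] by simp
qed

text \<open>A single f' realizes multiplication by p for both R f and R (S f). For the evaluation at
  a it is the translate of f by -a, with which S commutes; linearity covers sums and
  multiples.\<close>

lemma trig_commute:
  assumes S: "S \<in> Crho M H" and f: "f \<in> H" and "p \<in> trig"
  shows "\<exists>f'\<in>H. (AE \<xi> in N. R f' \<xi> = p \<xi> * R f \<xi>) \<and> (AE \<xi> in N. R (S f') \<xi> = p \<xi> * R (S f) \<xi>)"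
  using assms(3)
proof induction
  have Sb: "S \<in> bop M H" and Sc: "\<And>a f. f \<in> H \<Longrightarrow> S (rho a f) = rho a (S f)"
    using S by (auto simp: Crho_def)
  have Sf: "S f \<in> H" by (rule bop_H[OF Sb f])
  {
    case (ev a)
    have "AE \<xi> in N. R (rho (- a) h) \<xi> = \<xi> a * R h \<xi>" if "h \<in> H" for h
      using R_rho[OF that, of "- a"] AE_space
      by eventually_elim (simp add: character_minus space_N_character)
    then show ?case using f Sf Sc by (intro bexI[of _ "rho (- a) f"]) (auto simp: rho_H)
  next
    case (add p p')
    then obtain f1 f2 where f1: "f1 \<in> H" "AE \<xi> in N. R f1 \<xi> = p \<xi> * R f \<xi>" "AE \<xi> in N. R (S f1) \<xi> = p \<xi> * R (S f) \<xi>"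
      and f2: "f2 \<in> H" "AE \<xi> in N. R f2 \<xi> = p' \<xi> * R f \<xi>" "AE \<xi> in N. R (S f2) \<xi> = p' \<xi> * R (S f) \<xi>" by blast
    show ?case
    proof (intro bexI conjI)
      show "(\<lambda>r. 1 * f1 r + f2 r) \<in> H" by (intro H_lin f1 f2)
      show "AE \<xi> in N. R (\<lambda>r. 1 * f1 r + f2 r) \<xi> = (p \<xi> + p' \<xi>) * R f \<xi>"
        using R_lin[OF f1(1) f2(1), of 1] f1(2) f2(2) by eventually_elim (simp add: distrib_right)
      show "AE \<xi> in N. R (S (\<lambda>r. 1 * f1 r + f2 r)) \<xi> = (p \<xi> + p' \<xi>) * R (S f) \<xi>"
        unfolding bop_lin[OF Sb f1(1) f2(1)]
        using R_lin[OF bop_H[OF Sb f1(1)] bop_H[OF Sb f2(1)], of 1] f1(3) f2(3)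
        by eventually_elim (simp add: distrib_right)
    qed
  next
    case (scale p c)
    then obtain f1 where f1: "f1 \<in> H" "AE \<xi> in N. R f1 \<xi> = p \<xi> * R f \<xi>" "AE \<xi> in N. R (S f1) \<xi> = p \<xi> * R (S f) \<xi>"
      by blast
    have Rs: "AE \<xi> in N. R (\<lambda>r. c * h r) \<xi> = c * R h \<xi>" if "h \<in> H" for h
      by (rule R_unique[OF H_scale[OF that] L2_scale[OF R_L2[OF that]]]) (simp add: J_scale J_R that)
    show ?case
    proof (intro bexI conjI)
      show "(\<lambda>r. c * f1 r) \<in> H" by (intro H_scale f1)
      show "AE \<xi> in N. R (\<lambda>r. c * f1 r) \<xi> = (c * p \<xi>) * R f \<xi>"
        using Rs[OF f1(1)] f1(2) by eventually_elim simp
      show "AE \<xi> in N. R (S (\<lambda>r. c * f1 r)) \<xi> = (c * p \<xi>) * R (S f) \<xi>"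
        unfolding bop_scale[OF Sb f1(1)]
        using Rs[OF bop_H[OF Sb f1(1)]] f1(3) by eventually_elim simp
    qed
  next
    case (ext p p')
    then obtain f1 where f1: "f1 \<in> H" "AE \<xi> in N. R f1 \<xi> = p \<xi> * R f \<xi>" "AE \<xi> in N. R (S f1) \<xi> = p \<xi> * R (S f) \<xi>"
      by blast
    have pp: "AE \<xi> in N. p' \<xi> = p \<xi>" using ext(2) by (auto simp: space_N_character)
    show ?case
    proof (intro bexI[OF _ f1(1)] conjI)
      show "AE \<xi> in N. R f1 \<xi> = p' \<xi> * R f \<xi>" using f1(2) pp by eventually_elim simp
      show "AE \<xi> in N. R (S f1) \<xi> = p' \<xi> * R (S f) \<xi>" using f1(3) pp by eventually_elim simp
    qed
  }
qed

text \<open>Test the norm bound on trigonometric multiples of \<open>f\<close> that approximate the indicator of the set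
  where the pointwise bound fails.\<close>

lemma Crho_pointwise_bound:
  assumes S: "S \<in> Crho M H" and C: "\<And>f. f \<in> H \<Longrightarrow> l2norm M (S f) \<le> C * l2norm M f" and f: "f \<in> H"
  shows "AE \<xi> in N. cmod (R (S f) \<xi>) \<le> \<bar>C\<bar> * cmod (R f \<xi>)"
proof -
  have Sf: "S h \<in> H" if "h \<in> H" for h using S that by (auto simp: Crho_def intro: bop_H)
  \<comment> \<open>The claim is that W is nonnegative almost everywhere. The square of C makes the
    sign of C irrelevant, hence the modulus in the conclusion.\<close>
  define W where "W \<xi> = C\<^sup>2 * (cmod (R f \<xi>))\<^sup>2 - (cmod (R (S f) \<xi>))\<^sup>2" for \<xi>
  define Wx where "Wx \<xi> = indicator \<Omega> \<xi> * W \<xi>" for \<xi>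
  have Wi: "integrable N W" unfolding W_def[abs_def]
    by (intro Bochner_Integration.integrable_diff integrable_mult_right L2_integrable_square R_L2 f Sf)
  then have Wxi: "integrable \<nu>h Wx" unfolding integrable_N_real Wx_def[abs_def] .
  have [measurable]: "Wx \<in> borel_measurable \<nu>h" using Wxi by (rule borel_measurable_integrable)
  \<comment> \<open>This is the norm bound for S at the element f' with R f' = p * R f: the integral
    equals C^2 |f'|^2 - |S f'|^2 in the norm of H.\<close>
  have pos: "(\<integral>\<xi>. (cmod (p \<xi>))\<^sup>2 * Wx \<xi> \<partial>\<nu>h) \<ge> 0" "integrable \<nu>h (\<lambda>\<xi>. (cmod (p \<xi>))\<^sup>2 * Wx \<xi>)" if p: "p \<in> trig" for p
  proof -
    have pm: "p \<in> borel_measurable \<nu>h" using p by (rule trig_measurable[OF _ space_dual sets_dual])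
    have [measurable]: "p \<in> borel_measurable N" by (rule measurable_restrict_space1[OF pm])
    have [measurable]: "R f \<in> borel_measurable N" "R (S f) \<in> borel_measurable N"
      by (intro L2_measurable R_L2 f Sf)+
    obtain f' where f': "f' \<in> H" "AE \<xi> in N. R f' \<xi> = p \<xi> * R f \<xi>" "AE \<xi> in N. R (S f') \<xi> = p \<xi> * R (S f) \<xi>"
      using trig_commute[OF S f p] by blast
    have i1: "(\<lambda>\<xi>. p \<xi> * R f \<xi>) \<in> L2 N"
      by (rule L2_cong_AE[OF R_L2[OF f'(1)] _ f'(2)]) measurable
    have i2: "(\<lambda>\<xi>. p \<xi> * R (S f) \<xi>) \<in> L2 N"
      by (rule L2_cong_AE[OF R_L2[OF Sf[OF f'(1)]] _ f'(3)]) measurable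
    have n1: "l2norm N (\<lambda>\<xi>. p \<xi> * R f \<xi>) = l2norm M f'"
      unfolding l2norm_R[OF f'(1), symmetric]
      by (intro l2norm_cong_AE L2_measurable[OF i1] L2_measurable[OF R_L2] f' AE_symmetric[OF f'(2)])
    have n2: "l2norm N (\<lambda>\<xi>. p \<xi> * R (S f) \<xi>) = l2norm M (S f')"
      unfolding l2norm_R[OF Sf[OF f'(1)], symmetric]
      by (intro l2norm_cong_AE L2_measurable[OF i2] L2_measurable[OF R_L2] Sf f' AE_symmetric[OF f'(3)])
    have eq: "(cmod (p \<xi>))\<^sup>2 * W \<xi> = C\<^sup>2 * (cmod (p \<xi> * R f \<xi>))\<^sup>2 - (cmod (p \<xi> * R (S f) \<xi>))\<^sup>2" for \<xi>
      by (simp add: W_def norm_mult power_mult_distrib algebra_simps)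
    have "integrable N (\<lambda>\<xi>. (cmod (p \<xi>))\<^sup>2 * W \<xi>)"
      unfolding eq by (intro Bochner_Integration.integrable_diff integrable_mult_right L2_integrable_square i1 i2)
    then show "integrable \<nu>h (\<lambda>\<xi>. (cmod (p \<xi>))\<^sup>2 * Wx \<xi>)"
      unfolding integrable_N_real Wx_def by (simp add: mult.left_commute)
    have "(\<integral>\<xi>. (cmod (p \<xi>))\<^sup>2 * Wx \<xi> \<partial>\<nu>h) = (\<integral>\<xi>. (cmod (p \<xi>))\<^sup>2 * W \<xi> \<partial>N)"
      unfolding integral_N_real Wx_def by (simp add: mult.left_commute)
    also have "\<dots> = C\<^sup>2 * (l2norm M f')\<^sup>2 - (l2norm M (S f'))\<^sup>2"
      unfolding eq n1[symmetric] n2[symmetric] l2norm_square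
      using L2_integrable_square[OF i1] L2_integrable_square[OF i2] by simp
    also have "\<dots> \<ge> 0"
      using power_mono[OF C[OF f'(1)] l2norm_nonneg, of 2] by (simp add: power_mult_distrib)
    finally show "(\<integral>\<xi>. (cmod (p \<xi>))\<^sup>2 * Wx \<xi> \<partial>\<nu>h) \<ge> 0" .
  qed
  define A where "A = {\<xi> \<in> space \<nu>h. Wx \<xi> < 0}"
  have A [measurable]: "A \<in> sets \<nu>h" unfolding A_def by measurable
  have negi: "integrable \<nu>h (\<lambda>\<xi>. max 0 (- Wx \<xi>))" using Wxi by simp
  have "(\<integral>\<xi>. max 0 (- Wx \<xi>) \<partial>\<nu>h) \<le> 0"
  proof (rule field_le_epsilon)
    fix \<epsilon> :: real assume "\<epsilon> > 0"
    then have \<epsilon>2: "\<epsilon> / 2 > 0" by simp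
    have "integrable \<nu>h (\<lambda>\<xi>. \<bar>Wx \<xi>\<bar> * (cmod (indicator A \<xi>))\<^sup>2)"
      by (rule Bochner_Integration.integrable_bound[OF integrable_norm[OF Wxi]]) (auto simp: indicator_def)
    then obtain p where p: "p \<in> trig" "(\<integral>\<xi>. \<bar>Wx \<xi>\<bar> * (cmod (indicator A \<xi> - p \<xi>))\<^sup>2 \<partial>\<nu>h) < \<epsilon> / 2"
        and i: "integrable \<nu>h (\<lambda>\<xi>. \<bar>Wx \<xi>\<bar> * (cmod (indicator A \<xi> - p \<xi>))\<^sup>2)"
      using weighted_trig_dense[of "\<lambda>\<xi>. \<bar>Wx \<xi>\<bar>" "indicator A", OF integrable_abs[OF Wxi] abs_ge_zero _ _ \<epsilon>2] A
      by auto
    \<comment> \<open>Pointwise domination: on A it is 1 \<le> 2|1 - p|^2 + 2|p|^2 multiplied by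
      -Wx. Off A the two terms on the right cancel, as Wx is nonnegative and the indicator is
      0.\<close>
    have "(\<integral>\<xi>. max 0 (- Wx \<xi>) \<partial>\<nu>h) \<le>
       (\<integral>\<xi>. 2 * (\<bar>Wx \<xi>\<bar> * (cmod (indicator A \<xi> - p \<xi>))\<^sup>2) - 2 * ((cmod (p \<xi>))\<^sup>2 * Wx \<xi>) \<partial>\<nu>h)"
    proof (rule integral_mono[OF negi])
      show "integrable \<nu>h (\<lambda>\<xi>. 2 * (\<bar>Wx \<xi>\<bar> * (cmod (indicator A \<xi> - p \<xi>))\<^sup>2) - 2 * ((cmod (p \<xi>))\<^sup>2 * Wx \<xi>))"
        using i pos(2)[OF p(1)] by (intro Bochner_Integration.integrable_diff integrable_mult_right)
      fix \<xi> assume \<xi>: "\<xi> \<in> space \<nu>h"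
      show "max 0 (- Wx \<xi>) \<le> 2 * (\<bar>Wx \<xi>\<bar> * (cmod (indicator A \<xi> - p \<xi>))\<^sup>2) - 2 * ((cmod (p \<xi>))\<^sup>2 * Wx \<xi>)"
      proof (cases "Wx \<xi> < 0")
        case True
        then have ind: "(indicator A \<xi> :: complex) = 1" using \<xi> by (simp add: A_def)
        have "1 \<le> cmod (1 - p \<xi>) + cmod (p \<xi>)" using norm_triangle_ineq[of "1 - p \<xi>" "p \<xi>"] by simp
        then have "1 \<le> (cmod (1 - p \<xi>) + cmod (p \<xi>))\<^sup>2" by (simp add: power2_eq_square mult_ge1_I)
        also have "\<dots> \<le> 2 * (cmod (1 - p \<xi>))\<^sup>2 + 2 * (cmod (p \<xi>))\<^sup>2"
          using zero_le_power2[of "cmod (1 - p \<xi>) - cmod (p \<xi>)"] by (simp add: power2_eq_square algebra_simps)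
        finally have "- Wx \<xi> * 1 \<le> - Wx \<xi> * (2 * (cmod (1 - p \<xi>))\<^sup>2 + 2 * (cmod (p \<xi>))\<^sup>2)"
          using True by (intro mult_left_mono) auto
        then show ?thesis using True unfolding ind by (simp add: algebra_simps)
      next
        case False
        then have "(indicator A \<xi> :: complex) = 0" by (simp add: A_def)
        then show ?thesis using False by (simp add: mult.commute)
      qed
    qed
    also have "\<dots> = 2 * (\<integral>\<xi>. \<bar>Wx \<xi>\<bar> * (cmod (indicator A \<xi> - p \<xi>))\<^sup>2 \<partial>\<nu>h) - 2 * (\<integral>\<xi>. (cmod (p \<xi>))\<^sup>2 * Wx \<xi> \<partial>\<nu>h)"
      using i pos(2)[OF p(1)] by simp
    also have "\<dots> \<le> 0 + \<epsilon>" using p(2) pos(1)[OF p(1)] by simp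
    finally show "(\<integral>\<xi>. max 0 (- Wx \<xi>) \<partial>\<nu>h) \<le> 0 + \<epsilon>" .
  qed
  moreover have "(\<integral>\<xi>. max 0 (- Wx \<xi>) \<partial>\<nu>h) \<ge> 0" by (intro integral_nonneg_AE) auto
  ultimately have "(\<integral>\<xi>. max 0 (- Wx \<xi>) \<partial>\<nu>h) = 0" by linarith
  then have "AE \<xi> in \<nu>h. max 0 (- Wx \<xi>) = 0"
    using integral_nonneg_eq_0_iff_AE[OF negi] by simp
  then show ?thesis unfolding AE_N_iff
  proof eventually_elim
    case (elim \<xi>)
    show ?case
    proof
      assume "\<xi> \<in> \<Omega>"
      then have "(cmod (R (S f) \<xi>))\<^sup>2 \<le> C\<^sup>2 * (cmod (R f \<xi>))\<^sup>2" using elim by (simp add: Wx_def W_def max_def split: if_splits)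
      then have "(cmod (R (S f) \<xi>))\<^sup>2 \<le> (\<bar>C\<bar> * cmod (R f \<xi>))\<^sup>2" by (simp add: power_mult_distrib)
      then show "cmod (R (S f) \<xi>) \<le> \<bar>C\<bar> * cmod (R f \<xi>)" by (rule power2_le_imp_le) simp
    qed
  qed
qed

lemma Crho_eq_V:
  assumes S: "S \<in> Crho M H"
  obtains b where "b \<in> Linf N" "\<And>f. f \<in> H \<Longrightarrow> S f = V b f"
proof -
  have Sb: "S \<in> bop M H" using S by (simp add: Crho_def)
  note SH = bop_H[OF Sb]
  obtain C where C: "\<And>f. f \<in> H \<Longrightarrow> l2norm M (S f) \<le> C * l2norm M f"
    using Sb unfolding bop_def by blast
  have bound: "AE \<xi> in N. cmod (R (S f) \<xi>) \<le> \<bar>C\<bar> * cmod (R f \<xi>)" if "f \<in> H" for f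
    by (rule Crho_pointwise_bound[OF S C that])
  \<comment> \<open>Sigma-finiteness gives a strictly positive integrable function; since g \<le> 1,
    also g^2 \<le> g is integrable. Its image under J is an element of H on which division by R f0
    is possible almost everywhere.\<close>
  obtain g :: "('g \<Rightarrow> complex) \<Rightarrow> real" where g: "g \<in> borel_measurable N" "\<And>\<xi>. g \<xi> > 0" "\<And>\<xi>. g \<xi> \<le> 1" "integrable N g"
    using N.obtain_positive_integrable_function by metis
  define g0 where "g0 \<xi> = complex_of_real (g \<xi>)" for \<xi>
  have g0L: "g0 \<in> L2 N"
  proof -
    have "integrable N (\<lambda>\<xi>. (cmod (g0 \<xi>))\<^sup>2)"
    proof (rule Bochner_Integration.integrable_bound[OF g(4)])
      show "AE \<xi> in N. norm ((cmod (g0 \<xi>))\<^sup>2) \<le> norm (g \<xi>)"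
        using g(2,3) by (intro AE_I2) (simp add: g0_def power2_eq_square mult_left_le less_imp_le abs_of_pos)
    qed (use g(1) in \<open>simp add: g0_def[abs_def]\<close>)
    then show ?thesis using g(1) by (simp add: L2_def g0_def[abs_def])
  qed
  define f0 where "f0 = J g0"
  have f0: "f0 \<in> H" unfolding f0_def by (rule J_H[OF g0L])
  have R0: "AE \<xi> in N. R f0 \<xi> \<noteq> 0"
    unfolding f0_def using R_J[OF g0L]
  proof eventually_elim
    case (elim \<xi>)
    then show ?case using g(2)[of \<xi>] by (simp add: g0_def)
  qed
  define b where "b \<xi> = R (S f0) \<xi> / R f0 \<xi>" for \<xi>
  have [measurable]: "R f0 \<in> borel_measurable N" "R (S f0) \<in> borel_measurable N"
    by (intro L2_measurable R_L2 f0 SH)+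
  have bm: "b \<in> borel_measurable N" unfolding b_def[abs_def] by measurable
  have "AE \<xi> in N. cmod (b \<xi>) \<le> \<bar>C\<bar>"
    using bound[OF f0] R0 by eventually_elim (simp add: b_def norm_divide divide_le_eq)
  then have bL: "b \<in> Linf N" using bm by (auto simp: Linf_def)
  obtain D :: "complex set" where D: "countable D" "\<And>X. open X \<Longrightarrow> X \<noteq> {} \<Longrightarrow> \<exists>d\<in>D. d \<in> X"
    using countable_dense_setE by blast
  show ?thesis
  proof (rule that[OF bL])
    fix f assume f: "f \<in> H"
    \<comment> \<open>Countability yields one null set valid for all these scalars; continuity in
      \<alpha> then gives the inequality at each remaining \<xi> for every complex scalar.\<close>
    have "AE \<xi> in N. \<forall>\<alpha>\<in>D. cmod (R (S f) \<xi> - \<alpha> * R (S f0) \<xi>) \<le> \<bar>C\<bar> * cmod (R f \<xi> - \<alpha> * R f0 \<xi>)"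
      unfolding AE_ball_countable[OF D(1)]
    proof
      fix \<alpha>
      have "AE \<xi> in N. cmod (R (S (\<lambda>p. - \<alpha> * f0 p + f p)) \<xi>) \<le> \<bar>C\<bar> * cmod (R (\<lambda>p. - \<alpha> * f0 p + f p) \<xi>)"
        by (rule bound[OF H_lin[OF f0 f]])
      then have "AE \<xi> in N. cmod (R (\<lambda>p. - \<alpha> * S f0 p + S f p) \<xi>) \<le> \<bar>C\<bar> * cmod (R (\<lambda>p. - \<alpha> * f0 p + f p) \<xi>)"
        unfolding bop_lin[OF Sb f0 f] .
      then show "AE \<xi> in N. cmod (R (S f) \<xi> - \<alpha> * R (S f0) \<xi>) \<le> \<bar>C\<bar> * cmod (R f \<xi> - \<alpha> * R f0 \<xi>)"
        using R_lin[OF f0 f, of "- \<alpha>"] R_lin[OF SH[OF f0] SH[OF f], of "- \<alpha>"] by eventually_elim simp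
    qed
    then have ae: "AE \<xi> in N. R (S f) \<xi> = b \<xi> * R f \<xi>"
      using R0
    proof eventually_elim
      case (elim \<xi>)
      define F where "F = {\<alpha>. cmod (R (S f) \<xi> - \<alpha> * R (S f0) \<xi>) \<le> \<bar>C\<bar> * cmod (R f \<xi> - \<alpha> * R f0 \<xi>)}"
      have "closed F" unfolding F_def by (intro closed_Collect_le continuous_intros)
      then have "open (- F)" by (rule open_Compl)
      have "- F = {}"
      proof (rule ccontr)
        assume "- F \<noteq> {}"
        then obtain d where "d \<in> D" "d \<in> - F" using D(2)[OF \<open>open (- F)\<close>] by blast
        then show False using elim(1) by (simp add: F_def)
      qed
      \<comment> \<open>The scalar may now depend on \<xi>, and this one makes the right side of the
        inequality 0.\<close>
      then have "R f \<xi> / R f0 \<xi> \<in> F" by blast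
      then have "cmod (R (S f) \<xi> - R f \<xi> / R f0 \<xi> * R (S f0) \<xi>) \<le> 0"
        using elim(2) by (simp add: F_def)
      then show ?case by (simp add: b_def)
    qed
    have "S f = J (R (S f))" by (simp add: J_R SH f)
    also have "\<dots> = V b f"
      unfolding V_def by (intro J_cong_AE L2_measurable R_L2 Linf_mult_L2 bL SH f ae)
    finally show "S f = V b f" .
  qed
qed

lemma Crho_eq_Theta_phi:
  assumes S: "S \<in> Crho M H"
  obtains b where "b \<in> Linf N" "S = restrict (Sop M (phi \<nu> \<nu>h \<Omega> K b)) H"
proof -
  obtain b where b: "b \<in> Linf N" "\<And>f. f \<in> H \<Longrightarrow> S f = V b f" using Crho_eq_V[OF S] by blast
  \<comment> \<open>Members of \<open>bop\<close> have a fixed default value outside H, so agreement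
    on H is equality of operators.\<close>
  have "S \<in> extensional H" using S by (simp add: Crho_def bop_def)
  then have "S = restrict (V b) H" using b(2) by (auto simp: restrict_def extensional_def)
  then show ?thesis using that[OF b(1)] restrict_Sop_phi[OF b(1)] by simp
qed

lemma phi_surj:
  assumes \<psi>: "\<psi> \<in> Aset M H"
  shows "\<exists>b\<in>Linf N. phi \<nu> \<nu>h \<Omega> K b = \<psi>"
proof -
  obtain b where b: "b \<in> Linf N" "restrict (Sop M \<psi>) H = restrict (Sop M (phi \<nu> \<nu>h \<Omega> K b)) H"
    using Crho_eq_Theta_phi[OF Theta_Crho[OF \<psi>]] by metis
  have "\<psi> = phi \<nu> \<nu>h \<Omega> K b"
    using \<psi> by (intro Theta_inj phi_A0 b) (simp add: Aset_def)
  then show ?thesis using b(1) by blast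
qed

lemma Theta_bij: "bij_betw (\<lambda>\<psi>. restrict (Sop M \<psi>) H) (Aset M H) (Crho M H)"
proof (rule bij_betwI')
  fix \<psi>1 \<psi>2 assume "\<psi>1 \<in> Aset M H" "\<psi>2 \<in> Aset M H"
  then show "(restrict (Sop M \<psi>1) H = restrict (Sop M \<psi>2) H) = (\<psi>1 = \<psi>2)"
    using Theta_inj[of \<psi>1 \<psi>2] by (auto simp: Aset_def)
next
  show "restrict (Sop M \<psi>) H \<in> Crho M H" if "\<psi> \<in> Aset M H" for \<psi> using Theta_Crho[OF that] .
next
  fix S assume "S \<in> Crho M H"
  then obtain b where "b \<in> Linf N" "S = restrict (Sop M (phi \<nu> \<nu>h \<Omega> K b)) H" by (rule Crho_eq_Theta_phi)
  then show "\<exists>\<psi>\<in>Aset M H. S = restrict (Sop M \<psi>) H" using phi_Aset by blast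
qed

end

theorem theorem5p16:
  fixes \<nu> :: "'g::{ab_group_add,metric_space} measure"
    and \<mu> :: "'y measure"
    and \<nu>h :: "('g \<Rightarrow> complex) measure"
    and H :: "('g \<times> 'y \<Rightarrow> complex) set"
    and K :: "'g \<Rightarrow> 'y \<Rightarrow> ('g \<times> 'y \<Rightarrow> complex)"
    and q :: "('g \<Rightarrow> complex) \<Rightarrow> 'y \<Rightarrow> complex"
  defines "\<Omega> \<equiv> Omega \<nu> K"
  defines "M \<equiv> \<nu> \<Otimes>\<^sub>M \<mu>"
  defines "\<Phi> \<equiv> (\<lambda>b. phi \<nu> \<nu>h \<Omega> K b)"
  defines "\<Theta> \<equiv> (\<lambda>\<psi>. restrict (Sop M \<psi>) H)"
  defines "\<Lambda> \<equiv> (\<lambda>b. restrict (Vop \<nu> \<nu>h \<mu> H \<Omega> q b) H)"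
  assumes G: "lc_metr_sigma_compact_group TYPE('g)"
    and haar: "haar_measure \<nu>"
    and Y: "sigma_finite_measure \<mu>" "space \<mu> = UNIV"
    and sep: "separable_L2 \<nu>" "separable_L2 \<mu>"
    and rkhs: "rkhs_L2 M H (\<lambda>(x, y). K x y)"
    and Ktrans: "\<And>u x v y. K x y (u, v) = K 0 y (u - x, v)"
    and Kint: "\<And>y. \<exists>C::real. \<forall>v. (\<integral>\<^sup>+u. ennreal (cmod (K 0 y (u, v))) \<partial>\<nu>) \<le> ennreal C"
    and dual: "dual_plancherel_measure \<nu> \<nu>h"
    and \<Omega>meas: "\<Omega> \<in> sets \<nu>h"
    and qmeas: "(\<lambda>p. q (fst p) (snd p)) \<in> borel_measurable (restrict_space \<nu>h \<Omega> \<Otimes>\<^sub>M \<mu>)"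
    and qfac: "\<And>\<xi> y v. \<xi> \<in> \<Omega> \<Longrightarrow> LK \<nu> K \<xi> y v = cnj (q \<xi> y) * q \<xi> v"
  shows "(\<forall>b\<in>Linf (restrict_space \<nu>h \<Omega>). \<Phi> b \<in> Aset M H)
     \<and> (\<forall>b1\<in>Linf (restrict_space \<nu>h \<Omega>). \<forall>b2\<in>Linf (restrict_space \<nu>h \<Omega>).
          \<Phi> b1 = \<Phi> b2 \<longleftrightarrow> (AE \<xi> in restrict_space \<nu>h \<Omega>. b1 \<xi> = b2 \<xi>))
     \<and> (\<forall>\<psi>\<in>Aset M H. \<exists>b\<in>Linf (restrict_space \<nu>h \<Omega>). \<Phi> b = \<psi>)
     \<and> (\<forall>b1\<in>Linf (restrict_space \<nu>h \<Omega>). \<forall>b2\<in>Linf (restrict_space \<nu>h \<Omega>). \<forall>c::complex.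
          \<Phi> (\<lambda>\<xi>. c * b1 \<xi> + b2 \<xi>) = (\<lambda>x y v. c * \<Phi> b1 x y v + \<Phi> b2 x y v))
     \<and> (\<forall>\<psi>\<in>Aset M H. \<Theta> \<psi> \<in> Crho M H)
     \<and> bij_betw \<Theta> (Aset M H) (Crho M H)
     \<and> (\<forall>\<psi>1\<in>Aset M H. \<forall>\<psi>2\<in>Aset M H. \<forall>c::complex.
          \<Theta> (\<lambda>x y v. c * \<psi>1 x y v + \<psi>2 x y v) = restrict (\<lambda>f p. c * \<Theta> \<psi>1 f p + \<Theta> \<psi>2 f p) H)
     \<and> (\<forall>b\<in>Linf (restrict_space \<nu>h \<Omega>). \<Theta> (\<Phi> b) = \<Lambda> b)"
proof -
  interpret mu: sigma_finite_measure \<mu> by (rule Y(1))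
  interpret rkhs_setting \<nu> \<nu>h \<mu> H K q
    by unfold_locales
      (use G haar Y sep rkhs Ktrans Kint dual \<Omega>meas qmeas qfac in \<open>simp_all add: \<Omega>_def M_def\<close>)
  show ?thesis
    unfolding \<Phi>_def \<Theta>_def \<Lambda>_def \<Omega>_def M_def
  proof (intro conjI ballI allI)
    fix \<psi>1 \<psi>2 c assume "\<psi>1 \<in> Aset (\<nu> \<Otimes>\<^sub>M \<mu>) H" "\<psi>2 \<in> Aset (\<nu> \<Otimes>\<^sub>M \<mu>) H"
    then have A: "\<psi>1 \<in> A0 H" "\<psi>2 \<in> A0 H" by (auto simp: Aset_def)
    show "restrict (Sop (\<nu> \<Otimes>\<^sub>M \<mu>) (\<lambda>x y v. c * \<psi>1 x y v + \<psi>2 x y v)) H =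
      restrict (\<lambda>f p. c * restrict (Sop (\<nu> \<Otimes>\<^sub>M \<mu>) \<psi>1) H f p + restrict (Sop (\<nu> \<Otimes>\<^sub>M \<mu>) \<psi>2) H f p) H"
      by (rule restrict_ext) (simp add: Theta_lin[OF A])
  next
    fix b assume b: "b \<in> Linf (restrict_space \<nu>h (Omega \<nu> K))"
    show "restrict (Sop (\<nu> \<Otimes>\<^sub>M \<mu>) (phi \<nu> \<nu>h (Omega \<nu> K) K b)) H = restrict (Vop \<nu> \<nu>h \<mu> H (Omega \<nu> K) q b) H"
      by (rule restrict_ext) (simp add: Sop_phi[OF b] Vop_eq[OF b])
  qed (auto simp: phi_Aset phi_eq_iff phi_surj phi_lin Theta_Crho Theta_bij)
qed

end
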